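(* Let $u \in C^2(\mathbb{R}^n)$ be an even function such that its Hessian matrix $\nabla^2 u$ is positive definite (at every point), and let $\mu$ be the associated log-concave measure on $\mathbb{R}^n$ with density $\mathrm{d}\mu(x)=e^{-u(x)}\,\mathrm{d}x$. Suppose that for every origin-symmetric set $K \subset \mathbb{R}^n$ of class $C^2_+$, $$\frac{\mu(K)}{\int_{\partial K} h_K(\nu_K)\,\mathrm{d}\mu} \leq p(\mu,K).$$ Then, for every compact, convex and origin-symmetric set $K\subset\mathbb{R}^n$, the function $$t \mapsto \mu(e^t K)$$ is log-concave for $t \in \mathbb{R}$.
   Context: A set $K\subset\mathbb{R}^n$ is of class $C^2_+$ if it is compact and convex with non-empty interior and its boundary $\partial K$ is a manifold of class $C^2$ with strictly positive principal curvatures. $K$ is origin-symmetric if $K=-K$. For a non-empty compact convex $K\subset\mathbb{R}^n$, its support function is $h_K(x)=\sup_{y\in K}\langle x,y\rangle$. If $K$ is of class $C^2_+$, $\nu_K:\partial K\to\mathbb{S}^{n-1}$ denotes its Gauss map (outer unit normal). The symbol $\mathrm{d}\mu$ is used both for integration on $K$ (density $e^{-u}$ with respect to Lebesgue measure) and for integration on $\partial K$, where it means density $e^{-u}$ with respect to the $(n-1)$-dimensional Hausdorff measure on $\partial K$. Concavity power: let $K$ be of class $C^2_+$. For every $\rho\in C^2(\partial K)$ there is $\varepsilon>0$ such that for all $|t|<\varepsilon$ the function $h_t=h_K+t\,\rho(\nu_K^{-1})$ (on $\mathbb{S}^{n-1}$) is the support function of a compact convex set of class $C^2_+$, denoted $K(\rho,t)$.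 The concavity power of $K$ with respect to $\mu$ is the maximal exponent $p(\mu,K)$ such that $$\left.\frac{\mathrm{d}^2}{\mathrm{d}t^2}\,\mu\bigl(K(\rho,t)\bigr)^{p(\mu,K)}\right|_{t=0}\leq 0\quad\text{for every }\rho\in C^2(\partial K).$$ *)

theory Defs
  imports "HOL-Analysis.Analysis"
begin

section \<open>Functions of class C2\<close>

definition C2_on :: "'a::real_normed_vector set \<Rightarrow> ('a \<Rightarrow> 'b::real_normed_vector) \<Rightarrow> bool" where
  "C2_on S f \<longleftrightarrow>
     (\<exists>(f' :: 'a \<Rightarrow> 'a \<Rightarrow>\<^sub>L 'b) (f'' :: 'a \<Rightarrow> 'a \<Rightarrow>\<^sub>L ('a \<Rightarrow>\<^sub>L 'b)).
        (\<forall>x\<in>S. (f has_derivative blinfun_apply (f' x)) (at x)) \<and>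
        (\<forall>x\<in>S. (f' has_derivative blinfun_apply (f'' x)) (at x)) \<and>
        continuous_on S f'')"

definition partial_deriv :: "'n::finite \<Rightarrow> (real^'n \<Rightarrow> real) \<Rightarrow> real^'n \<Rightarrow> real" where
  "partial_deriv i f x = frechet_derivative f (at x) (axis i 1)"

definition hessian :: "(real^'n \<Rightarrow> real) \<Rightarrow> real^'n::finite \<Rightarrow> real^'n^'n" where
  "hessian f x = (\<chi> i j. partial_deriv i (partial_deriv j f) x)"

definition positive_definite :: "real^'n^'n::finite \<Rightarrow> bool" where
  "positive_definite A \<longleftrightarrow> (\<forall>v. v \<noteq> 0 \<longrightarrow> 0 < v \<bullet> (A *v v))"

text \<open>The existence of the second derivative at the point is part of the predicate; there is no
  default value for functions that are not twice differentiable there.\<close>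

definition has_second_derivative :: "(real \<Rightarrow> real) \<Rightarrow> real \<Rightarrow> real \<Rightarrow> bool" where
  "has_second_derivative f D x \<longleftrightarrow>
     (\<exists>f'. (\<forall>\<^sub>F t in nhds x. (f has_real_derivative f' t) (at t)) \<and>
           (f' has_real_derivative D) (at x))"

text \<open>Log-concavity in the multiplicative form, which allows the value 0 (logarithm \<open>-\<infinity>\<close>).\<close>

definition log_concave_fun :: "(real \<Rightarrow> real) \<Rightarrow> bool" where
  "log_concave_fun f \<longleftrightarrow>
     (\<forall>x. 0 \<le> f x) \<and>
     (\<forall>x y. \<forall>l\<in>{0<..<1}. f x powr (1 - l) * f y powr l \<le> f ((1 - l) * x + l * y))"

section \<open>Hausdorff measure\<close>

text \<open>The \<open>d\<close>-dimensional Hausdorff measure, normalised so that it agrees with Lebesgue measure on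
  \<open>d\<close>-dimensional Euclidean space. Empty sets of a cover contribute 0 also for \<open>d = 0\<close>, where
  \<open>0 ^ 0 = 1\<close> would otherwise count them. The requirement \<open>bounded (U i)\<close> is needed because
  \<open>diameter\<close> is real-valued and meaningless on unbounded sets.\<close>

definition hausdorff_premeasure :: "nat \<Rightarrow> real \<Rightarrow> 'a::metric_space set \<Rightarrow> ennreal" where
  "hausdorff_premeasure d \<delta> A =
     (INF U \<in> {U :: nat \<Rightarrow> 'a set. A \<subseteq> (\<Union>i. U i) \<and> (\<forall>i. bounded (U i) \<and> diameter (U i) \<le> \<delta>)}.
        \<Sum>i. if U i = {} then 0
             else ennreal (unit_ball_vol (real d) * (diameter (U i) / 2) ^ d))"

definition hausdorff_outer_measure :: "nat \<Rightarrow> 'a::metric_space set \<Rightarrow> ennreal" where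
  "hausdorff_outer_measure d A = (SUP \<delta>\<in>{0<..}. hausdorff_premeasure d \<delta> A)"

definition hausdorff_measure :: "nat \<Rightarrow> 'a::metric_space measure" where
  "hausdorff_measure d = measure_of UNIV (sets borel) (hausdorff_outer_measure d)"

section \<open>Convex bodies of class C2+\<close>

text \<open>Embedded hypersurfaces of class C2, as local regular level sets.\<close>

definition C2_hypersurface :: "'a::euclidean_space set \<Rightarrow> bool" where
  "C2_hypersurface M \<longleftrightarrow>
     (\<forall>x\<in>M. \<exists>U (g :: 'a \<Rightarrow> real). open U \<and> x \<in> U \<and> C2_on U g \<and>
        M \<inter> U = {y\<in>U. g y = 0} \<and>
        (\<forall>y\<in>M \<inter> U. frechet_derivative g (at y) \<noteq> (\<lambda>v. 0)))"

text \<open>A function on a submanifold is of class C2 if locally it is the restriction of a C2 function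
  on an open subset of the ambient space.\<close>

definition C2_function_on :: "'a::euclidean_space set \<Rightarrow> ('a \<Rightarrow> real) \<Rightarrow> bool" where
  "C2_function_on M \<rho> \<longleftrightarrow>
     (\<forall>x\<in>M. \<exists>U (g :: 'a \<Rightarrow> real). open U \<and> x \<in> U \<and> C2_on U g \<and> (\<forall>y\<in>M \<inter> U. \<rho> y = g y))"

definition support_function :: "'a::euclidean_space set \<Rightarrow> 'a \<Rightarrow> real" where
  "support_function K x = (SUP y\<in>K. x \<bullet> y)"

text \<open>The outer unit normal of a convex body at a (smooth) boundary point.\<close>

definition gauss_map :: "'a::euclidean_space set \<Rightarrow> 'a \<Rightarrow> 'a" where
  "gauss_map K x = (THE v. norm v = 1 \<and> (\<forall>y\<in>K. v \<bullet> (y - x) \<le> 0))"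

text \<open>Principal curvatures are the eigenvalues of the differential of the Gauss map on the tangent
  space of the boundary, i.e. on the orthogonal complement of the normal. The derivative within
  the boundary is determined only on the tangent space.\<close>

definition principal_curvature :: "'a::euclidean_space set \<Rightarrow> 'a \<Rightarrow> real \<Rightarrow> bool" where
  "principal_curvature K x \<kappa> \<longleftrightarrow>
     (\<exists>D v. (gauss_map K has_derivative D) (at x within frontier K) \<and>
            v \<noteq> 0 \<and> v \<bullet> gauss_map K x = 0 \<and> D v = \<kappa> *\<^sub>R v)"

definition C2_plus :: "'a::euclidean_space set \<Rightarrow> bool" where
  "C2_plus K \<longleftrightarrow> compact K \<and> convex K \<and> interior K \<noteq> {} \<and> C2_hypersurface (frontier K) \<and>
     (\<forall>x\<in>frontier K. \<forall>\<kappa>. principal_curvature K x \<kappa> \<longrightarrow> 0 < \<kappa>)"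

definition origin_symmetric :: "'a::real_vector set \<Rightarrow> bool" where
  "origin_symmetric K \<longleftrightarrow> K = uminus ` K"

section \<open>The weighted measures\<close>

definition weighted_measure :: "('a::euclidean_space \<Rightarrow> real) \<Rightarrow> 'a measure" where
  "weighted_measure u = density lborel (\<lambda>x. ennreal (exp (- u x)))"

definition weighted_boundary_measure ::
    "('a::euclidean_space \<Rightarrow> real) \<Rightarrow> 'a set \<Rightarrow> 'a measure" where
  "weighted_boundary_measure u K =
     density (restrict_space (hausdorff_measure (DIM('a) - 1)) (frontier K))
       (\<lambda>x. ennreal (exp (- u x)))"

section \<open>Concavity power\<close>

definition is_perturbation ::
    "'a::euclidean_space set \<Rightarrow> ('a \<Rightarrow> real) \<Rightarrow> real \<Rightarrow> 'a set \<Rightarrow> bool" where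
  "is_perturbation K \<rho> t L \<longleftrightarrow> C2_plus L \<and>
     (\<forall>\<theta>\<in>sphere 0 1. support_function L \<theta> =
        support_function K \<theta> + t * \<rho> (inv_into (frontier K) (gauss_map K) \<theta>))"

text \<open>The set written \<open>K(\<rho>,t)\<close>; it is unique when it exists, since a compact convex set is
  determined by its support function.\<close>

definition perturbation ::
    "'a::euclidean_space set \<Rightarrow> ('a \<Rightarrow> real) \<Rightarrow> real \<Rightarrow> 'a set" where
  "perturbation K \<rho> t = (THE L. is_perturbation K \<rho> t L)"

text \<open>The C2 functions \<open>\<rho>\<close> on the boundary for which \<open>K(\<rho>,t)\<close> is defined for all small \<open>t\<close>.
  For a sufficiently regular boundary (class C3, say) the last conjunct holds for every C2
  function \<open>\<rho>\<close>. If the boundary is only C2, then the inverse of the Gauss map is only C1 and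
  \<open>K(\<rho>,t)\<close> may fail to exist; such \<open>\<rho>\<close> impose no condition.\<close>

definition admissible :: "'a::euclidean_space set \<Rightarrow> ('a \<Rightarrow> real) \<Rightarrow> bool" where
  "admissible K \<rho> \<longleftrightarrow> C2_function_on (frontier K) \<rho> \<and>
     (\<exists>\<epsilon>>0. \<forall>t. \<bar>t\<bar> < \<epsilon> \<longrightarrow> (\<exists>L. is_perturbation K \<rho> t L))"

definition concavity_exponent :: "'a::euclidean_space measure \<Rightarrow> 'a set \<Rightarrow> real \<Rightarrow> bool" where
  "concavity_exponent \<mu> K p \<longleftrightarrow>
     (\<forall>\<rho>. admissible K \<rho> \<longrightarrow>
        (\<exists>D\<le>0. has_second_derivative (\<lambda>t. measure \<mu> (perturbation K \<rho> t) powr p) D 0))"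

definition concavity_power :: "'a::euclidean_space measure \<Rightarrow> 'a set \<Rightarrow> real" where
  "concavity_power \<mu> K = (GREATEST p. concavity_exponent \<mu> K p)"

end

theory Submission
  imports Defs
begin

text \<open>
  Write \<open>F(t) = \<mu>((1+t)K)\<close>. The body \<open>(1+t)K\<close> is the perturbation of \<open>K\<close> with speed \<open>h\<^sub>K \<circ> \<nu>\<^sub>K\<close>, because
  its support function is \<open>(1+t)h\<^sub>K\<close>. If \<open>p\<close> is the concavity power of \<open>K\<close>, the second derivative of
  \<open>F\<^sup>p\<close> at 0 is therefore at most 0, which for \<open>p > 0\<close> means \<open>F F'' \<le> (1 - p) F'\<^sup>2\<close>. The first variation of
  the measure is \<open>F'(0) = I\<close>, the integral of \<open>h\<^sub>K(\<nu>\<^sub>K)\<close> over the boundary, so the hypothesis \<open>F / I \<le> p\<close>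
  becomes \<open>F F' \<le> p F'\<^sup>2\<close>. The sum of both inequalities is \<open>F F'' + F F' \<le> F'\<^sup>2\<close>, which says that
  \<open>t \<mapsto> ln \<mu>(e\<^sup>tK)\<close> has a non-positive second derivative at 0. Applied to all dilates of \<open>K\<close>, this is
  log-concavity (\<open>dilation_second_order\<close>, \<open>power_body_log_concave\<close>).

  It suffices to treat a dense class of bodies. Every non-empty symmetric compact convex
  set is the limit, from outside, of unit balls of norms of the form \<open>(\<Sum> (b \<bullet> x)\<^sup>2\<^sup>q + c |x|\<^sup>2\<^sup>q)\<^sup>1\<^sup>/\<^sup>2\<^sup>q\<close>, obtained by replacing
  the maximum over finitely many slabs by a power sum (\<open>power_body_approximation\<close>), and log-concavity
  passes to pointwise limits. On the boundary of these bodies the speed \<open>h\<^sub>K \<circ> \<nu>\<^sub>K\<close> is, up to a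
  factor, the inverse square root of a polynomial, so it is of class \<open>C\<^sup>2\<close> and the dilation is an admissible perturbation
  (\<open>dilation_admissible\<close>). Strong convexity of the polynomial gives positive principal curvatures
  (\<open>K_C2_plus\<close>).

  Two points need care. The first is that the concavity power is a maximum that could fail to exist.
  The exponent 0 always qualifies, since constants have zero second derivative. If some positive
  exponent qualifies, then every perturbed measure is twice differentiable, the condition is linear in
  the exponent, and the dilation, which has a non-zero first variation, bounds the exponents from
  above. So the maximum exists (\<open>concavity_exponent_concavity_power\<close>). In particular \<open>F\<close> is twice differentiable as
  soon as the hypothesis forces \<open>p > 0\<close>.

  The second point is the first variation formula, in which the boundary carries the Hausdorff measure.
  What the argument uses is \<open>0 < I \<le> F'(0)\<close>. The upper bound, with the sharp constant, comes from the inequality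
  half of the coarea formula (\<open>hausdorff_coarea_le\<close>): the boundary has area at most the volume of a thin
  shell, weighted with the gradient of the gauge function and divided by the width of the shell. This inequality
  is obtained from efficient covers of the shell by balls and Fubini's theorem for a single ball. Positivity of \<open>I\<close> follows from a crude cover by boxes
  (\<open>hausdorff_frontier_pos\<close>). Finally, the Hausdorff outer measure is a measure on the Borel sets by
  Caratheodory's criterion (\<open>measure_space_hausdorff\<close>).
\<close>

section \<open>The Hausdorff measure on Borel sets\<close>

abbreviation hausdorff_gauge :: "nat \<Rightarrow> 'a::metric_space set \<Rightarrow> ennreal" where
  "hausdorff_gauge d U \<equiv>
     (if U = {} then 0 else ennreal (unit_ball_vol (real d) * (diameter U / 2) ^ d))"

lemma hausdorff_premeasure_le:
  assumes "A \<subseteq> (\<Union>i. U i)" "\<And>i. bounded (U i)" "\<And>i. diameter (U i) \<le> \<delta>"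
  shows "hausdorff_premeasure d \<delta> A \<le> (\<Sum>i::nat. hausdorff_gauge d (U i))"
  unfolding hausdorff_premeasure_def using assms by (intro INF_lower) auto

lemma hausdorff_premeasure_lessE:
  assumes "hausdorff_premeasure d \<delta> A < c"
  obtains U :: "nat \<Rightarrow> 'a::metric_space set" where "A \<subseteq> (\<Union>i. U i)" "\<And>i. bounded (U i)"
    "\<And>i. diameter (U i) \<le> \<delta>" "(\<Sum>i. hausdorff_gauge d (U i)) < c"
proof -
  from assms obtain U where "U \<in> {U :: nat \<Rightarrow> 'a set. A \<subseteq> (\<Union>i. U i) \<and> (\<forall>i. bounded (U i) \<and> diameter (U i) \<le> \<delta>)}"
    "(\<Sum>i. hausdorff_gauge d (U i)) < c"
    unfolding hausdorff_premeasure_def INF_less_iff by blast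
  then show ?thesis using that[of U] by auto
qed

lemma hausdorff_premeasure_geI:
  assumes "\<And>U :: nat \<Rightarrow> 'a::metric_space set. \<lbrakk>A \<subseteq> (\<Union>i. U i); \<And>i. bounded (U i); \<And>i. diameter (U i) \<le> \<delta>\<rbrakk>
             \<Longrightarrow> c \<le> (\<Sum>i. hausdorff_gauge d (U i))"
  shows "c \<le> hausdorff_premeasure d \<delta> A"
  unfolding hausdorff_premeasure_def by (rule INF_greatest) (use assms in auto)

lemma hausdorff_premeasure_mono:
  "A \<subseteq> B \<Longrightarrow> hausdorff_premeasure d \<delta> A \<le> hausdorff_premeasure d \<delta> B"
  unfolding hausdorff_premeasure_def by (rule INF_superset_mono) auto

lemma hausdorff_premeasure_antimono:
  "\<delta> \<le> \<delta>' \<Longrightarrow> hausdorff_premeasure d \<delta>' A \<le> hausdorff_premeasure d \<delta> A"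
  unfolding hausdorff_premeasure_def by (rule INF_superset_mono) (auto intro: order_trans)

lemma hausdorff_premeasure_empty: "\<delta> > 0 \<Longrightarrow> hausdorff_premeasure d \<delta> {} = 0"
  using hausdorff_premeasure_le[of "{}" "\<lambda>_. {}" \<delta> d] by (simp add: diameter_def)

lemma hausdorff_premeasure_countably_subadditive:
  "hausdorff_premeasure d \<delta> (\<Union>i. A i) \<le> (\<Sum>i::nat. hausdorff_premeasure d \<delta> (A i))"
proof (rule ennreal_le_epsilon)
  fix e :: real assume e: "0 < e" and fin: "(\<Sum>i. hausdorff_premeasure d \<delta> (A i)) < top"
  have lt: "hausdorff_premeasure d \<delta> (A n) < hausdorff_premeasure d \<delta> (A n) + e * (1/2)^Suc n" for n
    using e fin by (auto simp add: less_top dest!: ennreal_suminf_lessD)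
  have "\<exists>U. A n \<subseteq> (\<Union>i. U i) \<and> (\<forall>i. bounded (U i)) \<and> (\<forall>i. diameter (U i) \<le> \<delta>) \<and>
      (\<Sum>i::nat. hausdorff_gauge d (U i)) < hausdorff_premeasure d \<delta> (A n) + e * (1/2)^Suc n" for n
    by (rule hausdorff_premeasure_lessE[OF lt[of n]]) blast
  then have "\<exists>U. \<forall>n. A n \<subseteq> (\<Union>i. U n i) \<and> (\<forall>i. bounded (U n i)) \<and> (\<forall>i. diameter (U n i) \<le> \<delta>) \<and>
      (\<Sum>i::nat. hausdorff_gauge d (U n i)) < hausdorff_premeasure d \<delta> (A n) + e * (1/2)^Suc n"
    by (intro choice allI)
  then obtain U where U: "\<And>n. A n \<subseteq> (\<Union>i. U n i)" "\<And>n i. bounded (U n i)"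
      "\<And>n i. diameter (U n i) \<le> \<delta>"
      "\<And>n. (\<Sum>i::nat. hausdorff_gauge d (U n i)) < hausdorff_premeasure d \<delta> (A n) + e * (1/2)^Suc n"
    by (elim exE) blast
  have cover: "(\<Union>n. A n) \<subseteq> (\<Union>i. (case_prod U) (prod_decode i))"
  proof
    fix x assume "x \<in> (\<Union>n. A n)"
    then obtain n i where "x \<in> U n i" using U(1) by fast
    then have "x \<in> (case_prod U) (prod_decode (prod_encode (n, i)))" by simp
    then show "x \<in> (\<Union>i. (case_prod U) (prod_decode i))" by (rule UN_I[OF UNIV_I])
  qed
  have "hausdorff_premeasure d \<delta> (\<Union>i. A i) \<le> (\<Sum>i. hausdorff_gauge d ((case_prod U) (prod_decode i)))"
  proof (rule hausdorff_premeasure_le[where U = "\<lambda>i. case_prod U (prod_decode i)", OF cover])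
    show "bounded (case_prod U (prod_decode i))" for i unfolding case_prod_beta by (rule U(2))
    show "diameter (case_prod U (prod_decode i)) \<le> \<delta>" for i unfolding case_prod_beta by (rule U(3))
  qed
  also have "\<dots> = (\<Sum>n. \<Sum>i. hausdorff_gauge d (U n i))"
    by (rule suminf_ennreal_2dimen[where f = "\<lambda>p. hausdorff_gauge d (case_prod U p)"]) (simp only: prod.case)
  also have "\<dots> \<le> (\<Sum>n. hausdorff_premeasure d \<delta> (A n) + e * (1/2)^Suc n)"
    by (intro suminf_le) (rule less_imp_le[OF U(4)], auto)
  also have "\<dots> = (\<Sum>n. hausdorff_premeasure d \<delta> (A n)) + (\<Sum>n. ennreal e * ennreal ((1/2)^Suc n))"
    using e by (subst suminf_add[symmetric]) (auto simp: ennreal_mult simp del: power_Suc)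
  also have "(\<Sum>n. ennreal e * ennreal ((1/2)^Suc n)) = ennreal e"
    unfolding ennreal_suminf_cmult
    by (subst suminf_ennreal_eq[OF zero_le_power power_half_series]) auto
  finally show "hausdorff_premeasure d \<delta> (\<Union>i. A i) \<le> (\<Sum>n. hausdorff_premeasure d \<delta> (A n)) + ennreal e" .
qed

lemma hausdorff_premeasure_Un:
  assumes "\<delta> > 0"
  shows "hausdorff_premeasure d \<delta> (A \<union> B) \<le> hausdorff_premeasure d \<delta> A + hausdorff_premeasure d \<delta> B"
proof -
  have "hausdorff_premeasure d \<delta> (A \<union> B) \<le> (\<Sum>i. hausdorff_premeasure d \<delta> (binaryset A B i))"
    using hausdorff_premeasure_countably_subadditive[of d \<delta> "binaryset A B"]
    by (simp add: UN_binaryset_eq)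
  also have "\<dots> = hausdorff_premeasure d \<delta> A + hausdorff_premeasure d \<delta> B"
    by (rule suminf_binaryset_eq) (rule hausdorff_premeasure_empty[OF assms])
  finally show ?thesis .
qed

lemma hausdorff_premeasure_le_outer:
  "\<delta> > 0 \<Longrightarrow> hausdorff_premeasure d \<delta> A \<le> hausdorff_outer_measure d A"
  unfolding hausdorff_outer_measure_def by (rule SUP_upper) auto

lemma hausdorff_outer_measure_mono:
  "A \<subseteq> B \<Longrightarrow> hausdorff_outer_measure d A \<le> hausdorff_outer_measure d B"
  unfolding hausdorff_outer_measure_def by (intro SUP_mono) (meson hausdorff_premeasure_mono)

lemma hausdorff_outer_measure_countably_subadditive:
  "hausdorff_outer_measure d (\<Union>i. A i) \<le> (\<Sum>i::nat. hausdorff_outer_measure d (A i))"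
  unfolding hausdorff_outer_measure_def[of d "\<Union>i. A i"]
proof (rule SUP_least)
  fix \<delta> :: real assume "\<delta> \<in> {0<..}"
  then have "(\<Sum>i. hausdorff_premeasure d \<delta> (A i)) \<le> (\<Sum>i. hausdorff_outer_measure d (A i))"
    by (intro suminf_le) (auto intro: hausdorff_premeasure_le_outer)
  then show "hausdorff_premeasure d \<delta> (\<Union>i. A i) \<le> (\<Sum>i. hausdorff_outer_measure d (A i))"
    using hausdorff_premeasure_countably_subadditive order_trans by blast
qed

lemma outer_measure_space_hausdorff: "outer_measure_space UNIV (hausdorff_outer_measure d)"
  unfolding outer_measure_space_def positive_def increasing_def countably_subadditive_def
  using hausdorff_outer_measure_mono hausdorff_outer_measure_countably_subadditive
  by (auto simp: hausdorff_outer_measure_def hausdorff_premeasure_empty)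

lemma hausdorff_outer_measure_empty [simp]: "hausdorff_outer_measure d {} = 0"
  using outer_measure_space_hausdorff by (auto simp: outer_measure_space_def positive_def)

lemma hausdorff_outer_measure_Un:
  "hausdorff_outer_measure d (A \<union> B) \<le> hausdorff_outer_measure d A + hausdorff_outer_measure d B"
proof -
  have "hausdorff_outer_measure d (A \<union> B) \<le> (\<Sum>i. hausdorff_outer_measure d (binaryset A B i))"
    using hausdorff_outer_measure_countably_subadditive[of d "binaryset A B"]
    by (simp add: UN_binaryset_eq)
  also have "\<dots> = hausdorff_outer_measure d A + hausdorff_outer_measure d B"
    by (rule suminf_binaryset_eq) simp
  finally show ?thesis .
qed

text \<open>A covering set of diameter below the distance of \<open>A\<close> and \<open>B\<close> cannot meet both, so every
  fine cover of the union splits into a cover of \<open>A\<close> and one of \<open>B\<close>.\<close>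

lemma hausdorff_outer_measure_metric:
  assumes r: "r > 0" "\<And>x y. x \<in> A \<Longrightarrow> y \<in> B \<Longrightarrow> r \<le> dist x y"
  shows "hausdorff_outer_measure d A + hausdorff_outer_measure d B \<le> hausdorff_outer_measure d (A \<union> B)"
proof -
  have split: "hausdorff_premeasure d \<delta> A + hausdorff_premeasure d \<delta> B \<le> hausdorff_premeasure d \<delta> (A \<union> B)"
    if \<delta>: "\<delta> < r" "\<delta> > 0" for \<delta>
  proof (rule hausdorff_premeasure_geI)
    fix U :: "nat \<Rightarrow> 'a set"
    assume U: "A \<union> B \<subseteq> (\<Union>i. U i)" "\<And>i. bounded (U i)" "\<And>i. diameter (U i) \<le> \<delta>"
    define V where "V X i = (if U i \<inter> X = {} then {} else U i)" for X i
    have V: "hausdorff_premeasure d \<delta> X \<le> (\<Sum>i. hausdorff_gauge d (V X i))" if "X \<subseteq> A \<union> B" for X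
    proof (rule hausdorff_premeasure_le)
      show "X \<subseteq> (\<Union>i. V X i)"
      proof
        fix x assume x: "x \<in> X"
        with that U(1) obtain i where "x \<in> U i" by blast
        with x have "x \<in> V X i" by (auto simp: V_def)
        then show "x \<in> (\<Union>i. V X i)" by (rule UN_I[OF UNIV_I])
      qed
      show "bounded (V X i)" for i by (simp add: V_def U(2))
      show "diameter (V X i) \<le> \<delta>" for i
        using U(3)[of i] \<delta> by (cases "U i \<inter> X = {}") (auto simp: V_def)
    qed
    have disj: "V A i = {} \<or> V B i = {}" for i
    proof (rule ccontr)
      assume "\<not> ?thesis"
      then obtain x y where "x \<in> U i" "x \<in> A" "y \<in> U i" "y \<in> B" by (auto simp: V_def split: if_splits)
      then show False using diameter_bounded_bound[OF U(2), of x i y] U(3)[of i] r(2)[of x y] \<delta> by auto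
    qed
    have "hausdorff_gauge d (V A i) + hausdorff_gauge d (V B i) \<le> hausdorff_gauge d (U i)" for i
      using disj[of i] unfolding V_def by (cases "U i \<inter> A = {}"; cases "U i \<inter> B = {}") simp_all
    then have "(\<Sum>i. hausdorff_gauge d (V A i)) + (\<Sum>i. hausdorff_gauge d (V B i)) \<le> (\<Sum>i. hausdorff_gauge d (U i))"
      by (subst suminf_add[OF summableI summableI]) (intro suminf_le summableI)
    then show "hausdorff_premeasure d \<delta> A + hausdorff_premeasure d \<delta> B \<le> (\<Sum>i. hausdorff_gauge d (U i))"
      by (rule order_trans[OF add_mono[OF V[OF Un_upper1] V[OF Un_upper2]]])
  qed
  have "hausdorff_premeasure d \<delta>1 A + hausdorff_premeasure d \<delta>2 B \<le> hausdorff_outer_measure d (A \<union> B)"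
    if "\<delta>1 > 0" "\<delta>2 > 0" for \<delta>1 \<delta>2
  proof -
    define \<delta> where "\<delta> = min (min \<delta>1 \<delta>2) (r/2)"
    have \<delta>: "\<delta> \<le> \<delta>1" "\<delta> \<le> \<delta>2" "\<delta> < r" "\<delta> > 0" using that r by (auto simp: \<delta>_def)
    have "hausdorff_premeasure d \<delta>1 A + hausdorff_premeasure d \<delta>2 B
        \<le> hausdorff_premeasure d \<delta> A + hausdorff_premeasure d \<delta> B"
      using \<delta> by (intro add_mono hausdorff_premeasure_antimono)
    also have "\<dots> \<le> hausdorff_outer_measure d (A \<union> B)"
      using split[OF \<delta>(3,4)] hausdorff_premeasure_le_outer[OF \<delta>(4)] order_trans by blast
    finally show ?thesis .
  qed
  then have "hausdorff_premeasure d \<delta>1 A + hausdorff_outer_measure d B \<le> hausdorff_outer_measure d (A \<union> B)"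
    if "\<delta>1 > 0" for \<delta>1
    unfolding hausdorff_outer_measure_def[of d B] using that
    by (subst ennreal_SUP_add_right) (auto intro!: SUP_least)
  then show ?thesis
    unfolding hausdorff_outer_measure_def[of d A]
    by (subst ennreal_SUP_add_left[symmetric]) (auto intro!: SUP_least)
qed

text \<open>Caratheodory's criterion. The part of \<open>A\<close> outside \<open>C\<close> is exhausted by the sets \<open>D k\<close> at
  distance at least \<open>1/(k+1)\<close> from \<open>C\<close>. The layers \<open>R k\<close> between them are far apart when their
  indices differ by two, so their measures have a finite sum, and the tails of this sum bound what
  \<open>D k\<close> misses.\<close>

lemma hausdorff_closed_split:
  fixes A C :: "'a::metric_space set"
  assumes C: "closed C"
  shows "hausdorff_outer_measure d (A \<inter> C) + hausdorff_outer_measure d (A - C) \<le> hausdorff_outer_measure d A"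
proof (cases "C = {} \<or> hausdorff_outer_measure d A = \<infinity>")
  case True
  then show ?thesis by auto
next
  case False
  let ?H = "hausdorff_outer_measure d"
  define D where "D k = {x \<in> A. 1 / (real k + 1) \<le> infdist x C}" for k :: nat
  define R where "R k = D (Suc k) - D k" for k
  from False have ne: "C \<noteq> {}" and fin: "?H A < \<infinity>" by (auto simp: less_top)
  have D_sub: "D k \<subseteq> A - C" for k
    using C ne in_closed_iff_infdist_zero[OF C ne] by (fastforce simp: D_def field_simps)
  have far: "1 / (real k + 2) - 1 / (real k + 3) \<le> dist x y"
    if "x \<in> D (Suc k)" "y \<notin> D (Suc (Suc k))" "y \<in> A" for x y k
  proof -
    have "infdist x C \<le> infdist y C + dist x y" by (rule infdist_triangle)
    then show ?thesis using that by (auto simp: D_def algebra_simps)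
  qed
  have gap: "1 / (real k + 2) - 1 / (real k + 3) > 0" for k
    by (simp add: frac_less2)
  have mono: "D k \<subseteq> D (Suc k)" for k
  proof
    fix x assume x: "x \<in> D k"
    have "1 / (real (Suc k) + 1) \<le> 1 / (real k + 1)" by (intro frac_le) auto
    with x show "x \<in> D (Suc k)" by (auto simp: D_def)
  qed
  have mono': "i \<le> j \<Longrightarrow> D i \<subseteq> D j" for i j
    using mono lift_Suc_mono_le by blast
  have partial: "(\<Sum>j<m. ?H (R (2*j+p))) \<le> ?H A" for m p
  proof -
    have "(\<Sum>j<m. ?H (R (2*j+p))) \<le> ?H (\<Union>j<m. R (2*j+p))"
    proof (induction m)
      case (Suc m)
      show ?case
      proof (cases m)
        case 0 then show ?thesis by (simp add: lessThan_Suc)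
      next
        case m: (Suc l)
        let ?k = "2*l+p"
        have "?H (\<Union>j<m. R (2*j+p)) + ?H (R (2*m+p)) \<le> ?H ((\<Union>j<m. R (2*j+p)) \<union> R (2*m+p))"
        proof (rule hausdorff_outer_measure_metric[OF gap[of ?k]])
          fix x y assume x: "x \<in> (\<Union>j<m. R (2*j+p))" and y: "y \<in> R (2*m+p)"
          from x obtain j where "j < m" "x \<in> D (Suc (2*j+p))" by (auto simp: R_def)
          then have "x \<in> D (Suc ?k)" using mono'[of "Suc (2*j+p)" "Suc ?k"] m by auto
          moreover have "y \<notin> D (Suc (Suc ?k))" "y \<in> A" using y m by (auto simp: R_def D_def)
          ultimately show "1 / (real ?k + 2) - 1 / (real ?k + 3) \<le> dist x y" by (rule far)
        qed
        also have "((\<Union>j<m. R (2*j+p)) \<union> R (2*m+p)) = (\<Union>j<Suc m. R (2*j+p))"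
          by (auto simp: less_Suc_eq)
        finally show ?thesis using Suc by (auto intro: order_trans add_right_mono)
      qed
    qed simp
    also have "\<dots> \<le> ?H A" by (rule hausdorff_outer_measure_mono) (auto simp: R_def D_def)
    finally show ?thesis .
  qed
  have double: "(\<Sum>k<2*m. ?H (R k)) = (\<Sum>j<m. ?H (R (2*j+0))) + (\<Sum>j<m. ?H (R (2*j+1)))" for m
    by (induction m) (auto simp: ac_simps)
  have "(\<Sum>k<m. ?H (R k)) \<le> ?H A + ?H A" for m
  proof -
    have "(\<Sum>k<m. ?H (R k)) \<le> (\<Sum>k<2*m. ?H (R k))" by (rule sum_mono2) auto
    also have "\<dots> \<le> ?H A + ?H A" unfolding double by (intro add_mono partial)
    finally show ?thesis .
  qed
  then have "(\<Sum>k. ?H (R k)) \<le> ?H A + ?H A" by (intro suminf_le_const summableI)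
  also have "\<dots> < \<infinity>" using fin by (simp add: less_top)
  finally have finsum: "(\<Sum>k. ?H (R k)) < \<infinity>" .
  define a where "a k = enn2real (?H (R k))" for k
  have a: "?H (R k) = ennreal (a k)" for k
    using ennreal_suminf_lessD[OF finsum] by (simp add: a_def)
  have a0: "a k \<ge> 0" for k by (simp add: a_def)
  have summ: "summable a"
    using finsum a0 by (intro summable_suminf_not_top) (auto simp: a)
  show ?thesis
  proof (rule ennreal_le_epsilon)
    fix e :: real assume e: "0 < e"
    from suminf_exist_split[OF e summ] obtain N where N: "norm (\<Sum>i. a (i + N)) < e" by blast
    have cover: "A - C \<subseteq> D N \<union> (\<Union>i. R (i + N))"
    proof
      fix x assume x: "x \<in> A - C"
      then have "infdist x C > 0"
        using C ne in_closed_iff_infdist_zero[OF C ne] infdist_nonneg[of x C] by fastforce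
      then obtain k where "1 / (real (Suc k)) < infdist x C" using nat_approx_posE by blast
      then have k: "x \<in> D k" using x by (auto simp: D_def ac_simps)
      show "x \<in> D N \<union> (\<Union>i. R (i + N))"
      proof (rule ccontr)
        assume contr: "x \<notin> D N \<union> (\<Union>i. R (i + N))"
        have "x \<notin> D (N + i)" for i
          by (induction i) (use contr in \<open>auto simp: R_def ac_simps\<close>)
        then show False using k mono'[of k "N + k"] by auto
      qed
    qed
    have "?H (A - C) \<le> ?H (D N) + (\<Sum>i. ?H (R (i + N)))"
      by (rule order_trans[OF hausdorff_outer_measure_mono[OF cover] order_trans[OF
            hausdorff_outer_measure_Un add_left_mono[OF hausdorff_outer_measure_countably_subadditive]]])
    also have "(\<Sum>i. ?H (R (i + N))) = ennreal (\<Sum>i. a (i + N))"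
      unfolding a using summ a0 by (intro suminf_ennreal2) (auto simp: summable_iff_shift)
    also have "\<dots> \<le> ennreal e" using N by (intro ennreal_leI) auto
    finally have 1: "?H (A - C) \<le> ?H (D N) + ennreal e" by (simp add: add_left_mono)
    have "?H (A \<inter> C) + ?H (D N) \<le> ?H ((A \<inter> C) \<union> D N)"
    proof (rule hausdorff_outer_measure_metric)
      show "(0::real) < 1 / (real N + 1)" by simp
      fix x y assume "x \<in> A \<inter> C" "y \<in> D N"
      then show "1 / (real N + 1) \<le> dist x y"
        using infdist_le[of x C y] by (auto simp: D_def dist_commute)
    qed
    also have "\<dots> \<le> ?H A" by (rule hausdorff_outer_measure_mono) (auto simp: D_def)
    finally have 2: "?H (A \<inter> C) + ?H (D N) \<le> ?H A" .
    have "?H (A \<inter> C) + ?H (A - C) \<le> ?H (A \<inter> C) + (?H (D N) + ennreal e)"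
      by (rule add_left_mono[OF 1])
    also have "\<dots> \<le> ?H A + ennreal e" using add_right_mono[OF 2, of "ennreal e"] by (simp add: add.assoc)
    finally show "?H (A \<inter> C) + ?H (A - C) \<le> ?H A + ennreal e" .
  qed
qed

text \<open>The sets that split every set additively form a \<open>\<sigma>\<close>-algebra on which an outer measure is
  a measure. It contains the closed sets, hence the Borel sets. Without this the measure generated
  from the outer measure would be the zero measure by convention.\<close>

lemma measure_space_hausdorff:
  "measure_space (UNIV :: 'a::metric_space set) (sets borel) (hausdorff_outer_measure d)"
proof -
  interpret sigma_algebra UNIV "UNIV :: 'a set set"
    using sigma_algebra_Pow[of "UNIV :: 'a set"] by simp
  let ?L = "lambda_system UNIV UNIV (hausdorff_outer_measure d) :: 'a set set"
  have L: "measure_space UNIV ?L (hausdorff_outer_measure d)"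
    by (rule caratheodory_lemma[OF outer_measure_space_hausdorff])
  have "S \<in> ?L" if "closed S" for S :: "'a set"
  proof -
    have "hausdorff_outer_measure d (S \<inter> A) + hausdorff_outer_measure d ((UNIV - S) \<inter> A) = hausdorff_outer_measure d A" for A
    proof (rule antisym)
      show "hausdorff_outer_measure d (S \<inter> A) + hausdorff_outer_measure d ((UNIV - S) \<inter> A) \<le> hausdorff_outer_measure d A"
        using hausdorff_closed_split[OF that, of d A] by (simp add: Int_commute Diff_eq)
      have "A = (S \<inter> A) \<union> ((UNIV - S) \<inter> A)" by auto
      then show "hausdorff_outer_measure d A \<le> hausdorff_outer_measure d (S \<inter> A) + hausdorff_outer_measure d ((UNIV - S) \<inter> A)"
        by (metis hausdorff_outer_measure_Un)
    qed
    then show ?thesis by (simp add: lambda_system_def)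
  qed
  then have "Collect closed \<subseteq> ?L" by auto
  moreover have "sigma_algebra UNIV ?L" using L by (simp add: measure_space_def)
  ultimately have "sigma_sets UNIV (Collect closed) \<subseteq> ?L"
    using sigma_algebra.sigma_sets_subset by blast
  then have "sets borel \<subseteq> ?L" unfolding borel_eq_closed by simp
  moreover have "sigma_algebra (UNIV :: 'a set) (sets borel)"
    by (metis sets.sigma_algebra_axioms space_borel)
  ultimately show ?thesis using L measure_down by blast
qed

lemma sets_hausdorff_measure [simp]: "sets (hausdorff_measure d :: 'a::metric_space measure) = sets borel"
  unfolding hausdorff_measure_def by (metis sets.sets_measure_of_eq space_borel)

lemma emeasure_hausdorff_measure:
  fixes A :: "'a::metric_space set"
  assumes "A \<in> sets borel"
  shows "emeasure (hausdorff_measure d) A = hausdorff_outer_measure d A"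
proof -
  have "measure_space (UNIV :: 'a set) (sets borel) (hausdorff_outer_measure d)"
    by (rule measure_space_hausdorff)
  then show ?thesis unfolding hausdorff_measure_def
    by (subst emeasure_measure_of_sigma) (auto simp: measure_space_def assms)
qed

section \<open>A coarea inequality\<close>

text \<open>Fubini's theorem for a ball of radius \<open>R\<close> in dimension \<open>d + 1\<close>: its slice at height
  \<open>z = (s - a) / v\<close> is a ball of radius \<open>sqrt (R\<^sup>2 - z\<^sup>2)\<close> in dimension \<open>d\<close>. The factor \<open>v\<close> is the
  change of variables from heights to levels \<open>s\<close> of a function with slope \<open>v\<close>.\<close>

lemma nn_integral_ball_slices:
  fixes a v R :: real
  assumes v: "v > 0" and R: "R > 0"
  shows "(\<integral>\<^sup>+ s. indicator {s. \<bar>s - a\<bar> \<le> v * R} s *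
            ennreal (unit_ball_vol (real d) * sqrt (R\<^sup>2 - ((s - a) / v)\<^sup>2) ^ d) \<partial>lborel)
         = ennreal (v * (unit_ball_vol (real (Suc d)) * R ^ Suc d))"
proof -
  let ?f = "\<lambda>s. indicator {s. \<bar>s - a\<bar> \<le> v * R} s *
            ennreal (unit_ball_vol (real d) * sqrt (R\<^sup>2 - ((s - a) / v)\<^sup>2) ^ d)"
  have vR: "v * R > 0" using v R by simp
  have eq: "?f (a + (v * R) * x) = ennreal (unit_ball_vol (real d) * R ^ d) *
      ennreal (indicator {-1..1} x * sqrt (1 - x\<^sup>2) ^ d)" for x
  proof -
    have "\<bar>a + (v * R) * x - a\<bar> = v * R * \<bar>x\<bar>" using v R by (simp add: abs_mult)
    then have iff: "\<bar>a + (v * R) * x - a\<bar> \<le> v * R \<longleftrightarrow> \<bar>x\<bar> \<le> 1"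
      using mult_le_cancel_left_pos[OF vR, of "\<bar>x\<bar>" 1] by (simp only: mult_1_right)
    have "R\<^sup>2 - ((a + (v * R) * x - a) / v)\<^sup>2 = R\<^sup>2 * (1 - x\<^sup>2)"
      using v by (simp add: power2_eq_square algebra_simps)
    then have "sqrt (R\<^sup>2 - ((a + (v * R) * x - a) / v)\<^sup>2) = R * sqrt (1 - x\<^sup>2)"
      using R by (simp add: real_sqrt_mult)
    moreover have "0 \<le> sqrt (1 - x\<^sup>2)" if "\<bar>x\<bar> \<le> 1"
      using that by (simp add: abs_square_le_1)
    ultimately show ?thesis using iff R
      by (cases "\<bar>x\<bar> \<le> 1")
        (auto simp: indicator_def abs_le_iff power_mult_distrib ennreal_mult'[symmetric] mult_ac)
  qed
  have "(\<integral>\<^sup>+ s. ?f s \<partial>lborel) = ennreal (v * R) * (\<integral>\<^sup>+ x. ?f (a + (v * R) * x) \<partial>lborel)"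
    using vR by (subst nn_integral_real_affine[where c = "v * R" and t = a]) auto
  also have "(\<integral>\<^sup>+ x. ?f (a + (v * R) * x) \<partial>lborel) = ennreal (unit_ball_vol (real d) * R ^ d) *
      (\<integral>\<^sup>+ x. ennreal (indicator {-1..1} x * sqrt (1 - x\<^sup>2) ^ d) \<partial>lborel)"
    unfolding eq by (rule nn_integral_cmult) measurable
  also have "(\<integral>\<^sup>+ x. ennreal (indicator {-1..1} x * sqrt (1 - x\<^sup>2) ^ d) \<partial>lborel) =
      ennreal (Beta (1 / 2) (real d / 2 + 1))"
    using emeasure_cball_aux_integral[of d] by simp
  also have "ennreal (v * R) * (ennreal (unit_ball_vol (real d) * R ^ d) * ennreal (Beta (1 / 2) (real d / 2 + 1)))
      = ennreal (v * R * (unit_ball_vol (real d) * R ^ d * Beta (1 / 2) (real d / 2 + 1)))"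
    using v R by (simp add: ennreal_mult'[symmetric])
  also have "v * R * (unit_ball_vol (real d) * R ^ d * Beta (1 / 2) (real d / 2 + 1)) =
      v * ((unit_ball_vol (real d) * Beta (1 / 2) (real d / 2 + 1)) * R ^ Suc d)"
    by (simp add: mult_ac)
  also have "unit_ball_vol (real d) * Beta (1 / 2) (real d / 2 + 1) = unit_ball_vol (real (Suc d))"
    by (auto simp: unit_ball_vol_def Beta_def Gamma_eq_zero_iff field_simps
          Gamma_one_half_real powr_half_sqrt [symmetric] powr_add [symmetric])
  finally show ?thesis .
qed

text \<open>If \<open>g\<close> is nearly affine on a small ball, then a level set in the ball is nearly a slice of it.
  For two points of the level set, the parallelogram law bounds their distance by the length of the
  sum of their position vectors relative to the centre, and the component of this sum along the
  gradient is prescribed by the level up to the linearisation error. The error is absorbed by a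
  slight increase of the radius from \<open>r\<close> to \<open>R\<close>.\<close>

lemma diameter_level_set_cball:
  fixes c v :: "'a::euclidean_space"
  assumes v: "v \<noteq> 0" and r: "r > 0" and \<epsilon>: "0 \<le> \<epsilon>" "\<epsilon> \<le> 1"
    and lin: "\<And>y. y \<in> cball c r \<Longrightarrow> \<bar>g y - g c - v \<bullet> (y - c)\<bar> \<le> \<epsilon> * norm v * norm (y - c)"
    and R: "R = r * sqrt (1 + 4 * \<epsilon>)" and z: "z = (s - g c) / norm v"
    and ne: "S \<subseteq> cball c r" "\<And>y. y \<in> S \<Longrightarrow> g y = s" "S \<noteq> {}"
  shows "\<bar>s - g c\<bar> \<le> norm v * R" and "diameter S / 2 \<le> sqrt (R\<^sup>2 - z\<^sup>2)"
proof -
  define e where "e = v /\<^sub>R norm v"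
  have e: "norm e = 1" using v by (simp add: e_def)
  have R2: "R\<^sup>2 = r\<^sup>2 * (1 + 4 * \<epsilon>)" using \<epsilon> by (simp add: R power_mult_distrib)
  have near: "\<bar>e \<bullet> (y - c) - z\<bar> \<le> \<epsilon> * r" if "y \<in> S" for y
  proof -
    have y: "norm (y - c) \<le> r" using ne(1) that by (auto simp: dist_norm norm_minus_commute)
    have "e \<bullet> (y - c) - z = (v \<bullet> (y - c) - (g y - g c)) / norm v"
      using ne(2)[OF that] by (simp add: e_def z divide_simps)
    then have "\<bar>e \<bullet> (y - c) - z\<bar> = \<bar>g y - g c - v \<bullet> (y - c)\<bar> / norm v"
      by (simp add: abs_minus_commute)
    also have "\<dots> \<le> (\<epsilon> * norm v * norm (y - c)) / norm v"
      using lin[of y] ne(1) that by (intro divide_right_mono) auto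
    also have "\<dots> = \<epsilon> * norm (y - c)" using v by simp
    also have "\<dots> \<le> \<epsilon> * r" using y \<epsilon> by (intro mult_left_mono)
    finally show ?thesis .
  qed
  have len: "norm (y - c) \<le> r" if "y \<in> S" for y
    using ne(1) that by (auto simp: dist_norm norm_minus_commute)
  have ez: "\<bar>e \<bullet> w\<bar> \<le> norm w" for w using Cauchy_Schwarz_ineq2[of e w] e by simp
  obtain y0 where y0: "y0 \<in> S" using ne(3) by blast
  have "\<bar>z\<bar> \<le> r + \<epsilon> * r"
    using near[OF y0] ez[of "y0 - c"] len[OF y0] by linarith
  moreover have "\<epsilon> * r \<le> r" using \<epsilon> r by (simp add: mult_left_le_one_le)
  ultimately have z2: "\<bar>z\<bar> \<le> 2 * r" by linarith
  have key: "(dist x y)\<^sup>2 \<le> 4 * (R\<^sup>2 - z\<^sup>2)" if xy: "x \<in> S" "y \<in> S" for x y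
  proof -
    define a b where "a = x - c" and "b = y - c"
    define t where "t = \<bar>z\<bar> - \<epsilon> * r"
    have "2 * z - (e \<bullet> a + e \<bullet> b) \<le> 2 * (\<epsilon> * r)" "(e \<bullet> a + e \<bullet> b) - 2 * z \<le> 2 * (\<epsilon> * r)"
      using near[OF xy(1)] near[OF xy(2)] by (auto simp: a_def b_def)
    then have "2 * t \<le> \<bar>e \<bullet> a + e \<bullet> b\<bar>" by (auto simp: t_def abs_if)
    also have "\<dots> \<le> norm (a + b)" using ez[of "a + b"] by (simp add: inner_add_right)
    finally have tab: "2 * t \<le> norm (a + b)" .
    have lower: "4 * z\<^sup>2 - 16 * (\<epsilon> * r\<^sup>2) \<le> (norm (a + b))\<^sup>2"
    proof -
      have prod: "\<epsilon> * r * \<bar>z\<bar> \<le> \<epsilon> * r * (2 * r)" using \<epsilon> r z2 by (intro mult_left_mono) auto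
      show ?thesis
      proof (cases "t \<ge> 0")
        case True
        then have "(2 * t)\<^sup>2 \<le> (norm (a + b))\<^sup>2" using tab by (intro power_mono) auto
        moreover have "(2 * t)\<^sup>2 = 4 * z\<^sup>2 - 8 * (\<epsilon> * r * \<bar>z\<bar>) + 4 * (\<epsilon> * r)\<^sup>2"
          by (simp add: t_def power2_eq_square algebra_simps)
        moreover have "0 \<le> 4 * (\<epsilon> * r)\<^sup>2" by simp
        moreover have "\<epsilon> * r * (2 * r) = 2 * (\<epsilon> * r\<^sup>2)" by (simp add: power2_eq_square)
        ultimately show ?thesis using prod by linarith
      next
        case False
        then have "\<bar>z\<bar> * \<bar>z\<bar> \<le> (\<epsilon> * r) * \<bar>z\<bar>" by (intro mult_right_mono) (auto simp: t_def)
        then have "z\<^sup>2 \<le> \<epsilon> * r * (2 * r)" using prod by (simp add: power2_eq_square)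
        moreover have "0 \<le> (norm (a + b))\<^sup>2" by simp
        moreover have "0 \<le> \<epsilon> * r\<^sup>2" using \<epsilon> by simp
        moreover have "\<epsilon> * r * (2 * r) = 2 * (\<epsilon> * r\<^sup>2)" by (simp add: power2_eq_square)
        ultimately show ?thesis by linarith
      qed
    qed
    have "(dist x y)\<^sup>2 = (norm (a - b))\<^sup>2" by (simp add: a_def b_def dist_norm)
    also have "\<dots> = 2 * (norm a)\<^sup>2 + 2 * (norm b)\<^sup>2 - (norm (a + b))\<^sup>2"
      by (simp add: power2_norm_eq_inner algebra_simps inner_commute)
    also have "\<dots> \<le> 2 * r\<^sup>2 + 2 * r\<^sup>2 - (4 * z\<^sup>2 - 16 * (\<epsilon> * r\<^sup>2))"
      using lower len[OF xy(1)] len[OF xy(2)] by (intro diff_mono add_mono mult_left_mono power_mono) (auto simp: a_def b_def)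
    also have "\<dots> = 4 * (R\<^sup>2 - z\<^sup>2)" by (simp add: R2 algebra_simps)
    finally show ?thesis .
  qed
  have nonneg: "0 \<le> R\<^sup>2 - z\<^sup>2" using key[OF y0 y0] by simp
  have Rpos: "R \<ge> 0" using r \<epsilon> by (simp add: R)
  have "\<bar>z\<bar> \<le> R" using nonneg Rpos by (simp add: abs_le_square_iff[symmetric])
  then show "\<bar>s - g c\<bar> \<le> norm v * R" using v by (simp add: z field_simps)
  have "diameter S \<le> 2 * sqrt (R\<^sup>2 - z\<^sup>2)"
  proof (rule diameter_le)
    show "S \<noteq> {} \<or> 0 \<le> 2 * sqrt (R\<^sup>2 - z\<^sup>2)" using nonneg by simp
    fix x y assume "x \<in> S" "y \<in> S"
    then have "sqrt ((dist x y)\<^sup>2) \<le> sqrt (4 * (R\<^sup>2 - z\<^sup>2))" by (intro real_sqrt_le_mono key)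
    moreover have "sqrt (4 * (R\<^sup>2 - z\<^sup>2)) = 2 * sqrt (R\<^sup>2 - z\<^sup>2)"
      by (simp only: real_sqrt_mult real_sqrt_four)
    ultimately show "norm (x - y) \<le> 2 * sqrt (R\<^sup>2 - z\<^sup>2)"
      by (simp add: dist_norm)
  qed
  then show "diameter S / 2 \<le> sqrt (R\<^sup>2 - z\<^sup>2)" by simp
qed

text \<open>Each ball covers its part of a level set by one set of diameter at most that of a slice of a
  ball. Summing the slice volumes gives a majorant of the premeasures of all level sets, and its
  integral over the levels is a sum of ball volumes, each multiplied by the slope in the ball.\<close>

lemma hausdorff_level_sets_ball_family:
  fixes c v :: "nat \<Rightarrow> 'a::euclidean_space" and r :: "nat \<Rightarrow> real" and \<epsilon> :: real
  assumes \<epsilon>: "0 \<le> \<epsilon>" "\<epsilon> \<le> 1"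
    and r: "\<And>i. i \<in> I \<Longrightarrow> 0 < r i" "\<And>i. i \<in> I \<Longrightarrow> 2 * r i \<le> \<delta>" and \<delta>: "\<delta> > 0"
    and v: "\<And>i. i \<in> I \<Longrightarrow> v i \<noteq> 0"
    and lin: "\<And>i y. i \<in> I \<Longrightarrow> y \<in> cball (c i) (r i) \<Longrightarrow>
        \<bar>g y - g (c i) - v i \<bullet> (y - c i)\<bar> \<le> \<epsilon> * norm (v i) * norm (y - c i)"
    and S: "S \<subseteq> (\<Union>i\<in>I. cball (c i) (r i))"
  obtains \<Psi> :: "real \<Rightarrow> ennreal" where "\<Psi> \<in> borel_measurable borel"
    "\<And>s. hausdorff_premeasure (DIM('a) - 1) \<delta> {x\<in>S. g x = s} \<le> \<Psi> s"
    "(\<integral>\<^sup>+ s. \<Psi> s \<partial>lborel) =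
       ennreal (sqrt (1 + 4 * \<epsilon>) ^ DIM('a)) *
       (\<Sum>i. if i \<in> I then ennreal (norm (v i)) * emeasure lborel (cball (c i) (r i)) else 0)"
proof -
  define d where "d = DIM('a) - 1"
  have d: "Suc d = DIM('a)" by (simp add: d_def)
  define R where "R i = r i * sqrt (1 + 4 * \<epsilon>)" for i
  define \<psi> where "\<psi> i s = (if i \<in> I then indicator {s. \<bar>s - g (c i)\<bar> \<le> norm (v i) * R i} s *
     ennreal (unit_ball_vol (real d) * sqrt ((R i)\<^sup>2 - ((s - g (c i)) / norm (v i))\<^sup>2) ^ d) else 0)" for i s
  have meas[measurable]: "\<psi> i \<in> borel_measurable borel" for i
    unfolding \<psi>_def by (cases "i \<in> I") simp_all
  show thesis
  proof
    show "(\<lambda>s. \<Sum>i. \<psi> i s) \<in> borel_measurable borel" by measurable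
    show "hausdorff_premeasure (DIM('a) - 1) \<delta> {x\<in>S. g x = s} \<le> (\<Sum>i. \<psi> i s)" for s
    proof -
      define U where "U i = (if i \<in> I then {x \<in> cball (c i) (r i). g x = s} else {})" for i
      have bdd: "bounded (U i)" for i
        by (rule bounded_subset[OF bounded_cball[of "c i" "r i"]]) (auto simp: U_def)
      have diam: "diameter (U i) \<le> \<delta>" for i
      proof (cases "i \<in> I")
        case True
        have "diameter (U i) \<le> diameter (cball (c i) (r i))"
          by (rule diameter_subset) (auto simp: U_def)
        also have "\<dots> \<le> \<delta>" using r[OF True] by simp
        finally show ?thesis .
      qed (use \<delta> in \<open>simp add: U_def\<close>)
      have "{x\<in>S. g x = s} \<subseteq> (\<Union>i. U i)"
      proof
        fix x assume "x \<in> {x\<in>S. g x = s}"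
        then obtain i where "i \<in> I" "x \<in> cball (c i) (r i)" "g x = s" using S by blast
        then have "x \<in> U i" by (simp add: U_def)
        then show "x \<in> (\<Union>i. U i)" by (rule UN_I[OF UNIV_I])
      qed
      then have "hausdorff_premeasure (DIM('a) - 1) \<delta> {x\<in>S. g x = s} \<le> (\<Sum>i. hausdorff_gauge d (U i))"
        unfolding d_def by (rule hausdorff_premeasure_le[OF _ bdd diam])
      also have "\<dots> \<le> (\<Sum>i. \<psi> i s)"
      proof (intro suminf_le summableI)
        fix i show "hausdorff_gauge d (U i) \<le> \<psi> i s"
        proof (cases "U i = {}")
          case False
          then have i: "i \<in> I" by (auto simp: U_def split: if_splits)
          have sub: "U i \<subseteq> cball (c i) (r i)" "\<And>y. y \<in> U i \<Longrightarrow> g y = s"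
            using i by (auto simp: U_def)
          note D = diameter_level_set_cball[OF v[OF i] r(1)[OF i] \<epsilon> lin[OF i] R_def refl sub False]
          have "unit_ball_vol (real d) * (diameter (U i) / 2) ^ d \<le>
            unit_ball_vol (real d) * sqrt ((R i)\<^sup>2 - ((s - g (c i)) / norm (v i))\<^sup>2) ^ d"
            using D(2) diameter_ge_0[OF bdd] by (intro mult_left_mono power_mono) auto
          then show ?thesis using False i D(1) by (auto simp: \<psi>_def intro!: ennreal_leI)
        qed simp
      qed
      finally show ?thesis .
    qed
    have int: "(\<integral>\<^sup>+ s. \<psi> i s \<partial>lborel) = ennreal (sqrt (1 + 4 * \<epsilon>) ^ DIM('a)) *
       (if i \<in> I then ennreal (norm (v i)) * emeasure lborel (cball (c i) (r i)) else 0)" for i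
    proof (cases "i \<in> I")
      case True
      have "R i > 0" using r(1)[OF True] \<epsilon> by (simp add: R_def)
      then have "(\<integral>\<^sup>+ s. \<psi> i s \<partial>lborel) = ennreal (norm (v i) * (unit_ball_vol (real (Suc d)) * R i ^ Suc d))"
        using True v[OF True] unfolding \<psi>_def by (simp only: if_True) (rule nn_integral_ball_slices, auto)
      also have "norm (v i) * (unit_ball_vol (real (Suc d)) * R i ^ Suc d) =
          sqrt (1 + 4 * \<epsilon>) ^ DIM('a) * (norm (v i) * (unit_ball_vol (real DIM('a)) * r i ^ DIM('a)))"
        by (simp only: d R_def power_mult_distrib mult_ac)
      finally show ?thesis using True r(1)[OF True] \<epsilon>
        by (simp add: emeasure_cball ennreal_mult)
    qed (simp add: \<psi>_def)
    have "(\<integral>\<^sup>+ s. (\<Sum>i. \<psi> i s) \<partial>lborel) = (\<Sum>i. (\<integral>\<^sup>+ s. \<psi> i s \<partial>lborel))"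
      by (rule nn_integral_suminf) measurable
    then show "(\<integral>\<^sup>+ s. (\<Sum>i. \<psi> i s) \<partial>lborel) = ennreal (sqrt (1 + 4 * \<epsilon>) ^ DIM('a)) *
       (\<Sum>i. if i \<in> I then ennreal (norm (v i)) * emeasure lborel (cball (c i) (r i)) else 0)"
      unfolding int by simp
  qed
qed

lemma Vitali_cover_open:
  fixes U :: "'a::euclidean_space set"
  assumes U: "open U" and r0: "r0 > 0"
  obtains I :: "nat set" and r :: "nat \<Rightarrow> real" and c :: "nat \<Rightarrow> 'a"
  where "\<And>i. i \<in> I \<Longrightarrow> 0 < r i" "\<And>i. i \<in> I \<Longrightarrow> r i < r0" "\<And>i. i \<in> I \<Longrightarrow> cball (c i) (r i) \<subseteq> U"
    "disjoint_family_on (\<lambda>i. cball (c i) (r i)) I" "negligible (U - (\<Union>i\<in>I. cball (c i) (r i)))"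
proof -
  define K :: "('a \<times> real) set"
    where "K = {p. 0 < snd p \<and> snd p < r0 \<and> cball (fst p) (snd p) \<subseteq> U}"
  have "\<exists>i. i \<in> K \<and> x \<in> cball (fst i) (snd i) \<and> snd i < e" if x: "x \<in> U" and e: "0 < e" for x e
  proof -
    from U x obtain b where b: "b > 0" "cball x b \<subseteq> U" using open_contains_cball by blast
    define \<rho> where "\<rho> = min b (min (r0/2) (e/2))"
    have "\<rho> > 0" "\<rho> < r0" "\<rho> < e" "\<rho> \<le> b" using b r0 e by (auto simp: \<rho>_def)
    moreover have "cball x \<rho> \<subseteq> U" using b(2) subset_cball[OF \<open>\<rho> \<le> b\<close>, of x] by blast
    ultimately show ?thesis by (intro exI[of _ "(x, \<rho>)"]) (auto simp: K_def)
  qed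
  moreover have "0 < snd i" if "i \<in> K" for i using that by (auto simp: K_def)
  ultimately obtain C where C: "countable C" "C \<subseteq> K"
     "pairwise (\<lambda>i j. disjnt (cball (fst i) (snd i)) (cball (fst j) (snd j))) C"
     "negligible (U - (\<Union>i\<in>C. cball (fst i) (snd i)))"
    using Vitali_covering_theorem_cballs[of K snd U fst] by blast
  from C(1) obtain f and I :: "nat set" where f: "C = f ` I" "inj_on f I"
    unfolding countable_as_injective_image_subset by blast
  have K: "f i \<in> K" if "i \<in> I" for i using C(2) f(1) that by blast
  show thesis
  proof (rule that[of I "snd \<circ> f" "fst \<circ> f"])
    fix i assume "i \<in> I"
    from K[OF this] show "0 < (snd \<circ> f) i" "(snd \<circ> f) i < r0" "cball ((fst \<circ> f) i) ((snd \<circ> f) i) \<subseteq> U"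
      by (auto simp: K_def)
  next
    show "disjoint_family_on (\<lambda>i. cball ((fst \<circ> f) i) ((snd \<circ> f) i)) I"
      unfolding disjoint_family_on_def
    proof (intro ballI impI)
      fix i j assume ij: "i \<in> I" "j \<in> I" "i \<noteq> j"
      then have "f i \<noteq> f j" using f(2) by (auto dest: inj_onD)
      then show "cball ((fst \<circ> f) i) ((snd \<circ> f) i) \<inter> cball ((fst \<circ> f) j) ((snd \<circ> f) j) = {}"
        using C(3) ij f(1) unfolding pairwise_def disjnt_def comp_def by blast
    qed
    show "negligible (U - (\<Union>i\<in>I. cball ((fst \<circ> f) i) ((snd \<circ> f) i)))"
      using C(4) unfolding f(1) by simp
  qed
qed

lemma suminf_indexed_disjoint_emeasure:
  fixes I :: "nat set"
  assumes "disjoint_family_on B I" "\<And>i. i \<in> I \<Longrightarrow> B i \<in> sets M"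
  shows "(\<Sum>i. if i \<in> I then emeasure M (B i) else 0) = emeasure M (\<Union>i\<in>I. B i)"
proof -
  define B' where "B' i = (if i \<in> I then B i else {})" for i
  have "(\<Sum>i. if i \<in> I then emeasure M (B i) else 0) = (\<Sum>i. emeasure M (B' i))"
    by (intro suminf_cong) (simp add: B'_def)
  also have "\<dots> = emeasure M (\<Union>i. B' i)"
    using assms by (intro suminf_emeasure) (auto simp: B'_def disjoint_family_on_def)
  also have "(\<Union>i. B' i) = (\<Union>i\<in>I. B i)" by (auto simp: B'_def split: if_splits)
  finally show ?thesis .
qed

text \<open>Vitali's theorem fills an open set with disjoint balls only up to a null set, while the
  Hausdorff premeasure of a level set needs a genuine cover. The rest is covered by balls of small
  total volume: by the covering lemma, balls of five times the radius of disjoint balls inside an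
  open set of small volume suffice.\<close>

lemma null_set_ball_cover:
  fixes N :: "'a::euclidean_space set"
  assumes N: "negligible N" "N \<subseteq> W" "open W" and r0: "r0 > 0" and \<eta>: "\<eta> > 0"
  obtains I :: "nat set" and r :: "nat \<Rightarrow> real" and c :: "nat \<Rightarrow> 'a"
  where "\<And>i. i \<in> I \<Longrightarrow> 0 < r i" "\<And>i. i \<in> I \<Longrightarrow> r i < r0" "\<And>i. i \<in> I \<Longrightarrow> cball (c i) (r i) \<subseteq> W"
    "N \<subseteq> (\<Union>i\<in>I. cball (c i) (r i))"
    "(\<Sum>i. if i \<in> I then emeasure lborel (cball (c i) (r i)) else 0) \<le> ennreal \<eta>"
proof -
  define n where "n = DIM('a)"
  have Ns: "N \<in> sets lebesgue" using N(1) by (simp add: negligible_imp_sets)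
  have "\<eta> / 5 ^ n > 0" using \<eta> by simp
  from sets_lebesgue_outer_open[OF Ns this]
  obtain T where T: "open T" "N \<subseteq> T" "T - N \<in> lmeasurable" "emeasure lebesgue (T - N) < ennreal (\<eta> / 5 ^ n)" .
  have Ts: "T \<in> sets lebesgue" using T(1) by (intro sets_completionI_sets) simp
  have "emeasure lebesgue ((T - N) \<union> N) \<le> emeasure lebesgue (T - N) + emeasure lebesgue N"
    by (rule emeasure_subadditive[OF sets.Diff[OF Ts Ns] Ns])
  moreover have "(T - N) \<union> N = T" using T(2) by blast
  ultimately have "emeasure lebesgue T \<le> emeasure lebesgue (T - N) + emeasure lebesgue N" by simp
  also have "emeasure lebesgue N = 0" using N(1) by (simp add: negligible_iff_null_sets null_setsD1)
  finally have volT: "emeasure lborel T < ennreal (\<eta> / 5 ^ n)" using T(1,4) by simp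
  have TW: "open (T \<inter> W)" using T(1) N(3) by auto
  have "\<exists>\<rho>. 0 < \<rho> \<and> 5 * \<rho> < r0 \<and> cball x \<rho> \<subseteq> T \<and> cball x (5 * \<rho>) \<subseteq> W" if x: "x \<in> N" for x
  proof -
    from TW x N(2) T(2) obtain b where b: "b > 0" "cball x b \<subseteq> T \<inter> W" using open_contains_cball by blast
    define \<rho> where "\<rho> = min (b / 5) (r0 / 10)"
    have *: "\<rho> > 0" "5 * \<rho> < r0" "5 * \<rho> \<le> b" "\<rho> \<le> b" using b r0 by (auto simp: \<rho>_def)
    have "cball x (5 * \<rho>) \<subseteq> W" "cball x \<rho> \<subseteq> T"
      using b(2) subset_cball[OF *(3), of x] subset_cball[OF *(4), of x] by auto
    with * show ?thesis by blast
  qed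
  then have "\<exists>\<rho>. \<forall>x\<in>N. 0 < \<rho> x \<and> 5 * \<rho> x < r0 \<and> cball x (\<rho> x) \<subseteq> T \<and> cball x (5 * \<rho> x) \<subseteq> W"
    by (intro bchoice ballI)
  then obtain \<rho> where *: "\<forall>x\<in>N. 0 < \<rho> x \<and> 5 * \<rho> x < r0 \<and> cball x (\<rho> x) \<subseteq> T \<and> cball x (5 * \<rho> x) \<subseteq> W"
    by (rule exE)
  have \<rho>: "0 < \<rho> x" "5 * \<rho> x < r0" "cball x (\<rho> x) \<subseteq> T" "cball x (5 * \<rho> x) \<subseteq> W" if "x \<in> N" for x
    using bspec[OF * that] by simp_all
  have "N \<subseteq> (\<Union>x\<in>N. cball x (\<rho> x))" using \<rho>(1) by fastforce
  moreover have "0 < \<rho> x \<and> \<rho> x \<le> r0" if "x \<in> N" for x using \<rho>(1,2)[OF that] by auto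
  ultimately obtain C where C: "countable C" "C \<subseteq> N"
     "pairwise (\<lambda>i j. disjnt (cball i (\<rho> i)) (cball j (\<rho> j))) C" "N \<subseteq> (\<Union>i\<in>C. cball i (5 * \<rho> i))"
    by (rule Vitali_covering_lemma_cballs)
  from C(1) obtain f and I :: "nat set" where f: "C = f ` I" "inj_on f I"
    unfolding countable_as_injective_image_subset by blast
  have fN: "f i \<in> N" if "i \<in> I" for i using C(2) f(1) that by blast
  have disj: "disjoint_family_on (\<lambda>i. cball (f i) (\<rho> (f i))) I"
    unfolding disjoint_family_on_def
  proof (intro ballI impI)
    fix i j assume ij: "i \<in> I" "j \<in> I" "i \<noteq> j"
    then have "f i \<noteq> f j" using f(2) by (auto dest: inj_onD)
    then show "cball (f i) (\<rho> (f i)) \<inter> cball (f j) (\<rho> (f j)) = {}"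
      using C(3) ij f(1) unfolding pairwise_def disjnt_def by blast
  qed
  have "(\<Sum>i. if i \<in> I then emeasure lborel (cball (f i) (5 * \<rho> (f i))) else 0)
      = (\<Sum>i. ennreal (5 ^ n) * (if i \<in> I then emeasure lborel (cball (f i) (\<rho> (f i))) else 0))"
  proof (intro suminf_cong)
    fix i show "(if i \<in> I then emeasure lborel (cball (f i) (5 * \<rho> (f i))) else 0)
      = ennreal (5 ^ n) * (if i \<in> I then emeasure lborel (cball (f i) (\<rho> (f i))) else 0)"
    proof (cases "i \<in> I")
      case True
      then have pos: "0 \<le> \<rho> (f i)" "0 \<le> 5 * \<rho> (f i)" using \<rho>(1)[OF fN[OF True]] by auto
      show ?thesis using True pos
        by (simp add: emeasure_cball n_def power_mult_distrib ennreal_mult'[symmetric] mult_ac)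
    qed simp
  qed
  also have "\<dots> = ennreal (5 ^ n) * emeasure lborel (\<Union>i\<in>I. cball (f i) (\<rho> (f i)))"
    unfolding ennreal_suminf_cmult by (subst suminf_indexed_disjoint_emeasure[OF disj]) auto
  also have "\<dots> \<le> ennreal (5 ^ n) * emeasure lborel T"
    using \<rho>(3) fN T(1) by (intro mult_left_mono emeasure_mono UN_least) auto
  also have "\<dots> \<le> ennreal (5 ^ n) * ennreal (\<eta> / 5 ^ n)"
    using volT by (intro mult_left_mono) auto
  also have "\<dots> = ennreal \<eta>" using \<eta> by (simp add: ennreal_mult'[symmetric])
  finally have small: "(\<Sum>i. if i \<in> I then emeasure lborel (cball (f i) (5 * \<rho> (f i))) else 0) \<le> ennreal \<eta>" .
  show thesis
    by (rule that[of I "\<lambda>i. 5 * \<rho> (f i)" f]) (use \<rho> fN C(4) f(1) small in auto)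
qed

text \<open>The inequality half of the coarea formula, with the constant 1. Balls that cover a set
  \<open>E\<close> efficiently in volume also cover every level set of \<open>g\<close> in \<open>E\<close>, and a ball of radius \<open>r\<close>
  contributes to the integral over the levels what its volume contributes to the integral of the
  gradient, because the level sets in it are nearly the parallel slices of a ball.\<close>

lemma hausdorff_coarea_le:
  fixes g :: "'a::euclidean_space \<Rightarrow> real" and \<gamma> :: "'a \<Rightarrow> 'a"
  assumes W: "open W" "W \<subseteq> C" and C: "compact C"
    and cont: "continuous_on C \<gamma>" and \<gamma>0: "\<And>x. x \<in> C \<Longrightarrow> \<gamma> x \<noteq> 0"
    and meas[measurable]: "\<gamma> \<in> borel_measurable borel"
    and der: "\<And>x. x \<in> W \<Longrightarrow> (g has_derivative (\<lambda>h. \<gamma> x \<bullet> h)) (at x)"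
    and E[measurable]: "E \<in> sets borel" and EW: "E \<subseteq> W"
    and \<epsilon>: "0 < \<epsilon>" "\<epsilon> \<le> 1" and \<delta>: "\<delta> > 0"
  obtains \<Psi> :: "real \<Rightarrow> ennreal" where "\<Psi> \<in> borel_measurable borel"
    "\<And>s. hausdorff_premeasure (DIM('a) - 1) \<delta> {x\<in>E. g x = s} \<le> \<Psi> s"
    "(\<integral>\<^sup>+ s. \<Psi> s \<partial>lborel) \<le> ennreal (sqrt (1 + 4 * \<epsilon>) ^ DIM('a) * (1 + \<epsilon>)) *
       ((\<integral>\<^sup>+ x\<in>E. norm (\<gamma> x) \<partial>lborel) + ennreal \<epsilon>)"
proof -
  obtain m where m: "m > 0" "\<And>x. x \<in> C \<Longrightarrow> m \<le> norm (\<gamma> x)"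
  proof (cases "C = {}")
    case False
    then obtain x where "x \<in> C" "\<forall>y\<in>C. norm (\<gamma> x) \<le> norm (\<gamma> y)"
      using continuous_attains_inf[OF C False, of "\<lambda>x. norm (\<gamma> x)"] cont
      by (auto intro: continuous_intros)
    then show ?thesis using \<gamma>0 by (intro that[of "norm (\<gamma> x)"]) auto
  qed (use that[of 1] in auto)
  obtain M where M: "M > 0" "\<And>x. x \<in> C \<Longrightarrow> norm (\<gamma> x) \<le> M"
    using compact_imp_bounded[OF compact_continuous_image[OF cont C]] unfolding bounded_pos by auto
  have "uniformly_continuous_on C \<gamma>" by (rule compact_uniformly_continuous[OF cont C])
  then obtain r1 where r1: "r1 > 0" "\<And>x y. x \<in> C \<Longrightarrow> y \<in> C \<Longrightarrow> dist x y < r1 \<Longrightarrow> dist (\<gamma> x) (\<gamma> y) < \<epsilon> * m"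
    unfolding uniformly_continuous_on_def using \<epsilon> m(1) by (metis dist_commute mult_pos_pos)
  have centre: "c \<in> C" if "cball c r \<subseteq> W" "0 < r" for c r
    using that W(2) centre_in_cball[of c r] by (meson less_imp_le subsetD)
  \<comment> \<open>On balls of radius below \<open>r0\<close> the gradient varies by at most the fraction \<open>\<epsilon>\<close> of its length.\<close>
  define r0 where "r0 = min r1 (\<delta> / 2)"
  have r0: "r0 > 0" using r1 \<delta> by (simp add: r0_def)
  have var: "norm (\<gamma> y - \<gamma> c) \<le> \<epsilon> * m" if "cball c r \<subseteq> W" "y \<in> cball c r" "0 < r" "r < r0" for c r y
  proof -
    have "c \<in> C" using that(1,3) by (rule centre)
    moreover have "y \<in> C" using that(1,2) W(2) by blast
    moreover have "dist y c < r1" using that by (simp add: r0_def dist_commute)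
    ultimately show ?thesis using r1(2)[of y c] by (simp add: dist_norm)
  qed
  have lin: "\<bar>g y - g c - \<gamma> c \<bullet> (y - c)\<bar> \<le> \<epsilon> * norm (\<gamma> c) * norm (y - c)"
    if ball: "cball c r \<subseteq> W" "0 < r" "r < r0" and y: "y \<in> cball c r" for c r y
  proof -
    have cC: "c \<in> C" using ball(1,2) by (rule centre)
    have "norm (g y - g c - \<gamma> c \<bullet> (y - c)) \<le> norm (y - c) * (\<epsilon> * norm (\<gamma> c))"
    proof (rule differentiable_bound_linearization[where f' = "\<lambda>x h. \<gamma> x \<bullet> h" and S = "cball c r"])
      fix t :: real assume "t \<in> {0..1}"
      then have "(1 - t) *\<^sub>R c + t *\<^sub>R y \<in> cball c r"
        using y ball by (intro convexD[OF convex_cball]) auto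
      then show "c + t *\<^sub>R (y - c) \<in> cball c r" by (simp add: algebra_simps)
    next
      fix x assume x: "x \<in> cball c r"
      show "(g has_derivative (\<lambda>h. \<gamma> x \<bullet> h)) (at x within cball c r)"
        by (rule has_derivative_at_withinI[OF der[OF subsetD[OF ball(1) x]]])
      have "onorm ((\<lambda>h. \<gamma> x \<bullet> h) - (\<lambda>h. \<gamma> c \<bullet> h)) = onorm (\<lambda>h. (\<gamma> x - \<gamma> c) \<bullet> h)"
        by (simp add: fun_diff_def inner_diff_left)
      also have "\<dots> \<le> norm (\<gamma> x - \<gamma> c)" by (rule onorm_bound) (auto simp: Cauchy_Schwarz_ineq2)
      also have "\<dots> \<le> \<epsilon> * m" using var[OF ball(1) x ball(2,3)] .
      also have "\<dots> \<le> \<epsilon> * norm (\<gamma> c)" using \<epsilon> m(2)[OF cC] by (intro mult_left_mono) auto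
      finally show "onorm ((\<lambda>h. \<gamma> x \<bullet> h) - (\<lambda>h. \<gamma> c \<bullet> h)) \<le> \<epsilon> * norm (\<gamma> c)" .
    qed (use ball in auto)
    then show ?thesis by (simp add: mult_ac)
  qed
  define \<mu> where "\<mu> = density lborel (\<lambda>x. ennreal (norm (\<gamma> x)))"
  have \<mu>: "emeasure \<mu> A = (\<integral>\<^sup>+ x\<in>A. norm (\<gamma> x) \<partial>lborel)" if "A \<in> sets borel" for A
    unfolding \<mu>_def using that by (subst emeasure_density) auto
  have \<mu>M: "emeasure \<mu> A \<le> ennreal M * emeasure lborel A" if "A \<in> sets borel" "A \<subseteq> C" for A
  proof -
    have "emeasure \<mu> A \<le> (\<integral>\<^sup>+ x. ennreal M * indicator A x \<partial>lborel)"
      unfolding \<mu>[OF that(1)] using M(2) that(2)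
      by (intro nn_integral_mono) (auto simp: indicator_def intro!: ennreal_leI)
    then show ?thesis using that by (simp add: nn_integral_cmult_indicator)
  qed
  have ball\<mu>: "ennreal (norm (\<gamma> c)) * emeasure lborel (cball c r) \<le> ennreal (1 + \<epsilon>) * emeasure \<mu> (cball c r)"
    if ball: "cball c r \<subseteq> W" "0 < r" "r < r0" for c r
  proof -
    have "ennreal (norm (\<gamma> c)) * emeasure lborel (cball c r) = (\<integral>\<^sup>+ x\<in>cball c r. ennreal (norm (\<gamma> c)) \<partial>lborel)"
      by (rule nn_integral_cmult_indicator[symmetric]) simp
    also have "\<dots> \<le> (\<integral>\<^sup>+ x. ennreal (1 + \<epsilon>) * (ennreal (norm (\<gamma> x)) * indicator (cball c r) x) \<partial>lborel)"
    proof (rule nn_integral_mono)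
      fix x
      have "norm (\<gamma> c) \<le> (1 + \<epsilon>) * norm (\<gamma> x)" if x: "x \<in> cball c r"
      proof -
        have "norm (\<gamma> c) \<le> norm (\<gamma> x) + norm (\<gamma> x - \<gamma> c)"
          using norm_triangle_ineq4[of "\<gamma> x" "\<gamma> x - \<gamma> c"] by simp
        also have "\<dots> \<le> norm (\<gamma> x) + \<epsilon> * m" using var[OF ball(1) x ball(2,3)] by simp
        also have "\<dots> \<le> norm (\<gamma> x) + \<epsilon> * norm (\<gamma> x)"
          using m(2)[OF subsetD[OF W(2) subsetD[OF ball(1) x]]] \<epsilon> by (intro add_left_mono mult_left_mono) auto
        finally show ?thesis by (simp add: algebra_simps)
      qed
      then show "ennreal (norm (\<gamma> c)) * indicator (cball c r) x \<le>
          ennreal (1 + \<epsilon>) * (ennreal (norm (\<gamma> x)) * indicator (cball c r) x)"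
        using \<epsilon> by (cases "x \<in> cball c r")
          (simp_all add: ennreal_mult'[symmetric] ennreal_leI del: ennreal_plus)
    qed
    also have "\<dots> = ennreal (1 + \<epsilon>) * emeasure \<mu> (cball c r)"
    proof (subst nn_integral_cmult)
      have [measurable]: "cball c r \<in> sets borel" by simp
      show "(\<lambda>x. ennreal (norm (\<gamma> x)) * indicator (cball c r) x) \<in> borel_measurable lborel"
        by measurable
    qed (simp add: \<mu>)
    finally show ?thesis .
  qed
  have sum\<mu>: "(\<Sum>i. if i \<in> I then ennreal (norm (\<gamma> (c i))) * emeasure lborel (cball (c i) (r i)) else 0)
       \<le> ennreal (1 + \<epsilon>) * (\<Sum>i. if i \<in> I then emeasure \<mu> (cball (c i) (r i)) else 0)"
    if "\<And>i. i \<in> I \<Longrightarrow> 0 < r i" "\<And>i. i \<in> I \<Longrightarrow> r i < r0" "\<And>i. i \<in> I \<Longrightarrow> cball (c i) (r i) \<subseteq> W"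
    for I :: "nat set" and c :: "nat \<Rightarrow> 'a" and r :: "nat \<Rightarrow> real"
    unfolding ennreal_suminf_cmult[symmetric]
    by (intro suminf_le summableI) (use ball\<mu> that in auto)
  have ev: "E \<in> sets lebesgue" "\<epsilon> / (2 * M) > 0" using \<epsilon> M(1) by auto
  from sets_lebesgue_outer_open[OF this]
  obtain T where T: "open T" "E \<subseteq> T" "T - E \<in> lmeasurable" "emeasure lebesgue (T - E) < ennreal (\<epsilon> / (2 * M))" .
  define U where "U = T \<inter> W"
  have U: "open U" "E \<subseteq> U" "U \<subseteq> W" using T W EW by (auto simp: U_def)
  have "emeasure \<mu> (U - E) \<le> ennreal M * emeasure lborel (U - E)"
    using U W by (intro \<mu>M) auto
  also have "\<dots> \<le> ennreal M * ennreal (\<epsilon> / (2 * M))"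
  proof (rule mult_left_mono)
    have "emeasure lborel (U - E) \<le> emeasure lborel (T - E)"
      using T(1) by (intro emeasure_mono) (auto simp: U_def)
    also have "\<dots> \<le> ennreal (\<epsilon> / (2 * M))" using T(1,4) by simp
    finally show "emeasure lborel (U - E) \<le> ennreal (\<epsilon> / (2 * M))" .
  qed simp
  also have "\<dots> = ennreal (\<epsilon> / 2)" using M(1) \<epsilon> by (simp add: ennreal_mult'[symmetric])
  finally have UE: "emeasure \<mu> (U - E) \<le> ennreal (\<epsilon> / 2)" .
  have U\<mu>: "emeasure \<mu> U \<le> emeasure \<mu> E + ennreal (\<epsilon> / 2)"
  proof -
    have "emeasure \<mu> U \<le> emeasure \<mu> (E \<union> (U - E))" using U by (intro emeasure_mono) (auto simp: \<mu>_def)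
    also have "\<dots> \<le> emeasure \<mu> E + emeasure \<mu> (U - E)"
      using U by (intro emeasure_subadditive) (auto simp: \<mu>_def)
    also have "\<dots> \<le> emeasure \<mu> E + ennreal (\<epsilon> / 2)" by (rule add_left_mono[OF UE])
    finally show ?thesis .
  qed
  obtain I1 :: "nat set" and r1' :: "nat \<Rightarrow> real" and c1 :: "nat \<Rightarrow> 'a"
    where F1: "\<And>i. i \<in> I1 \<Longrightarrow> 0 < r1' i" "\<And>i. i \<in> I1 \<Longrightarrow> r1' i < r0"
      "\<And>i. i \<in> I1 \<Longrightarrow> cball (c1 i) (r1' i) \<subseteq> U"
      "disjoint_family_on (\<lambda>i. cball (c1 i) (r1' i)) I1"
      "negligible (U - (\<Union>i\<in>I1. cball (c1 i) (r1' i)))"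
    using Vitali_cover_open[OF U(1) r0] by blast
  have F1W: "cball (c1 i) (r1' i) \<subseteq> W" if "i \<in> I1" for i using F1(3)[OF that] U(3) by blast
  \<comment> \<open>\<open>E1\<close> is covered by the disjoint balls, whose total mass is controlled by that of \<open>U\<close>; the null set \<open>N\<close> is covered separately.\<close>
  define E1 where "E1 = E \<inter> (\<Union>i\<in>I1. cball (c1 i) (r1' i))"
  define N where "N = E - (\<Union>i\<in>I1. cball (c1 i) (r1' i))"
  have N: "negligible N" "N \<subseteq> W" using F1(5) U EW by (auto simp: N_def intro: negligible_subset)
  obtain I2 :: "nat set" and r2 :: "nat \<Rightarrow> real" and c2 :: "nat \<Rightarrow> 'a"
    where F2: "\<And>i. i \<in> I2 \<Longrightarrow> 0 < r2 i" "\<And>i. i \<in> I2 \<Longrightarrow> r2 i < r0"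
      "\<And>i. i \<in> I2 \<Longrightarrow> cball (c2 i) (r2 i) \<subseteq> W" "N \<subseteq> (\<Union>i\<in>I2. cball (c2 i) (r2 i))"
      "(\<Sum>i. if i \<in> I2 then emeasure lborel (cball (c2 i) (r2 i)) else 0) \<le> ennreal (\<epsilon> / (2 * M))"
    using null_set_ball_cover[OF N W(1) r0 ev(2)] by blast
  have S1: "(\<Sum>i. if i \<in> I1 then emeasure \<mu> (cball (c1 i) (r1' i)) else 0) \<le> emeasure \<mu> E + ennreal (\<epsilon> / 2)"
  proof -
    have "(\<Sum>i. if i \<in> I1 then emeasure \<mu> (cball (c1 i) (r1' i)) else 0) = emeasure \<mu> (\<Union>i\<in>I1. cball (c1 i) (r1' i))"
      by (rule suminf_indexed_disjoint_emeasure[OF F1(4)]) (simp add: \<mu>_def)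
    also have "\<dots> \<le> emeasure \<mu> U" using F1(3) U by (intro emeasure_mono UN_least) (auto simp: \<mu>_def)
    finally show ?thesis using U\<mu> by (rule order_trans)
  qed
  have S2: "(\<Sum>i. if i \<in> I2 then emeasure \<mu> (cball (c2 i) (r2 i)) else 0) \<le> ennreal (\<epsilon> / 2)"
  proof -
    have "(\<Sum>i. if i \<in> I2 then emeasure \<mu> (cball (c2 i) (r2 i)) else 0)
        \<le> (\<Sum>i. ennreal M * (if i \<in> I2 then emeasure lborel (cball (c2 i) (r2 i)) else 0))"
    proof (intro suminf_le summableI)
      fix i show "(if i \<in> I2 then emeasure \<mu> (cball (c2 i) (r2 i)) else 0)
          \<le> ennreal M * (if i \<in> I2 then emeasure lborel (cball (c2 i) (r2 i)) else 0)"
        using \<mu>M[of "cball (c2 i) (r2 i)"] F2(3)[of i] W(2) by auto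
    qed
    also have "\<dots> \<le> ennreal M * ennreal (\<epsilon> / (2 * M))"
      unfolding ennreal_suminf_cmult by (intro mult_left_mono F2(5)) auto
    also have "\<dots> = ennreal (\<epsilon> / 2)" using M(1) \<epsilon> by (simp add: ennreal_mult'[symmetric])
    finally show ?thesis .
  qed
  have two: "2 * r \<le> \<delta>" if "r < r0" for r using that by (simp add: r0_def)
  let ?k = "sqrt (1 + 4 * \<epsilon>) ^ DIM('a)"
  have kmult: "ennreal (?k * (1 + \<epsilon>)) = ennreal ?k * ennreal (1 + \<epsilon>)"
    by (rule ennreal_mult) (use \<epsilon> in auto)
  obtain \<Psi>1 where \<Psi>1: "\<Psi>1 \<in> borel_measurable borel"
    "\<And>s. hausdorff_premeasure (DIM('a) - 1) \<delta> {x\<in>E1. g x = s} \<le> \<Psi>1 s"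
    "(\<integral>\<^sup>+ s. \<Psi>1 s \<partial>lborel) = ennreal ?k *
       (\<Sum>i. if i \<in> I1 then ennreal (norm (\<gamma> (c1 i))) * emeasure lborel (cball (c1 i) (r1' i)) else 0)"
  proof (rule hausdorff_level_sets_ball_family[of \<epsilon> I1 r1' \<delta> "\<lambda>i. \<gamma> (c1 i)" c1 g E1])
    show "\<gamma> (c1 i) \<noteq> 0" if "i \<in> I1" for i
      by (rule \<gamma>0[OF centre[OF F1W[OF that] F1(1)[OF that]]])
    show "\<bar>g y - g (c1 i) - \<gamma> (c1 i) \<bullet> (y - c1 i)\<bar> \<le> \<epsilon> * norm (\<gamma> (c1 i)) * norm (y - c1 i)"
      if "i \<in> I1" "y \<in> cball (c1 i) (r1' i)" for i y
      using lin[OF F1W F1(1) F1(2)] that by blast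
  qed (use \<epsilon> F1 two \<delta> in \<open>auto simp: E1_def\<close>)
  obtain \<Psi>2 where \<Psi>2: "\<Psi>2 \<in> borel_measurable borel"
    "\<And>s. hausdorff_premeasure (DIM('a) - 1) \<delta> {x\<in>N. g x = s} \<le> \<Psi>2 s"
    "(\<integral>\<^sup>+ s. \<Psi>2 s \<partial>lborel) = ennreal ?k *
       (\<Sum>i. if i \<in> I2 then ennreal (norm (\<gamma> (c2 i))) * emeasure lborel (cball (c2 i) (r2 i)) else 0)"
  proof (rule hausdorff_level_sets_ball_family[of \<epsilon> I2 r2 \<delta> "\<lambda>i. \<gamma> (c2 i)" c2 g N])
    show "\<gamma> (c2 i) \<noteq> 0" if "i \<in> I2" for i
      by (rule \<gamma>0[OF centre[OF F2(3)[OF that] F2(1)[OF that]]])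
    show "\<bar>g y - g (c2 i) - \<gamma> (c2 i) \<bullet> (y - c2 i)\<bar> \<le> \<epsilon> * norm (\<gamma> (c2 i)) * norm (y - c2 i)"
      if "i \<in> I2" "y \<in> cball (c2 i) (r2 i)" for i y
      using lin[OF F2(3) F2(1) F2(2)] that by blast
  qed (use \<epsilon> F2 two \<delta> in auto)
  show thesis
  proof
    show "(\<lambda>s. \<Psi>1 s + \<Psi>2 s) \<in> borel_measurable borel" using \<Psi>1(1) \<Psi>2(1) by measurable
    show "hausdorff_premeasure (DIM('a) - 1) \<delta> {x\<in>E. g x = s} \<le> \<Psi>1 s + \<Psi>2 s" for s
    proof -
      have "{x\<in>E. g x = s} = {x\<in>E1. g x = s} \<union> {x\<in>N. g x = s}" by (auto simp: E1_def N_def)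
      then show ?thesis
        using order_trans[OF hausdorff_premeasure_Un[OF \<delta>] add_mono[OF \<Psi>1(2) \<Psi>2(2)]] by simp
    qed
    have "(\<integral>\<^sup>+ s. \<Psi>1 s + \<Psi>2 s \<partial>lborel) = (\<integral>\<^sup>+ s. \<Psi>1 s \<partial>lborel) + (\<integral>\<^sup>+ s. \<Psi>2 s \<partial>lborel)"
      using \<Psi>1(1) \<Psi>2(1) by (intro nn_integral_add) auto
    also have "\<dots> \<le> ennreal ?k * (ennreal (1 + \<epsilon>) * (emeasure \<mu> E + ennreal (\<epsilon> / 2)))
        + ennreal ?k * (ennreal (1 + \<epsilon>) * ennreal (\<epsilon> / 2))"
      unfolding \<Psi>1(3) \<Psi>2(3)
      by (intro add_mono mult_left_mono order_trans[OF sum\<mu>] S1 S2) (use F1 F1W F2 in auto)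
    also have "\<dots> = ennreal (?k * (1 + \<epsilon>)) * (emeasure \<mu> E + (ennreal (\<epsilon> / 2) + ennreal (\<epsilon> / 2)))"
      unfolding kmult by (simp only: distrib_left mult.assoc add.assoc)
    also have "ennreal (\<epsilon> / 2) + ennreal (\<epsilon> / 2) = ennreal \<epsilon>"
      using \<epsilon> by (simp add: ennreal_plus[symmetric] del: ennreal_plus)
    finally show "(\<integral>\<^sup>+ s. \<Psi>1 s + \<Psi>2 s \<partial>lborel) \<le> ennreal (?k * (1 + \<epsilon>)) *
       ((\<integral>\<^sup>+ x\<in>E. norm (\<gamma> x) \<partial>lborel) + ennreal \<epsilon>)" by (simp add: \<mu>)
  qed
qed

lemma hausdorff_premeasure_lipschitz_image:
  fixes f :: "'a::metric_space \<Rightarrow> 'b::metric_space"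
  assumes f: "\<And>x y. dist (f x) (f y) \<le> dist x y"
  shows "hausdorff_premeasure d \<delta> (f ` A) \<le> hausdorff_premeasure d \<delta> A"
proof (rule hausdorff_premeasure_geI)
  fix U :: "nat \<Rightarrow> 'a set"
  assume U: "A \<subseteq> (\<Union>i. U i)" "\<And>i. bounded (U i)" "\<And>i. diameter (U i) \<le> \<delta>"
  have diam: "diameter (f ` U i) \<le> diameter (U i)" for i
  proof (cases "U i = {}")
    case False
    have "(SUP (x, y)\<in>f ` U i \<times> f ` U i. dist x y) \<le> diameter (U i)"
    proof (rule cSUP_least)
      show "f ` U i \<times> f ` U i \<noteq> {}" using False by auto
      fix p assume "p \<in> f ` U i \<times> f ` U i"
      then obtain x y where xy: "x \<in> U i" "y \<in> U i" "p = (f x, f y)" by auto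
      have "dist (f x) (f y) \<le> diameter (U i)"
        using f[of x y] diameter_bounded_bound[OF U(2) xy(1,2)] by linarith
      then show "(case p of (x, y) \<Rightarrow> dist x y) \<le> diameter (U i)" using xy by simp
    qed
    then show ?thesis using False by (simp add: diameter_def[of "f ` U i"])
  qed simp
  have bdd: "bounded (f ` U i)" for i
  proof -
    from U(2) obtain a e where "\<forall>y\<in>U i. dist a y \<le> e" unfolding bounded_def by blast
    then have "\<forall>y\<in>f ` U i. dist (f a) y \<le> e" using f order_trans by blast
    then show ?thesis unfolding bounded_def by blast
  qed
  have "hausdorff_premeasure d \<delta> (f ` A) \<le> (\<Sum>i. hausdorff_gauge d (f ` U i))"
  proof (rule hausdorff_premeasure_le)
    show "f ` A \<subseteq> (\<Union>i. f ` U i)" using image_mono[OF U(1), of f] by (simp only: image_UN)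
    show "bounded (f ` U i)" for i by (rule bdd)
    show "diameter (f ` U i) \<le> \<delta>" for i using diam[of i] U(3)[of i] by linarith
  qed
  also have "\<dots> \<le> (\<Sum>i. hausdorff_gauge d (U i))"
  proof (intro suminf_le summableI)
    fix i
    have "unit_ball_vol (real d) * (diameter (f ` U i) / 2) ^ d \<le> unit_ball_vol (real d) * (diameter (U i) / 2) ^ d"
      using diam[of i] diameter_ge_0[OF bdd[of i]] by (intro mult_left_mono power_mono) auto
    then show "hausdorff_gauge d (f ` U i) \<le> hausdorff_gauge d (U i)"
      by (auto intro!: ennreal_leI)
  qed
  finally show "hausdorff_premeasure d \<delta> (f ` A) \<le> (\<Sum>i. hausdorff_gauge d (U i))" .
qed

text \<open>All level sets of a positively homogeneous function are dilates of each other. For levels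
  above 1 they are larger than the level set 1, so that the coarea inequality over the shell of
  levels between 1 and \<open>1 + h\<close> bounds \<open>h\<close> times the area of the level set 1.\<close>

lemma hausdorff_level_set_le_shell:
  fixes g :: "'a::euclidean_space \<Rightarrow> real" and \<gamma> :: "'a \<Rightarrow> 'a"
  assumes W: "open W" "W \<subseteq> C" and C: "compact C"
    and cont: "continuous_on C \<gamma>" and \<gamma>0: "\<And>x. x \<in> C \<Longrightarrow> \<gamma> x \<noteq> 0"
    and meas: "\<gamma> \<in> borel_measurable borel" and gmeas[measurable]: "g \<in> borel_measurable borel"
    and der: "\<And>x. x \<in> W \<Longrightarrow> (g has_derivative (\<lambda>h. \<gamma> x \<bullet> h)) (at x)"
    and hom: "\<And>s x. s > 0 \<Longrightarrow> g (s *\<^sub>R x) = s * g x"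
    and shell: "\<And>x. 1 < g x \<Longrightarrow> g x \<le> 1 + h \<Longrightarrow> x \<in> W"
    and A[measurable]: "A \<in> sets borel" and A1: "\<And>x. x \<in> A \<Longrightarrow> g x = 1" and h: "h > 0"
  shows "ennreal h * hausdorff_outer_measure (DIM('a) - 1) A
     \<le> (\<integral>\<^sup>+ x\<in>{y. 1 < g y \<and> g y \<le> 1 + h \<and> y /\<^sub>R g y \<in> A}. norm (\<gamma> x) \<partial>lborel)"
proof -
  define E where "E = {y. 1 < g y \<and> g y \<le> 1 + h \<and> y /\<^sub>R g y \<in> A}"
  have E: "E \<in> sets borel" unfolding E_def by measurable
  have EW: "E \<subseteq> W" using shell by (auto simp: E_def)
  define T where "T = (\<integral>\<^sup>+ x\<in>E. norm (\<gamma> x) \<partial>lborel)"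
  have main: "ennreal h * hausdorff_premeasure (DIM('a) - 1) \<delta> A \<le> T" if \<delta>: "\<delta> > 0" for \<delta>
  proof -
    let ?a = "hausdorff_premeasure (DIM('a) - 1) \<delta> A"
    have approx: "ennreal h * ?a \<le> ennreal (sqrt (1 + 4 * \<epsilon>) ^ DIM('a) * (1 + \<epsilon>)) * (T + ennreal \<epsilon>)"
      if \<epsilon>: "0 < \<epsilon>" "\<epsilon> \<le> 1" for \<epsilon>
    proof -
      obtain \<Psi> :: "real \<Rightarrow> ennreal" where \<Psi>: "\<Psi> \<in> borel_measurable borel"
        "\<And>s. hausdorff_premeasure (DIM('a) - 1) \<delta> {x\<in>E. g x = s} \<le> \<Psi> s"
        "(\<integral>\<^sup>+ s. \<Psi> s \<partial>lborel) \<le> ennreal (sqrt (1 + 4 * \<epsilon>) ^ DIM('a) * (1 + \<epsilon>)) *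
           ((\<integral>\<^sup>+ x\<in>E. norm (\<gamma> x) \<partial>lborel) + ennreal \<epsilon>)"
        using hausdorff_coarea_le[OF W C cont \<gamma>0 meas der E EW \<epsilon> \<delta>] by blast
      have level: "?a \<le> \<Psi> s" if s: "1 < s" "s \<le> 1 + h" for s
      proof -
        have sub: "A \<subseteq> (\<lambda>x. x /\<^sub>R s) ` {x\<in>E. g x = s}"
        proof
          fix x assume x: "x \<in> A"
          have gs: "g (s *\<^sub>R x) = s" using hom[of s x] A1[OF x] s by simp
          have "s *\<^sub>R x \<in> {x\<in>E. g x = s}" using gs s x by (simp add: E_def)
          moreover have "x = (s *\<^sub>R x) /\<^sub>R s" using s by simp
          ultimately show "x \<in> (\<lambda>x. x /\<^sub>R s) ` {x\<in>E. g x = s}" by (rule rev_image_eqI)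
        qed
        have contr: "dist (x /\<^sub>R s) (y /\<^sub>R s) \<le> dist x y" for x y :: 'a
        proof -
          have "dist (x /\<^sub>R s) (y /\<^sub>R s) = inverse s * dist x y"
            using s by (simp add: dist_norm scaleR_diff_right[symmetric])
          also have "\<dots> \<le> 1 * dist x y" using s by (intro mult_right_mono) (auto simp: inverse_le_1_iff)
          finally show ?thesis by simp
        qed
        have "?a \<le> hausdorff_premeasure (DIM('a) - 1) \<delta> ((\<lambda>x. x /\<^sub>R s) ` {x\<in>E. g x = s})"
          by (rule hausdorff_premeasure_mono[OF sub])
        also have "\<dots> \<le> hausdorff_premeasure (DIM('a) - 1) \<delta> {x\<in>E. g x = s}"
          by (rule hausdorff_premeasure_lipschitz_image[OF contr])
        also have "\<dots> \<le> \<Psi> s" by (rule \<Psi>(2))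
        finally show ?thesis .
      qed
      have "ennreal h * ?a = (\<integral>\<^sup>+ s. ?a * indicator {1<..1 + h} s \<partial>lborel)"
        using h by (subst nn_integral_cmult_indicator) (auto simp: mult.commute)
      also have "\<dots> \<le> (\<integral>\<^sup>+ s. \<Psi> s \<partial>lborel)"
        using level by (intro nn_integral_mono) (auto simp: indicator_def)
      also note \<Psi>(3)
      finally show ?thesis unfolding T_def .
    qed
    show ?thesis
    proof (cases T rule: ennreal_cases)
      case (real t)
      define e where "e k = inverse (real (Suc k))" for k
      have e: "0 < e k" "e k \<le> 1" for k by (auto simp: e_def inverse_le_1_iff)
      have e0: "e \<longlonglongrightarrow> 0" unfolding e_def by (rule LIMSEQ_inverse_real_of_nat)
      have "(\<lambda>k. sqrt (1 + 4 * e k) ^ DIM('a) * (1 + e k) * (t + e k)) \<longlonglongrightarrow> sqrt (1 + 4 * 0) ^ DIM('a) * (1 + 0) * (t + 0)"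
        by (intro tendsto_intros e0)
      then have "(\<lambda>k. ennreal (sqrt (1 + 4 * e k) ^ DIM('a) * (1 + e k) * (t + e k))) \<longlonglongrightarrow> ennreal t"
        by (intro tendsto_ennrealI) simp
      moreover have "ennreal h * ?a \<le> ennreal (sqrt (1 + 4 * e k) ^ DIM('a) * (1 + e k) * (t + e k))" for k
      proof -
        have "ennreal h * ?a \<le> ennreal (sqrt (1 + 4 * e k) ^ DIM('a) * (1 + e k)) * (T + ennreal (e k))"
          by (rule approx[OF e])
        also have "\<dots> = ennreal (sqrt (1 + 4 * e k) ^ DIM('a) * (1 + e k) * (t + e k))"
          using real e[of k] by (simp add: ennreal_mult''[symmetric] ennreal_plus[symmetric] del: ennreal_plus)
        finally show ?thesis .
      qed
      ultimately have "ennreal h * ?a \<le> ennreal t" by (intro LIMSEQ_le_const) auto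
      then show ?thesis using real by simp
    qed simp
  qed
  have "ennreal h * hausdorff_outer_measure (DIM('a) - 1) A =
      (SUP \<delta>\<in>{0<..}. ennreal h * hausdorff_premeasure (DIM('a) - 1) \<delta> A)"
    unfolding hausdorff_outer_measure_def by (rule SUP_mult_left_ennreal)
  also have "\<dots> \<le> T" by (rule SUP_least) (use main in auto)
  finally show ?thesis unfolding T_def E_def .
qed

section \<open>Functions of class C2\<close>

lemma C2_onI:
  fixes f' :: "'a::real_normed_vector \<Rightarrow> 'a \<Rightarrow>\<^sub>L 'b::real_normed_vector"
  assumes "\<And>x. x \<in> S \<Longrightarrow> (f has_derivative blinfun_apply (f' x)) (at x)"
    and "\<And>x. x \<in> S \<Longrightarrow> (f' has_derivative blinfun_apply (f'' x)) (at x)"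
    and "continuous_on S f''"
  shows "C2_on S f"
  unfolding C2_on_def using assms by blast

lemma C2_on_const: "C2_on S (\<lambda>x. c)"
  by (rule C2_onI[where f' = "\<lambda>_. 0" and f'' = "\<lambda>_. 0"]) (auto intro!: derivative_eq_intros)

lemma C2_on_linear:
  assumes "bounded_linear f" shows "C2_on S f"
proof (rule C2_onI[where f' = "\<lambda>_. Blinfun f" and f'' = "\<lambda>_. 0"])
  fix x show "(f has_derivative blinfun_apply (Blinfun f)) (at x)"
    using assms by (simp add: bounded_linear_Blinfun_apply bounded_linear_imp_has_derivative)
qed (auto intro!: derivative_eq_intros)

lemma C2_on_add:
  assumes "C2_on S f" "C2_on S g" shows "C2_on S (\<lambda>x. f x + g x)"
proof -
  from assms(1) obtain f' f'' where f: "\<forall>x\<in>S. (f has_derivative blinfun_apply (f' x)) (at x)"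
     "\<forall>x\<in>S. (f' has_derivative blinfun_apply (f'' x)) (at x)" "continuous_on S f''"
    unfolding C2_on_def by blast
  from assms(2) obtain g' g'' where g: "\<forall>x\<in>S. (g has_derivative blinfun_apply (g' x)) (at x)"
     "\<forall>x\<in>S. (g' has_derivative blinfun_apply (g'' x)) (at x)" "continuous_on S g''"
    unfolding C2_on_def by blast
  show ?thesis
    by (rule C2_onI[where f' = "\<lambda>x. f' x + g' x" and f'' = "\<lambda>x. f'' x + g'' x"])
      (use f g in \<open>auto intro!: has_derivative_eq_rhs[OF has_derivative_add] continuous_on_add
        simp: plus_blinfun.rep_eq\<close>)
qed

lemma C2_on_sum:
  assumes "\<And>i. i \<in> I \<Longrightarrow> C2_on S (f i)" shows "C2_on S (\<lambda>x. \<Sum>i\<in>I. f i x)"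
  using assms by (induction I rule: infinite_finite_induct) (auto intro: C2_on_const C2_on_add)

text \<open>The second derivative of \<open>h \<circ> f\<close> is \<open>h''(f) df \<otimes> df + h'(f) d\<^sup>2f\<close>.\<close>

lemma C2_on_compose_real:
  fixes f :: "'a::real_normed_vector \<Rightarrow> real" and h h' h'' :: "real \<Rightarrow> real"
  assumes "C2_on S f"
    and h1: "\<And>x. x \<in> S \<Longrightarrow> (h has_real_derivative h' (f x)) (at (f x))"
    and h2: "\<And>x. x \<in> S \<Longrightarrow> (h' has_real_derivative h'' (f x)) (at (f x))"
    and h3: "continuous_on (f ` S) h''"
  shows "C2_on S (\<lambda>x. h (f x))"
proof -
  from assms(1) obtain f' f'' where f: "\<And>x. x \<in> S \<Longrightarrow> (f has_derivative blinfun_apply (f' x)) (at x)"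
     "\<And>x. x \<in> S \<Longrightarrow> (f' has_derivative blinfun_apply (f'' x)) (at x)" "continuous_on S f''"
    unfolding C2_on_def by blast
  have cf: "continuous_on S f" "continuous_on S f'"
    using f(1,2) by (meson has_derivative_at_withinI has_derivative_continuous_on)+
  show ?thesis
  proof (rule C2_onI[where f' = "\<lambda>x. h' (f x) *\<^sub>R f' x"
        and f'' = "\<lambda>x. (blinfun_scaleR_left (f' x) o\<^sub>L (h'' (f x) *\<^sub>R f' x)) + h' (f x) *\<^sub>R f'' x"])
    fix x assume x: "x \<in> S"
    show "((\<lambda>x. h (f x)) has_derivative blinfun_apply (h' (f x) *\<^sub>R f' x)) (at x)"
      using has_derivative_compose[OF f(1)[OF x] h1[OF x, unfolded has_field_derivative_def]]
      by (simp add: scaleR_blinfun.rep_eq)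
    have "((\<lambda>x. h' (f x)) has_derivative (\<lambda>v. h'' (f x) * f' x v)) (at x)"
      using has_derivative_compose[OF f(1)[OF x] h2[OF x, unfolded has_field_derivative_def]] by simp
    from has_derivative_scaleR[OF this f(2)[OF x]]
    show "((\<lambda>x. h' (f x) *\<^sub>R f' x) has_derivative
        blinfun_apply ((blinfun_scaleR_left (f' x) o\<^sub>L (h'' (f x) *\<^sub>R f' x)) + h' (f x) *\<^sub>R f'' x)) (at x)"
      by (rule has_derivative_eq_rhs)
        (auto simp: fun_eq_iff plus_blinfun.rep_eq scaleR_blinfun.rep_eq add.commute)
  next
    have c1: "continuous_on S (\<lambda>x. h'' (f x))"
      using continuous_on_compose[OF cf(1) h3] by (simp add: comp_def)
    have "continuous_on (f ` S) h'"
      unfolding continuous_on_eq_continuous_within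
      using h2 by (auto intro: DERIV_isCont continuous_at_imp_continuous_within)
    then have c2: "continuous_on S (\<lambda>x. h' (f x))"
      using continuous_on_compose[OF cf(1)] by (simp add: comp_def)
    show "continuous_on S (\<lambda>x. (blinfun_scaleR_left (f' x) o\<^sub>L (h'' (f x) *\<^sub>R f' x)) + h' (f x) *\<^sub>R f'' x)"
      by (intro continuous_on_add bounded_bilinear.continuous_on[OF bounded_bilinear_blinfun_compose]
          bounded_linear.continuous_on[OF bounded_linear_blinfun_scaleR_left] continuous_on_scaleR c1 c2 cf f(3))
  qed
qed

lemma C2_on_power:
  fixes f :: "'a::real_normed_vector \<Rightarrow> real"
  assumes "C2_on S f" shows "C2_on S (\<lambda>x. f x ^ n)"
  by (rule C2_on_compose_real[OF assms, where h' = "\<lambda>y. real n * y ^ (n - 1)"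
        and h'' = "\<lambda>y. real n * (real (n - 1) * y ^ (n - 1 - 1))"])
    (auto intro!: derivative_eq_intros continuous_intros)

text \<open>Polarisation reduces products to squares, which are compositions with a function of one variable.\<close>

lemma C2_on_mult:
  fixes f g :: "'a::real_normed_vector \<Rightarrow> real"
  assumes "C2_on S f" "C2_on S g" shows "C2_on S (\<lambda>x. f x * g x)"
proof -
  have scale: "C2_on S (\<lambda>x. c * k x)" if "C2_on S k" for c and k :: "'a \<Rightarrow> real"
    by (rule C2_on_compose_real[OF that, where h' = "\<lambda>_. c" and h'' = "\<lambda>_. 0"])
      (auto intro!: derivative_eq_intros continuous_intros)
  have "C2_on S (\<lambda>x. (1/4) * (f x + g x) ^ 2 + (-1/4) * (f x + (-1) * g x) ^ 2)"
    by (intro C2_on_add scale C2_on_power assms)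
  moreover have "(1/4) * (f x + g x) ^ 2 + (-1/4) * (f x + (-1) * g x) ^ 2 = f x * g x" for x
    by (simp add: power2_eq_square field_simps)
  ultimately show ?thesis by simp
qed

lemma C2_on_inverse_sqrt:
  fixes f :: "'a::real_normed_vector \<Rightarrow> real"
  assumes "C2_on S f" "\<And>x. x \<in> S \<Longrightarrow> f x > 0" shows "C2_on S (\<lambda>x. f x powr (-1/2))"
proof (rule C2_on_compose_real[OF assms(1), where h' = "\<lambda>y. (-1/2) * y powr (-1/2 - 1)"
      and h'' = "\<lambda>y. (-1/2) * ((-1/2 - 1) * y powr (-1/2 - 1 - 1))"])
  fix x assume x: "x \<in> S"
  show "((\<lambda>y. y powr (-1/2)) has_real_derivative (-1/2) * f x powr (-1/2 - 1)) (at (f x))"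
    using has_real_derivative_powr[OF assms(2)[OF x]] .
  show "((\<lambda>y. (-1/2) * y powr (-1/2 - 1)) has_real_derivative
      (-1/2) * ((-1/2 - 1) * f x powr (-1/2 - 1 - 1))) (at (f x))"
    by (rule DERIV_cmult[OF has_real_derivative_powr[OF assms(2)[OF x]]])
qed (use assms(2) in \<open>force intro!: continuous_intros\<close>)

section \<open>Bodies bounded by level sets of even homogeneous polynomials\<close>

text \<open>The tangent inequality for the convex function \<open>t \<mapsto> t\<^sup>q\<close>. With squares inserted for \<open>s\<close> and \<open>t\<close>
  it yields tangent inequalities for even powers of linear forms and of the norm.\<close>

lemma power_tangent_le:
  fixes s t :: real
  assumes "s \<ge> 0" "t \<ge> 0"
  shows "s ^ q + real q * s ^ (q - 1) * (t - s) \<le> t ^ q"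
proof (induction q)
  case (Suc q)
  show ?case
  proof (cases q)
    case 0 then show ?thesis by simp
  next
    case q: (Suc p)
    have "s ^ Suc q + real (Suc q) * s ^ q * (t - s)
        = t * (s ^ q + real q * s ^ (q - 1) * (t - s)) - real q * s ^ (q - 1) * (t - s)\<^sup>2"
      by (simp add: q power2_eq_square algebra_simps)
    also have "\<dots> \<le> t * (s ^ q + real q * s ^ (q - 1) * (t - s))" using assms by simp
    also have "\<dots> \<le> t * t ^ q" by (rule mult_left_mono[OF Suc assms(2)])
    finally show ?thesis by simp
  qed
qed simp

text \<open>The smooth bodies used for the approximation are the unit balls \<open>K\<close> of the norms \<open>g\<close> whose
  \<open>2q\<close>-th power is a sum \<open>\<phi>\<close> of \<open>2q\<close>-th powers of linear forms and a multiple of \<open>|x|\<^sup>2\<^sup>q\<close>. The last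
  summand makes \<open>\<phi>\<close> strongly convex away from the origin. The vector fields \<open>G\<close> and \<open>\<gamma>\<close> are the
  gradients of \<open>\<phi>\<close> and \<open>g\<close>. Homogeneity of \<open>\<phi>\<close> makes the support function explicit at normal vectors
  (by Euler's identity) and makes all dilates of \<open>K\<close> sublevel sets of the same function.\<close>

locale power_body =
  fixes B :: "'a::euclidean_space set" and q :: nat and c :: real
  assumes finB: "finite B" and q1: "1 \<le> q" and c0: "0 < c"
begin

definition \<phi> :: "'a \<Rightarrow> real" where
  "\<phi> x = (\<Sum>b\<in>B. (b \<bullet> x) ^ (2 * q)) + c * (x \<bullet> x) ^ q"

definition G :: "'a \<Rightarrow> 'a" where
  "G x = (\<Sum>b\<in>B. (2 * real q * (b \<bullet> x) ^ (2 * q - 1)) *\<^sub>R b) + (2 * real q * c * (x \<bullet> x) ^ (q - 1)) *\<^sub>R x"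

definition K :: "'a set" where "K = {x. \<phi> x \<le> 1}"

definition g :: "'a \<Rightarrow> real" where "g x = root (2 * q) (\<phi> x)"

definition \<gamma> :: "'a \<Rightarrow> 'a" where "\<gamma> x = inverse (2 * real q * g x ^ (2 * q - 1)) *\<^sub>R G x"

lemma q0: "0 < 2 * q" using q1 by simp

lemma phi_scale: "\<phi> (s *\<^sub>R x) = s ^ (2 * q) * \<phi> x"
  by (simp add: \<phi>_def power_mult_distrib sum_distrib_left power_mult algebra_simps power2_eq_square)

lemma phi_minus: "\<phi> (- x) = \<phi> x"
  using phi_scale[of "-1" x] by simp

lemma phi_ge: "c * (x \<bullet> x) ^ q \<le> \<phi> x"
  by (auto simp: \<phi>_def intro!: sum_nonneg)

lemma phi_zero [simp]: "\<phi> 0 = 0"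
  using phi_scale[of 0 0] q0 by (simp add: power_0_left)

lemma phi_pos: "x \<noteq> 0 \<Longrightarrow> \<phi> x > 0"
  using phi_ge[of x] c0 by (intro less_le_trans[OF _ phi_ge[of x]]) simp

lemma phi_nonneg: "\<phi> x \<ge> 0"
  using phi_pos[of x] by (cases "x = 0") auto

lemma phi_deriv: "(\<phi> has_derivative (\<lambda>h. G x \<bullet> h)) (at x)"
  unfolding \<phi>_def[abs_def] G_def
  by (rule has_derivative_eq_rhs, (rule derivative_intros)+)
    (auto simp: fun_eq_iff inner_add_left inner_sum_left inner_sum_right algebra_simps inner_commute intro!: sum.cong)

lemma phi_cont: "continuous_on S \<phi>"
  unfolding \<phi>_def[abs_def] by (intro continuous_intros)

lemma G_cont: "continuous_on S G"
  unfolding G_def[abs_def] by (intro continuous_intros)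

lemma G_scale: "G (s *\<^sub>R x) = s ^ (2 * q - 1) *\<^sub>R G x"
proof -
  have "(s *\<^sub>R x \<bullet> s *\<^sub>R x) ^ (q - 1) * s = s ^ (2 * q - 1) * (x \<bullet> x) ^ (q - 1)"
  proof -
    have "2 * q - 1 = Suc (2 * (q - 1))" using q1 by simp
    then show ?thesis
      by (simp add: power_mult_distrib power_mult power2_eq_square)
  qed
  then have "(2 * real q * c * (s *\<^sub>R x \<bullet> s *\<^sub>R x) ^ (q - 1)) *\<^sub>R (s *\<^sub>R x)
      = s ^ (2 * q - 1) *\<^sub>R ((2 * real q * c * (x \<bullet> x) ^ (q - 1)) *\<^sub>R x)"
    by (simp only: scaleR_scaleR mult.assoc) (simp add: mult_ac)
  then show ?thesis
    unfolding G_def scaleR_add_right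
    by (simp add: scaleR_sum_right power_mult_distrib mult_ac)
qed

lemma Euler: "G x \<bullet> x = 2 * real q * \<phi> x"
proof -
  have 1: "(b \<bullet> x) ^ (2 * q - 1) * (b \<bullet> x) = (b \<bullet> x) ^ (2 * q)" for b
    using q0 by (metis mult.commute power_eq_if not_gr_zero)
  have 2: "(x \<bullet> x) ^ (q - 1) * (x \<bullet> x) = (x \<bullet> x) ^ q"
    using q1 by (metis mult.commute power_eq_if not_one_le_zero)
  have "G x \<bullet> x = (\<Sum>b\<in>B. 2 * real q * ((b \<bullet> x) ^ (2 * q - 1) * (b \<bullet> x))) + 2 * real q * c * ((x \<bullet> x) ^ (q - 1) * (x \<bullet> x))"
    by (simp add: G_def inner_add_left inner_sum_left mult_ac)
  then show ?thesis unfolding 1 2 \<phi>_def by (simp add: sum_distrib_left algebra_simps)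
qed

lemma G_nonzero: "x \<noteq> 0 \<Longrightarrow> G x \<noteq> 0"
  using Euler[of x] phi_pos[of x] q1 by auto

text \<open>Each summand \<open>(b \<bullet> x)\<^sup>2\<^sup>q\<close> lies above its tangent. For the summand \<open>(x \<bullet> x)\<^sup>q\<close> the outer
  power lies above its tangent in the variable \<open>x \<bullet> x\<close>, and the quadratic function inside has the
  exact remainder \<open>|y - x|\<^sup>2\<close>; this gives the quantitative term.\<close>

lemma phi_tangent:
  "\<phi> x + G x \<bullet> (y - x) + real q * c * (x \<bullet> x) ^ (q - 1) * (norm (y - x))\<^sup>2 \<le> \<phi> y"
proof -
  have one: "(b \<bullet> x) ^ (2 * q) + 2 * real q * (b \<bullet> x) ^ (2 * q - 1) * (b \<bullet> (y - x)) \<le> (b \<bullet> y) ^ (2 * q)" for b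
  proof -
    define s t where "s = b \<bullet> x" and "t = b \<bullet> y"
    have e: "2 * q - 1 = Suc (2 * (q - 1))" using q1 by simp
    have "2 * s * (t - s) \<le> t\<^sup>2 - s\<^sup>2"
    proof -
      have "0 \<le> (t - s)\<^sup>2" by simp
      then show ?thesis by (simp add: power2_eq_square algebra_simps)
    qed
    then have "(s\<^sup>2) ^ q + real q * (s\<^sup>2) ^ (q - 1) * (2 * s * (t - s))
        \<le> (s\<^sup>2) ^ q + real q * (s\<^sup>2) ^ (q - 1) * (t\<^sup>2 - s\<^sup>2)"
      by (intro add_left_mono mult_left_mono) auto
    also have "\<dots> \<le> (t\<^sup>2) ^ q" by (rule power_tangent_le) auto
    finally have fin: "(s\<^sup>2) ^ q + real q * (s\<^sup>2) ^ (q - 1) * (2 * s * (t - s)) \<le> (t\<^sup>2) ^ q" .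
    have "s ^ (2 * q) + 2 * real q * s ^ (2 * q - 1) * (t - s) \<le> t ^ (2 * q)"
    proof -
      have "s ^ (2 * q - 1) = s * (s\<^sup>2) ^ (q - 1)" unfolding e by (simp only: power_Suc power_mult)
      then have "2 * real q * s ^ (2 * q - 1) * (t - s) = real q * (s\<^sup>2) ^ (q - 1) * (2 * s * (t - s))"
        by (simp only: mult_ac)
      then show ?thesis using fin by (simp only: power_mult)
    qed
    then show ?thesis by (simp add: s_def t_def inner_diff_right)
  qed
  have two: "(x \<bullet> x) ^ q + real q * (x \<bullet> x) ^ (q - 1) * (2 * (x \<bullet> (y - x)) + (norm (y - x))\<^sup>2) \<le> (y \<bullet> y) ^ q"
  proof -
    have "2 * (x \<bullet> (y - x)) + (norm (y - x))\<^sup>2 = y \<bullet> y - x \<bullet> x"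
      by (simp add: power2_norm_eq_inner inner_diff_left inner_diff_right inner_commute)
    then show ?thesis using power_tangent_le[of "x \<bullet> x" "y \<bullet> y" q] by simp
  qed
  have "(\<Sum>b\<in>B. (b \<bullet> x) ^ (2 * q) + 2 * real q * (b \<bullet> x) ^ (2 * q - 1) * (b \<bullet> (y - x))) \<le> (\<Sum>b\<in>B. (b \<bullet> y) ^ (2 * q))"
    by (intro sum_mono one)
  moreover have "c * ((x \<bullet> x) ^ q + real q * (x \<bullet> x) ^ (q - 1) * (2 * (x \<bullet> (y - x)) + (norm (y - x))\<^sup>2)) \<le> c * (y \<bullet> y) ^ q"
    using c0 by (intro mult_left_mono two) auto
  moreover have "\<phi> x + G x \<bullet> (y - x) + real q * c * (x \<bullet> x) ^ (q - 1) * (norm (y - x))\<^sup>2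
     = (\<Sum>b\<in>B. (b \<bullet> x) ^ (2 * q) + 2 * real q * (b \<bullet> x) ^ (2 * q - 1) * (b \<bullet> (y - x)))
       + c * ((x \<bullet> x) ^ q + real q * (x \<bullet> x) ^ (q - 1) * (2 * (x \<bullet> (y - x)) + (norm (y - x))\<^sup>2))"
    unfolding \<phi>_def G_def
    by (simp only: inner_add_left inner_sum_left inner_scaleR_left sum.distrib) (simp add: algebra_simps)
  ultimately show ?thesis unfolding \<phi>_def[of y] by linarith
qed

lemma phi_tangent': "\<phi> x + G x \<bullet> (y - x) \<le> \<phi> y"
proof -
  have "0 \<le> real q * c * (x \<bullet> x) ^ (q - 1) * (norm (y - x))\<^sup>2" using c0 by simp
  then show ?thesis using phi_tangent[of x y] by linarith
qed

lemma zero_in_K: "0 \<in> K" by (simp add: K_def)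

lemma K_symmetric: "origin_symmetric K"
proof -
  have "x \<in> uminus ` K" if "x \<in> K" for x
    by (rule image_eqI[of _ _ "- x"]) (use that in \<open>auto simp: K_def phi_minus\<close>)
  then show ?thesis by (auto simp: origin_symmetric_def K_def phi_minus)
qed

lemma K_convex: "convex K"
  unfolding convex_alt
proof (intro ballI allI impI)
  fix x y t assume xy: "x \<in> K" "y \<in> K" and t: "0 \<le> t \<and> t \<le> (1::real)"
  define z where "z = (1 - t) *\<^sub>R x + t *\<^sub>R y"
  have "\<phi> z = (1 - t) * (\<phi> z + G z \<bullet> (x - z)) + t * (\<phi> z + G z \<bullet> (y - z))"
  proof -
    have "(1 - t) *\<^sub>R (x - z) + t *\<^sub>R (y - z) = 0" by (simp add: z_def algebra_simps)
    then have "G z \<bullet> ((1 - t) *\<^sub>R (x - z) + t *\<^sub>R (y - z)) = 0" by simp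
    then show ?thesis by (simp add: inner_add_right algebra_simps)
  qed
  also have "\<dots> \<le> (1 - t) * 1 + t * 1"
    using xy t phi_tangent'[of z x] phi_tangent'[of z y]
    by (intro add_mono mult_left_mono) (auto simp: K_def)
  finally show "(1 - t) *\<^sub>R x + t *\<^sub>R y \<in> K" by (simp add: K_def z_def)
qed

lemma sublevel_bounded: "bounded {x. \<phi> x \<le> s}"
proof -
  have "norm x \<le> 1 + \<bar>s\<bar> / c" if "\<phi> x \<le> s" for x
  proof (cases "norm x \<le> 1")
    case False
    then have n1: "1 \<le> norm x" by simp
    have "norm x \<le> norm x ^ (2 * q)" using n1 q0 by (metis power_increasing power_one_right less_eq_Suc_le One_nat_def)
    also have "\<dots> = (x \<bullet> x) ^ q" by (simp add: power_mult power2_norm_eq_inner)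
    also have "\<dots> \<le> s / c" using phi_ge[of x] that c0 by (simp add: field_simps)
    also have "\<dots> \<le> \<bar>s\<bar> / c" using c0 by (intro divide_right_mono) auto
    finally show ?thesis by simp
  qed (use c0 in \<open>auto intro: order_trans[of _ 1]\<close>)
  then show ?thesis unfolding bounded_iff by blast
qed

lemma sublevel_closed: "closed {x. \<phi> x \<le> s}"
  by (rule closed_Collect_le[OF phi_cont continuous_on_const])

lemma K_compact: "compact K"
  unfolding K_def compact_eq_bounded_closed using sublevel_bounded sublevel_closed by simp

lemma K_interior: "interior K = {x. \<phi> x < 1}"
proof (rule antisym)
  have "open {x. \<phi> x < 1}" by (rule open_Collect_less[OF phi_cont continuous_on_const])
  then show "{x. \<phi> x < 1} \<subseteq> interior K" by (intro interior_maximal) (auto simp: K_def)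
  show "interior K \<subseteq> {x. \<phi> x < 1}"
  proof
    fix x assume x: "x \<in> interior K"
    then obtain e where e: "e > 0" "cball x e \<subseteq> K" unfolding mem_interior_cball by blast
    show "x \<in> {x. \<phi> x < 1}"
    proof (cases "x = 0")
      case False
      define y where "y = (1 + e / norm x) *\<^sub>R x"
      have "dist x y = e" using False e by (simp add: y_def dist_norm algebra_simps)
      then have "\<phi> y \<le> 1" using e by (auto simp: K_def)
      moreover have "1 < (1 + e / norm x) ^ (2 * q)" using e(1) False q0 by (intro one_less_power) auto
      then have "\<phi> x < (1 + e / norm x) ^ (2 * q) * \<phi> x" using phi_pos[OF False] by simp
      ultimately show ?thesis by (simp add: y_def phi_scale)
    qed simp
  qed
qed

lemma K_frontier: "frontier K = {x. \<phi> x = 1}"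
  unfolding frontier_def K_interior closure_closed[OF compact_imp_closed[OF K_compact]]
  by (auto simp: K_def)

lemma frontier_nonzero: "x \<in> frontier K \<Longrightarrow> x \<noteq> 0"
  unfolding K_frontier by auto

lemma K_normal:
  assumes x: "x \<in> frontier K" and y: "y \<in> K"
  shows "(G x /\<^sub>R norm (G x)) \<bullet> (y - x) \<le> 0"
proof -
  have "\<phi> x = 1" using x by (simp add: K_frontier)
  moreover have "\<phi> y \<le> 1" using y by (simp add: K_def)
  ultimately have "G x \<bullet> (y - x) \<le> 0" using phi_tangent'[of x y] by simp
  then show ?thesis by (simp add: divide_simps)
qed

text \<open>If a normal vector \<open>v\<close> differed from \<open>n = G x / |G x|\<close>, then \<open>\<phi>\<close> would decrease from \<open>x\<close> in the
  direction \<open>v - n\<close>, which therefore leads into \<open>K\<close>, although it has a positive component along \<open>v\<close>.\<close>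

lemma K_normal_unique:
  assumes x: "x \<in> frontier K" and v: "norm v = 1" "\<And>y. y \<in> K \<Longrightarrow> v \<bullet> (y - x) \<le> 0"
  shows "v = G x /\<^sub>R norm (G x)"
proof -
  have G0: "G x \<noteq> 0" using x frontier_nonzero G_nonzero by blast
  have \<phi>x: "\<phi> x = 1" using x by (simp add: K_frontier)
  define n where "n = G x /\<^sub>R norm (G x)"
  have n: "norm n = 1" using G0 by (simp add: n_def)
  have "v = n"
  proof (rule ccontr)
    assume ne: "v \<noteq> n"
    have "0 < (norm (v - n))\<^sup>2" using ne by simp
    also have "(norm (v - n))\<^sup>2 = 2 - 2 * (v \<bullet> n)"
      using v(1) n by (simp add: power2_norm_eq_inner inner_diff_left inner_diff_right inner_commute norm_eq_1)
    finally have vn: "v \<bullet> n < 1" by simp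
    define w where "w = v - n"
    have Gn: "G x = norm (G x) *\<^sub>R n" using G0 by (simp add: n_def)
    have "G x \<bullet> w = norm (G x) * (n \<bullet> v - 1)"
      by (subst Gn) (use n in \<open>simp add: w_def inner_diff_right norm_eq_1 algebra_simps\<close>)
    then have neg: "G x \<bullet> w < 0" using vn G0 by (simp add: inner_commute mult_pos_neg)
    have "((\<lambda>t. \<phi> (x + t *\<^sub>R w)) has_derivative (\<lambda>t. G (x + 0 *\<^sub>R w) \<bullet> (t *\<^sub>R w))) (at 0)"
      by (rule has_derivative_compose[OF _ phi_deriv]) (auto intro!: derivative_eq_intros)
    then have "((\<lambda>t. \<phi> (x + t *\<^sub>R w)) has_real_derivative (G x \<bullet> w)) (at 0)"
      unfolding has_field_derivative_def by (rule has_derivative_eq_rhs) (auto simp: fun_eq_iff)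
    from DERIV_neg_dec_right[OF this neg]
    obtain d where d: "d > 0" "\<And>h. 0 < h \<Longrightarrow> h < d \<Longrightarrow> \<phi> (x + h *\<^sub>R w) < \<phi> x" by auto
    have "x + (d / 2) *\<^sub>R w \<in> K" using d(2)[of "d / 2"] d(1) \<phi>x by (simp add: K_def)
    then have "v \<bullet> ((x + (d / 2) *\<^sub>R w) - x) \<le> 0" by (rule v(2))
    then have "v \<bullet> w \<le> 0" using d(1) by (simp add: mult_le_0_iff)
    then show False using vn v(1) by (simp add: w_def inner_diff_right norm_eq_1)
  qed
  then show ?thesis by (simp add: n_def)
qed

lemma K_gauss_map:
  assumes x: "x \<in> frontier K"
  shows "gauss_map K x = G x /\<^sub>R norm (G x)"
  unfolding gauss_map_def
proof (rule the_equality)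
  have "G x \<noteq> 0" using x frontier_nonzero G_nonzero by blast
  then show "norm (G x /\<^sub>R norm (G x)) = 1 \<and> (\<forall>y\<in>K. (G x /\<^sub>R norm (G x)) \<bullet> (y - x) \<le> 0)"
    using K_normal[OF x] by auto
  show "v = G x /\<^sub>R norm (G x)" if "norm v = 1 \<and> (\<forall>y\<in>K. v \<bullet> (y - x) \<le> 0)" for v
    using K_normal_unique[OF x] that by blast
qed

end

lemma support_function_eq:
  assumes "x \<in> K" "\<And>y. y \<in> K \<Longrightarrow> \<theta> \<bullet> y \<le> \<theta> \<bullet> x"
  shows "support_function K \<theta> = \<theta> \<bullet> x"
  unfolding support_function_def by (rule cSup_eq_maximum) (use assms in auto)

context power_body begin

lemma K_support_gauss:
  assumes x: "x \<in> frontier K"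
  shows "support_function K (gauss_map K x) = 2 * real q / norm (G x)"
proof -
  have \<phi>x: "\<phi> x = 1" using x by (simp add: K_frontier)
  have G0: "G x \<noteq> 0" using x frontier_nonzero G_nonzero by blast
  have "support_function K (gauss_map K x) = gauss_map K x \<bullet> x"
  proof (rule support_function_eq)
    show "x \<in> K" using \<phi>x by (simp add: K_def)
    fix y assume "y \<in> K"
    then have "G x \<bullet> y \<le> G x \<bullet> x" using phi_tangent'[of x y] \<phi>x by (simp add: K_def inner_diff_right)
    then show "gauss_map K x \<bullet> y \<le> gauss_map K x \<bullet> x"
      unfolding K_gauss_map[OF x] using G0 by (simp add: divide_right_mono)
  qed
  then show ?thesis unfolding K_gauss_map[OF x] using Euler[of x] \<phi>x by (simp add: field_simps)
qed

lemma K_gauss_surj: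
  assumes "norm \<theta> = 1"
  obtains x where "x \<in> frontier K" "gauss_map K x = \<theta>" "x \<in> K" "\<And>y. y \<in> K \<Longrightarrow> \<theta> \<bullet> y \<le> \<theta> \<bullet> x"
proof -
  have "K \<noteq> {}" using zero_in_K by blast
  moreover have "continuous_on K (\<lambda>x. \<theta> \<bullet> x)" by (intro continuous_intros)
  ultimately obtain x where x: "x \<in> K" "\<forall>y\<in>K. \<theta> \<bullet> y \<le> \<theta> \<bullet> x"
    using continuous_attains_sup[OF K_compact] by blast
  have "x \<in> frontier K"
  proof (rule ccontr)
    assume "x \<notin> frontier K"
    then have "\<phi> x \<noteq> 1" by (simp add: K_frontier)
    moreover have "\<phi> x \<le> 1" using x(1) by (simp add: K_def)
    ultimately have "x \<in> interior K" by (simp add: K_interior)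
    then obtain e where e: "e > 0" "cball x e \<subseteq> K" unfolding mem_interior_cball by blast
    have "x + e *\<^sub>R \<theta> \<in> K" using e assms by (intro subsetD[OF e(2)]) (auto simp: dist_norm)
    then have "\<theta> \<bullet> (x + e *\<^sub>R \<theta>) \<le> \<theta> \<bullet> x" using x(2) by blast
    then show False using e(1) assms by (simp add: inner_add_right norm_eq_1)
  qed
  moreover have "gauss_map K x = \<theta>"
    using K_normal_unique[OF \<open>x \<in> frontier K\<close> assms] x(2) K_gauss_map[OF \<open>x \<in> frontier K\<close>]
    by (simp add: inner_diff_right)
  ultimately show thesis using that x by blast
qed

lemma C2_on_inner: "C2_on S (\<lambda>x::'a. b \<bullet> x)"
  by (rule C2_on_linear) (rule bounded_linear_inner_right)

lemma C2_on_inner_self: "C2_on S (\<lambda>x::'a. x \<bullet> x)"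
proof -
  have "C2_on S (\<lambda>x::'a. \<Sum>b\<in>Basis. (b \<bullet> x) ^ 2)"
    by (intro C2_on_sum C2_on_power C2_on_inner)
  moreover have "(\<Sum>b\<in>Basis. (b \<bullet> x) ^ 2) = x \<bullet> x" for x :: 'a
    by (subst euclidean_inner) (simp add: power2_eq_square inner_commute)
  ultimately show ?thesis by simp
qed

lemma phi_C2: "C2_on S \<phi>"
  unfolding \<phi>_def[abs_def]
  by (intro C2_on_add C2_on_sum C2_on_power C2_on_inner C2_on_mult C2_on_const C2_on_inner_self)

lemma norm_G_C2: "C2_on S (\<lambda>x. G x \<bullet> G x)"
proof -
  have "C2_on S (\<lambda>x. G x \<bullet> e)" for e
    unfolding G_def inner_add_left inner_sum_left inner_scaleR_left
    by (intro C2_on_add C2_on_sum C2_on_mult C2_on_power C2_on_inner C2_on_const C2_on_inner_self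
        C2_on_linear[OF bounded_linear_inner_left])
  then have "C2_on S (\<lambda>x. \<Sum>e\<in>Basis. (G x \<bullet> e) ^ 2)"
    by (intro C2_on_sum C2_on_power)
  moreover have "(\<Sum>e\<in>Basis. (G x \<bullet> e) ^ 2) = G x \<bullet> G x" for x
    by (subst euclidean_inner[of "G x" "G x"]) (simp add: power2_eq_square)
  ultimately show ?thesis by simp
qed

text \<open>Euler's identity turns \<open>h\<^sub>K \<circ> \<nu>\<^sub>K\<close> into \<open>2q / |G|\<close>, up to a factor the inverse square root of a
  polynomial. For a boundary that is only of class \<open>C\<^sup>2\<close> this function would in general be only of class \<open>C\<^sup>1\<close>, and the
  dilation would not be among the perturbations that define the concavity power.\<close>

lemma support_gauss_C2:
  "C2_function_on (frontier K) (\<lambda>x. support_function K (gauss_map K x))"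
  unfolding C2_function_on_def
proof
  fix x assume "x \<in> frontier K"
  then have x0: "x \<in> - {0}" using frontier_nonzero by blast
  let ?r = "\<lambda>x. 2 * real q * (G x \<bullet> G x) powr (-1/2)"
  have "C2_on (- {0}) ?r"
    by (intro C2_on_mult C2_on_const C2_on_inverse_sqrt norm_G_C2) (use G_nonzero in auto)
  moreover have "support_function K (gauss_map K y) = ?r y" if "y \<in> frontier K \<inter> - {0}" for y
  proof -
    have pos: "G y \<bullet> G y > 0" using that G_nonzero[of y] by simp
    have "(G y \<bullet> G y) powr (-1/2) = inverse ((G y \<bullet> G y) powr (1/2))"
      using powr_minus[of "G y \<bullet> G y" "1/2"] by simp
    also have "(G y \<bullet> G y) powr (1/2) = norm (G y)"
      using pos by (simp add: powr_half_sqrt norm_eq_sqrt_inner)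
    finally show ?thesis using K_support_gauss[of y] that by (simp add: field_simps)
  qed
  ultimately show "\<exists>U (ga :: 'a \<Rightarrow> real). open U \<and> x \<in> U \<and> C2_on U ga \<and>
      (\<forall>y\<in>frontier K \<inter> U. support_function K (gauss_map K y) = ga y)"
    using x0 by (intro exI[of _ "- {0}"] exI[of _ ?r]) auto
qed

lemma K_hypersurface: "C2_hypersurface (frontier K)"
  unfolding C2_hypersurface_def
proof
  fix x assume x: "x \<in> frontier K"
  have der: "((\<lambda>y. \<phi> y + - 1) has_derivative (\<lambda>h. G y \<bullet> h)) (at y)" for y
    by (rule has_derivative_eq_rhs[OF has_derivative_add[OF phi_deriv has_derivative_const]]) simp
  have nz: "frechet_derivative (\<lambda>y. \<phi> y + - 1) (at y) \<noteq> (\<lambda>v. 0)" if "y \<in> frontier K" for y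
  proof -
    have "frechet_derivative (\<lambda>y. \<phi> y + - 1) (at y) = (\<lambda>h. G y \<bullet> h)"
      using frechet_derivative_at[OF der] by simp
    moreover have "G y \<bullet> G y \<noteq> 0" using G_nonzero[OF frontier_nonzero[OF that]] by simp
    ultimately show ?thesis by (metis (full_types))
  qed
  have C2: "C2_on UNIV (\<lambda>y. \<phi> y + - 1)" by (intro C2_on_add phi_C2 C2_on_const)
  have "frontier K \<inter> UNIV = {y \<in> UNIV. \<phi> y + - 1 = 0}" by (auto simp: K_frontier)
  then have "open UNIV \<and> x \<in> UNIV \<and> C2_on UNIV (\<lambda>y. \<phi> y + - 1) \<and>
      frontier K \<inter> UNIV = {y\<in>UNIV. \<phi> y + - 1 = 0} \<and>
      (\<forall>y\<in>frontier K \<inter> UNIV. frechet_derivative (\<lambda>y. \<phi> y + - 1) (at y) \<noteq> (\<lambda>v. 0))"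
    using C2 nz by blast
  then show "\<exists>U (h :: 'a \<Rightarrow> real). open U \<and> x \<in> U \<and> C2_on U h \<and> frontier K \<inter> U = {y\<in>U. h y = 0} \<and>
        (\<forall>y\<in>frontier K \<inter> U. frechet_derivative h (at y) \<noteq> (\<lambda>v. 0))"
    by (intro exI)
qed

end

lemma has_vector_derivative_difference_quotient:
  fixes f :: "real \<Rightarrow> 'a::real_normed_vector"
  assumes "(f has_vector_derivative v) (at a)"
  shows "((\<lambda>s. (f s - f a) /\<^sub>R (s - a)) \<longlongrightarrow> v) (at a)"
proof -
  have "((\<lambda>s. norm (f s - f a - (s - a) *\<^sub>R v) / norm (s - a)) \<longlongrightarrow> 0) (at a)"
    using assms unfolding has_vector_derivative_def has_derivative_iff_norm by simp
  moreover have "norm ((f s - f a) /\<^sub>R (s - a) - v) = norm (f s - f a - (s - a) *\<^sub>R v) / norm (s - a)"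
    if "s \<noteq> a" for s
  proof -
    have "(f s - f a) /\<^sub>R (s - a) - v = (f s - f a - (s - a) *\<^sub>R v) /\<^sub>R (s - a)"
      using that by (simp add: scaleR_diff_right)
    then show ?thesis by (simp add: divide_inverse_commute)
  qed
  then have "\<forall>\<^sub>F s in at a. norm (f s - f a - (s - a) *\<^sub>R v) / norm (s - a) = norm ((f s - f a) /\<^sub>R (s - a) - v)"
    unfolding eventually_at_filter by (intro always_eventually) auto
  ultimately have "((\<lambda>s. norm ((f s - f a) /\<^sub>R (s - a) - v)) \<longlongrightarrow> 0) (at a)"
    by (rule Lim_transform_eventually)
  then show ?thesis using Lim_null tendsto_norm_zero_iff by blast
qed

context power_body begin

lemma g_scale: "s \<ge> 0 \<Longrightarrow> g (s *\<^sub>R x) = s * g x"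
  using q0 by (simp add: g_def phi_scale real_root_mult real_root_power_cancel)

lemma g_pos: "x \<noteq> 0 \<Longrightarrow> g x > 0"
  using q0 by (simp add: g_def phi_pos)

lemma g_zero [simp]: "g 0 = 0" by (simp add: g_def)

lemma g_le_iff: "0 \<le> s \<Longrightarrow> g x \<le> s \<longleftrightarrow> \<phi> x \<le> s ^ (2 * q)"
  using q0 by (metis g_def real_root_le_iff real_root_power_cancel)

lemma g_eq_1_iff: "g x = 1 \<longleftrightarrow> \<phi> x = 1"
  using q0 by (simp add: g_def)

lemma g_cont: "continuous_on S g"
  unfolding g_def[abs_def] by (intro continuous_intros phi_cont)

lemma g_deriv:
  assumes "x \<noteq> 0"
  shows "(g has_derivative (\<lambda>h. \<gamma> x \<bullet> h)) (at x)"
proof -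
  have "(root (2 * q) has_real_derivative inverse (real (2 * q) * root (2 * q) (\<phi> x) ^ (2 * q - Suc 0))) (at (\<phi> x))"
    by (rule DERIV_real_root[OF q0 phi_pos[OF assms]])
  from has_derivative_compose[OF phi_deriv this[unfolded has_field_derivative_def]]
  show ?thesis unfolding g_def[abs_def] \<gamma>_def by (rule has_derivative_eq_rhs) (simp add: g_def)
qed

lemma gamma_cont: "continuous_on (- {0}) \<gamma>"
  unfolding \<gamma>_def[abs_def] using q0 g_pos
  by (intro continuous_intros g_cont G_cont) (force simp: less_imp_neq[symmetric])+

lemma gamma_measurable: "\<gamma> \<in> borel_measurable borel"
proof -
  have [measurable]: "g \<in> borel_measurable borel" "G \<in> borel_measurable borel"
    by (rule borel_measurable_continuous_onI, rule g_cont G_cont)+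
  show ?thesis unfolding \<gamma>_def[abs_def] by measurable
qed

lemma gamma_nonzero: "x \<noteq> 0 \<Longrightarrow> \<gamma> x \<noteq> 0"
  using G_nonzero[of x] g_pos[of x] q1 by (simp add: \<gamma>_def)

lemma gamma_eq:
  assumes "x \<noteq> 0"
  shows "\<gamma> x = G (x /\<^sub>R g x) /\<^sub>R (2 * real q)"
  using g_pos[OF assms] by (simp add: \<gamma>_def G_scale power_inverse)

text \<open>The Gauss map is strongly monotone along the boundary, since \<open>\<phi>\<close> is strongly convex and
  takes the same value at both points. Hence the eigenvalues of its differential are positive.\<close>

lemma K_gauss_strongly_monotone:
  obtains \<kappa> where "\<kappa> > 0" "\<And>x y. x \<in> frontier K \<Longrightarrow> y \<in> frontier K \<Longrightarrow>
     \<kappa> * (norm (y - x))\<^sup>2 \<le> (gauss_map K y - gauss_map K x) \<bullet> (y - x)"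
proof -
  have cK: "compact (frontier K)" using K_compact by (simp add: compact_frontier)
  obtain M where M: "M > 0" "\<And>x. x \<in> frontier K \<Longrightarrow> norm (G x) \<le> M"
    using compact_imp_bounded[OF compact_continuous_image[OF G_cont cK]] unfolding bounded_pos by auto
  obtain m where m: "m > 0" "\<And>x. x \<in> frontier K \<Longrightarrow> m \<le> (x \<bullet> x) ^ (q - 1)"
  proof (cases "frontier K = {}")
    case False
    have "continuous_on (frontier K) (\<lambda>x. (x \<bullet> x) ^ (q - 1))" by (intro continuous_intros)
    from continuous_attains_inf[OF cK False this]
    obtain x where "x \<in> frontier K" "\<forall>y\<in>frontier K. (x \<bullet> x) ^ (q - 1) \<le> (y \<bullet> y) ^ (q - 1)" by blast
    then show ?thesis using frontier_nonzero[of x] by (intro that[of "(x \<bullet> x) ^ (q - 1)"]) auto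
  qed (use that[of 1] in auto)
  define k where "k = real q * c * m / M"
  have k: "k > 0" using q1 c0 m(1) M(1) by (simp add: k_def)
  have half: "k * (norm (y - x))\<^sup>2 \<le> - (gauss_map K x \<bullet> (y - x))"
    if x: "x \<in> frontier K" and y: "y \<in> frontier K" for x y
  proof -
    have G0: "G x \<noteq> 0" using G_nonzero[OF frontier_nonzero[OF x]] .
    have "real q * c * m * (norm (y - x))\<^sup>2 \<le> real q * c * (x \<bullet> x) ^ (q - 1) * (norm (y - x))\<^sup>2"
      using m(2)[OF x] c0 by (intro mult_right_mono mult_left_mono) auto
    also have "\<dots> \<le> - (G x \<bullet> (y - x))"
      using phi_tangent[of x y] x y by (simp add: K_frontier)
    finally have 1: "real q * c * m * (norm (y - x))\<^sup>2 \<le> - (G x \<bullet> (y - x))" .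
    have "k * (norm (y - x))\<^sup>2 = (real q * c * m * (norm (y - x))\<^sup>2) / M" by (simp add: k_def)
    also have "\<dots> \<le> (real q * c * m * (norm (y - x))\<^sup>2) / norm (G x)"
      using M(1) M(2)[OF x] G0 c0 m(1) by (intro divide_left_mono mult_pos_pos) auto
    also have "\<dots> \<le> - (G x \<bullet> (y - x)) / norm (G x)"
      using 1 by (intro divide_right_mono) auto
    also have "\<dots> = - (gauss_map K x \<bullet> (y - x))" by (simp add: K_gauss_map[OF x] divide_inverse_commute)
    finally show ?thesis .
  qed
  show thesis
  proof (rule that[of "2 * k"])
    fix x y assume xy: "x \<in> frontier K" "y \<in> frontier K"
    have "gauss_map K y \<bullet> (x - y) = - (gauss_map K y \<bullet> (y - x))" by (simp add: inner_diff_right)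
    then show "2 * k * (norm (y - x))\<^sup>2 \<le> (gauss_map K y - gauss_map K x) \<bullet> (y - x)"
      using half[OF xy] half[OF xy(2,1)] by (simp add: inner_diff_left norm_minus_commute)
  qed (use k in simp)
qed

text \<open>The differential of the Gauss map is evaluated along the curve \<open>y\<close> in the boundary that is the
  radial projection of the tangent line \<open>x + s v\<close>. Its difference quotients inherit strong
  monotonicity.\<close>

lemma K_principal_curvature_pos:
  assumes x: "x \<in> frontier K" and pc: "principal_curvature K x k"
  shows "0 < k"
proof -
  from pc obtain D v where D: "(gauss_map K has_derivative D) (at x within frontier K)"
    and v: "v \<noteq> 0" "v \<bullet> gauss_map K x = 0" "D v = k *\<^sub>R v"
    unfolding principal_curvature_def by blast
  obtain \<kappa> where \<kappa>: "\<kappa> > 0" "\<And>x y. x \<in> frontier K \<Longrightarrow> y \<in> frontier K \<Longrightarrow>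
     \<kappa> * (norm (y - x))\<^sup>2 \<le> (gauss_map K y - gauss_map K x) \<bullet> (y - x)"
    by (rule K_gauss_strongly_monotone) blast
  have x0: "x \<noteq> 0" by (rule frontier_nonzero[OF x])
  have gx: "g x = 1" using x by (simp add: K_frontier g_eq_1_iff)
  have tang: "\<gamma> x \<bullet> v = 0"
    using v(2) G_nonzero[OF x0] by (simp add: \<gamma>_def K_gauss_map[OF x] inner_commute)
  define y where "y s = (x + s *\<^sub>R v) /\<^sub>R g (x + s *\<^sub>R v)" for s :: real
  have y0: "y 0 = x" by (simp add: y_def gx)
  have line: "((\<lambda>s. x + s *\<^sub>R v) has_derivative (\<lambda>s. s *\<^sub>R v)) (at 0)"
    by (auto intro!: derivative_eq_intros)
  have "((\<lambda>s. g (x + s *\<^sub>R v)) has_derivative (\<lambda>s. \<gamma> (x + 0 *\<^sub>R v) \<bullet> (s *\<^sub>R v))) (at 0)"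
    by (rule has_derivative_compose[OF line]) (use g_deriv[OF x0] in simp)
  then have dg: "((\<lambda>s. g (x + s *\<^sub>R v)) has_derivative (\<lambda>s. 0)) (at 0)"
    by (rule has_derivative_eq_rhs) (simp add: tang)
  have "((\<lambda>s. inverse (g (x + s *\<^sub>R v))) has_derivative (\<lambda>s. 0)) (at 0)"
    by (rule has_derivative_eq_rhs[OF Deriv.has_derivative_inverse[OF _ dg]]) (simp_all add: gx)
  from has_derivative_scaleR[OF this line]
  have dy: "(y has_derivative (\<lambda>s. s *\<^sub>R v)) (at 0)"
    unfolding y_def[abs_def] by (rule has_derivative_eq_rhs) (simp add: gx)
  have nz: "\<forall>\<^sub>F s in at 0. x + s *\<^sub>R v \<noteq> 0"
  proof -
    have "((\<lambda>s. x + s *\<^sub>R v) \<longlongrightarrow> x + 0 *\<^sub>R v) (at 0)" by (intro tendsto_intros)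
    then show ?thesis using x0 using tendsto_imp_eventually_ne[of _ x _ 0] by simp
  qed
  have onF: "y s \<in> frontier K" if "x + s *\<^sub>R v \<noteq> 0" for s
    using g_pos[OF that] by (simp add: K_frontier y_def g_scale g_eq_1_iff[symmetric])
  define S where "S = {s. x + s *\<^sub>R v \<noteq> 0}"
  have S0: "0 \<in> S" using x0 by (simp add: S_def)
  have dS: "(y has_derivative (\<lambda>s. s *\<^sub>R v)) (at 0 within S)" by (rule has_derivative_at_withinI[OF dy])
  have "(gauss_map K has_derivative D) (at (y 0) within y ` S)"
    unfolding y0 by (rule has_derivative_subset[OF D]) (auto simp: S_def onF)
  from has_derivative_in_compose[OF dS this]
  have dN: "((\<lambda>s. gauss_map K (y s)) has_derivative (\<lambda>s. D (s *\<^sub>R v))) (at 0 within S)" .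
  have "open S" unfolding S_def
    by (intro open_Collect_neq continuous_intros)
  then have atS: "at 0 within S = at 0" using S0 by (rule at_within_open[rotated])
  have linD: "linear D" using D by (rule has_derivative_linear)
  have vd1: "((\<lambda>s. gauss_map K (y s)) has_vector_derivative k *\<^sub>R v) (at 0)"
    using dN unfolding atS has_vector_derivative_def
    by (rule has_derivative_eq_rhs) (simp add: linear_cmul[OF linD] v(3))
  have vd2: "(y has_vector_derivative v) (at 0)"
    using dy unfolding has_vector_derivative_def .
  have l1: "((\<lambda>s. (gauss_map K (y s) - gauss_map K x) /\<^sub>R s) \<longlongrightarrow> k *\<^sub>R v) (at 0)"
    using has_vector_derivative_difference_quotient[OF vd1] by (simp add: y0)
  have l2: "((\<lambda>s. (y s - x) /\<^sub>R s) \<longlongrightarrow> v) (at 0)"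
    using has_vector_derivative_difference_quotient[OF vd2] by (simp add: y0)
  have "((\<lambda>s. ((gauss_map K (y s) - gauss_map K x) /\<^sub>R s) \<bullet> ((y s - x) /\<^sub>R s)) \<longlongrightarrow> (k *\<^sub>R v) \<bullet> v) (at 0)"
    by (intro tendsto_inner l1 l2)
  moreover have "((\<lambda>s. \<kappa> * (norm ((y s - x) /\<^sub>R s))\<^sup>2) \<longlongrightarrow> \<kappa> * (norm v)\<^sup>2) (at 0)"
    by (intro tendsto_intros l2)
  moreover have "\<forall>\<^sub>F s in at 0. \<kappa> * (norm ((y s - x) /\<^sub>R s))\<^sup>2 \<le> ((gauss_map K (y s) - gauss_map K x) /\<^sub>R s) \<bullet> ((y s - x) /\<^sub>R s)"
    using nz
  proof eventually_elim
    case (elim s)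
    have "\<kappa> * (norm (y s - x))\<^sup>2 * (inverse s)\<^sup>2 \<le> ((gauss_map K (y s) - gauss_map K x) \<bullet> (y s - x)) * (inverse s)\<^sup>2"
      by (intro mult_right_mono \<kappa>(2) x onF elim) auto
    moreover have "(norm ((y s - x) /\<^sub>R s))\<^sup>2 = (norm (y s - x))\<^sup>2 * (inverse s)\<^sup>2"
      by (simp add: power_mult_distrib power_inverse)
    moreover have "((gauss_map K (y s) - gauss_map K x) /\<^sub>R s) \<bullet> ((y s - x) /\<^sub>R s)
        = ((gauss_map K (y s) - gauss_map K x) \<bullet> (y s - x)) * (inverse s)\<^sup>2"
      by (simp add: power2_eq_square)
    ultimately show ?case by (simp only: mult.assoc)
  qed
  ultimately have "\<kappa> * (norm v)\<^sup>2 \<le> (k *\<^sub>R v) \<bullet> v"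
    by (intro tendsto_le[OF trivial_limit_at]) auto
  then have "0 < k * (norm v)\<^sup>2"
    using \<kappa>(1) v(1) by (simp add: power2_norm_eq_inner)
  then show ?thesis using v(1) by (simp add: zero_less_mult_iff)
qed

lemma K_C2_plus: "C2_plus K"
  unfolding C2_plus_def
  using K_compact K_convex K_hypersurface K_principal_curvature_pos
  by (auto simp: K_interior intro!: exI[of _ 0])

end

section \<open>Dilations as perturbations\<close>

lemma support_function_image_scaleR:
  assumes "x \<in> K" "\<And>y. y \<in> K \<Longrightarrow> \<theta> \<bullet> y \<le> \<theta> \<bullet> x" "s > 0"
  shows "support_function ((*\<^sub>R) s ` K) \<theta> = s * (\<theta> \<bullet> x)"
proof -
  have "support_function ((*\<^sub>R) s ` K) \<theta> = \<theta> \<bullet> (s *\<^sub>R x)"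
    by (rule support_function_eq) (use assms in \<open>auto simp: mult_left_mono\<close>)
  then show ?thesis by simp
qed

text \<open>A compact convex set is determined by its support function on the sphere: a point outside
  is cut off by a hyperplane, whose normal can be taken of length 1.\<close>

lemma support_function_subset:
  fixes K L :: "'a::euclidean_space set"
  assumes K: "compact K" "K \<noteq> {}" and L: "compact L" "convex L" "L \<noteq> {}"
    and eq: "\<And>\<theta>. norm \<theta> = 1 \<Longrightarrow> support_function K \<theta> \<le> support_function L \<theta>"
  shows "K \<subseteq> L"
proof (rule ccontr)
  assume "\<not> K \<subseteq> L"
  then obtain x where x: "x \<in> K" "x \<notin> L" by blast
  obtain a b where ab: "a \<bullet> x < b" "\<And>y. y \<in> L \<Longrightarrow> b < a \<bullet> y"
    using separating_hyperplane_closed_point[OF L(2) compact_imp_closed[OF L(1)] x(2)] by blast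
  have a0: "a \<noteq> 0" using ab L(3) by (metis ex_in_conv inner_zero_left less_trans less_irrefl)
  define \<theta> where "\<theta> = - (a /\<^sub>R norm a)"
  have \<theta>: "norm \<theta> = 1" using a0 by (simp add: \<theta>_def)
  have bdd: "bdd_above ((\<lambda>y. \<theta> \<bullet> y) ` K)"
    by (intro bounded_imp_bdd_above compact_imp_bounded compact_continuous_image K(1) continuous_intros)
  have "support_function L \<theta> \<le> - b / norm a"
    unfolding support_function_def
  proof (rule cSUP_least[OF L(3)])
    fix y assume "y \<in> L"
    then have "- (a \<bullet> y) / norm a \<le> - b / norm a" using ab(2)[of y] by (intro divide_right_mono) auto
    then show "\<theta> \<bullet> y \<le> - b / norm a" by (simp add: \<theta>_def divide_inverse_commute)
  qed
  also have "\<dots> < - (a \<bullet> x) / norm a" using ab(1) a0 by (intro divide_strict_right_mono) auto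
  also have "\<dots> = \<theta> \<bullet> x" by (simp add: \<theta>_def divide_inverse_commute)
  also have "\<dots> \<le> support_function K \<theta>"
    unfolding support_function_def by (rule cSUP_upper[OF x(1) bdd])
  also have "\<dots> \<le> support_function L \<theta>" by (rule eq[OF \<theta>])
  finally show False by simp
qed

lemma C2_plus_nonempty: "C2_plus K \<Longrightarrow> K \<noteq> {}"
  by (auto simp: C2_plus_def)

lemma perturbation_eq:
  assumes "is_perturbation K \<rho> t L"
  shows "perturbation K \<rho> t = L"
  unfolding perturbation_def
proof (rule the_equality)
  show "is_perturbation K \<rho> t L" by (rule assms)
  fix L' assume L': "is_perturbation K \<rho> t L'"
  have c: "compact L" "convex L" "L \<noteq> {}" "compact L'" "convex L'" "L' \<noteq> {}"
    using assms L' C2_plus_nonempty by (auto simp: is_perturbation_def C2_plus_def)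
  have eq: "support_function L \<theta> = support_function L' \<theta>" if "norm \<theta> = 1" for \<theta>
    using assms L' that by (simp add: is_perturbation_def)
  show "L' = L"
    using support_function_subset[of L L'] support_function_subset[of L' L] c eq by auto
qed

lemma image_scaleR_Collect:
  fixes P :: "'a::real_vector \<Rightarrow> bool"
  assumes "s \<noteq> 0"
  shows "(*\<^sub>R) s ` {x. P x} = {x. P (x /\<^sub>R s)}"
proof -
  have "x \<in> (*\<^sub>R) s ` {x. P x}" if "P (x /\<^sub>R s)" for x
    by (rule image_eqI[of _ _ "x /\<^sub>R s"]) (use that assms in auto)
  then show ?thesis using assms by auto
qed

lemma power_body_scale:
  assumes "power_body B q c" "s > 0"
  shows "power_body ((*\<^sub>R) (inverse s) ` B) q (c / s ^ (2 * q))"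
    and "power_body.K ((*\<^sub>R) (inverse s) ` B) q (c / s ^ (2 * q)) = (*\<^sub>R) s ` power_body.K B q c"
proof -
  interpret power_body B q c by fact
  show *: "power_body ((*\<^sub>R) (inverse s) ` B) q (c / s ^ (2 * q))"
    using finB q1 c0 assms(2) by unfold_locales auto
  interpret S: power_body "(*\<^sub>R) (inverse s) ` B" q "c / s ^ (2 * q)" by fact
  have inj: "inj_on ((*\<^sub>R) (inverse s)) B" using assms(2) by (auto simp: inj_on_def)
  have "S.\<phi> x = \<phi> (x /\<^sub>R s)" for x
    using assms(2) unfolding S.\<phi>_def \<phi>_def
    by (simp add: sum.reindex[OF inj] power_mult_distrib power_mult power2_eq_square divide_inverse power_inverse mult_ac)
  then show "S.K = (*\<^sub>R) s ` K"
    unfolding S.K_def K_def using assms(2) by (subst image_scaleR_Collect) auto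
qed

context power_body begin

lemma scaled_C2_plus: "s > 0 \<Longrightarrow> C2_plus ((*\<^sub>R) s ` K)"
  using power_body.K_C2_plus[OF power_body_scale(1)[OF power_body_axioms]]
    power_body_scale(2)[OF power_body_axioms] by metis

text \<open>Since the Gauss map is onto the sphere, the speed \<open>h\<^sub>K \<circ> \<nu>\<^sub>K\<close>, transported to the sphere, is \<open>h\<^sub>K\<close>.
  The perturbed support function is therefore \<open>(1 + t) h\<^sub>K\<close>.\<close>

lemma dilation_is_perturbation:
  assumes "\<bar>t\<bar> < 1"
  shows "is_perturbation K (\<lambda>x. support_function K (gauss_map K x)) t ((*\<^sub>R) (1 + t) ` K)"
  unfolding is_perturbation_def
proof (intro conjI ballI)
  have t: "1 + t > 0" using assms by auto
  show "C2_plus ((*\<^sub>R) (1 + t) ` K)" by (rule scaled_C2_plus[OF t])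
  fix \<theta> :: 'a assume "\<theta> \<in> sphere 0 1"
  then have \<theta>: "norm \<theta> = 1" by simp
  obtain x where x: "x \<in> frontier K" "gauss_map K x = \<theta>" "x \<in> K" "\<And>y. y \<in> K \<Longrightarrow> \<theta> \<bullet> y \<le> \<theta> \<bullet> x"
    using K_gauss_surj[OF \<theta>] by blast
  have "\<theta> \<in> gauss_map K ` frontier K" using x by blast
  then have inv: "gauss_map K (inv_into (frontier K) (gauss_map K) \<theta>) = \<theta>" by (rule f_inv_into_f)
  show "support_function ((*\<^sub>R) (1 + t) ` K) \<theta> = support_function K \<theta> +
      t * support_function K (gauss_map K (inv_into (frontier K) (gauss_map K) \<theta>))"
    unfolding inv using support_function_image_scaleR[OF x(3,4) t] support_function_eq[OF x(3,4)]
    by (simp add: algebra_simps)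
qed

lemma dilation_admissible: "admissible K (\<lambda>x. support_function K (gauss_map K x))"
  unfolding admissible_def using support_gauss_C2 dilation_is_perturbation
  by (intro conjI exI[of _ "1::real"]) auto

end

section \<open>Second derivatives of powers\<close>

lemma has_second_derivativeI:
  assumes "\<forall>\<^sub>F t in nhds x. (f has_real_derivative f' t) (at t)" "(f' has_real_derivative D) (at x)"
  shows "has_second_derivative f D x"
  using assms unfolding has_second_derivative_def by blast

lemma has_second_derivative_compose_powr:
  fixes f :: "real \<Rightarrow> real"
  assumes f: "\<forall>\<^sub>F t in nhds x. (f has_real_derivative f' t) (at t)" "(f' has_real_derivative D) (at x)"
    and pos: "f x > 0"
  shows "\<forall>\<^sub>F t in nhds x. ((\<lambda>t. f t powr r) has_real_derivative r * f t powr (r - 1) * f' t) (at t)"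
    and "((\<lambda>t. r * f t powr (r - 1) * f' t) has_real_derivative
          r * f x powr (r - 2) * (f x * D + (r - 1) * (f' x)\<^sup>2)) (at x)"
proof -
  have fx: "(f has_real_derivative f' x) (at x)" using f(1) by (rule eventually_nhds_x_imp_x)
  have "(f \<longlongrightarrow> f x) (nhds x)"
    using DERIV_isCont[OF fx] by (simp add: isCont_def tendsto_at_iff_tendsto_nhds)
  then have ev: "\<forall>\<^sub>F t in nhds x. f t > 0" using pos order_tendstoD(1) by blast
  show "\<forall>\<^sub>F t in nhds x. ((\<lambda>t. f t powr r) has_real_derivative r * f t powr (r - 1) * f' t) (at t)"
    using ev f(1)
  proof eventually_elim
    case (elim t)
    show ?case
      using DERIV_chain2[OF has_real_derivative_powr[OF elim(1)] elim(2)] .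
  qed
  have "((\<lambda>t. f t powr (r - 1)) has_real_derivative (r - 1) * f x powr (r - 1 - 1) * f' x) (at x)"
    by (rule DERIV_chain2[OF has_real_derivative_powr[OF pos] fx])
  from DERIV_mult[OF DERIV_cmult[OF this, of r] f(2)]
  have "((\<lambda>t. r * f t powr (r - 1) * f' t) has_real_derivative
     r * ((r - 1) * f x powr (r - 1 - 1) * f' x) * f' x + D * (r * f x powr (r - 1))) (at x)" .
  moreover have "f x powr (r - 1) = f x powr (r - 2) * f x"
    using powr_add[of "f x" "r - 2" 1] pos by simp
  ultimately show "((\<lambda>t. r * f t powr (r - 1) * f' t) has_real_derivative
          r * f x powr (r - 2) * (f x * D + (r - 1) * (f' x)\<^sup>2)) (at x)"
    by (elim DERIV_cong) (simp add: power2_eq_square algebra_simps)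
qed

lemma has_second_derivative_unique:
  assumes "has_second_derivative f D x" "has_second_derivative f E x"
  shows "D = E"
proof -
  from assms obtain f' h' where
    f: "\<forall>\<^sub>F t in nhds x. (f has_real_derivative f' t) (at t)" "(f' has_real_derivative D) (at x)" and
    h: "\<forall>\<^sub>F t in nhds x. (f has_real_derivative h' t) (at t)" "(h' has_real_derivative E) (at x)"
    unfolding has_second_derivative_def by blast
  have eq: "\<forall>\<^sub>F t in nhds x. h' t = f' t"
    using f(1) h(1) by eventually_elim (rule DERIV_unique)
  have "(f' has_real_derivative E) (at x)"
    using h(2) DERIV_cong_ev[OF refl eq refl] by blast
  then show ?thesis using f(2) DERIV_unique by blast
qed

lemma has_second_derivative_transform:
  assumes "has_second_derivative f D x" "\<forall>\<^sub>F t in nhds x. f t = h t"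
  shows "has_second_derivative h D x"
proof -
  from assms(1) obtain f' where
    f: "\<forall>\<^sub>F t in nhds x. (f has_real_derivative f' t) (at t)" "(f' has_real_derivative D) (at x)"
    unfolding has_second_derivative_def by blast
  have "\<forall>\<^sub>F t in nhds x. \<forall>\<^sub>F s in nhds t. f s = h s"
    using assms(2) by (simp add: eventually_eventually)
  then have "\<forall>\<^sub>F t in nhds x. (h has_real_derivative f' t) (at t)"
    using f(1)
  proof eventually_elim
    case (elim t)
    then show ?case using DERIV_cong_ev[OF refl elim(1) refl] by blast
  qed
  then show ?thesis using f(2) unfolding has_second_derivative_def by blast
qed

text \<open>The function is recovered from its power \<open>p\<close> by taking the power \<open>1/p\<close>, so differentiability
  passes from one non-zero exponent to all exponents.\<close>

lemma has_second_derivative_of_powr: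
  fixes m :: "real \<Rightarrow> real"
  assumes "has_second_derivative (\<lambda>t. m t powr p) E x" "p \<noteq> 0" "\<forall>\<^sub>F t in nhds x. m t > 0"
  obtains m1 D where "\<forall>\<^sub>F t in nhds x. (m has_real_derivative m1 t) (at t)"
    "(m1 has_real_derivative D) (at x)"
    "\<And>r. has_second_derivative (\<lambda>t. m t powr r) (r * m x powr (r - 2) * (m x * D + (r - 1) * (m1 x)\<^sup>2)) x"
proof -
  have mx: "m x > 0" using assms(3) by (rule eventually_nhds_x_imp_x)
  from assms(1) obtain f' where f: "\<forall>\<^sub>F t in nhds x. ((\<lambda>t. m t powr p) has_real_derivative f' t) (at t)"
     "(f' has_real_derivative E) (at x)" unfolding has_second_derivative_def by blast
  have "m x powr p > 0" using mx by simp
  note C = has_second_derivative_compose_powr[OF f this, of "1/p"]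
  have "has_second_derivative (\<lambda>t. (m t powr p) powr (1/p)) ((1/p) * (m x powr p) powr (1/p - 2) * (m x powr p * E + (1/p - 1) * (f' x)\<^sup>2)) x"
    by (rule has_second_derivativeI[OF C])
  then have "has_second_derivative m ((1/p) * (m x powr p) powr (1/p - 2) * (m x powr p * E + (1/p - 1) * (f' x)\<^sup>2)) x"
  proof (rule has_second_derivative_transform)
    show "\<forall>\<^sub>F t in nhds x. (m t powr p) powr (1/p) = m t"
      using assms(3) by eventually_elim (use assms(2) in \<open>simp add: powr_powr\<close>)
  qed
  then obtain m1 D where m1: "\<forall>\<^sub>F t in nhds x. (m has_real_derivative m1 t) (at t)"
    "(m1 has_real_derivative D) (at x)" unfolding has_second_derivative_def by blast
  show thesis
  proof (rule that[OF m1])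
    fix r show "has_second_derivative (\<lambda>t. m t powr r) (r * m x powr (r - 2) * (m x * D + (r - 1) * (m1 x)\<^sup>2)) x"
      by (rule has_second_derivativeI[OF has_second_derivative_compose_powr[OF m1 mx]])
  qed
qed

section \<open>The boundary integral and the first variation of the measure\<close>

text \<open>The point \<open>y\<close> is the last point of \<open>K\<close> on the ray from \<open>x\<close> in the direction \<open>- e\<close>.\<close>

lemma frontier_below:
  fixes K :: "'a::euclidean_space set"
  assumes K: "compact K" "\<And>x. x \<in> K \<Longrightarrow> norm x \<le> R" and e: "norm e = 1" and x: "x \<in> K"
  obtains y s where "y \<in> frontier K" "0 \<le> s" "s \<le> 2 * R" "x = y + s *\<^sub>R e"
proof -
  define S where "S = {0..2 * R} \<inter> (\<lambda>s. x - s *\<^sub>R e) -` K"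
  have inS: "s \<in> S" if "0 \<le> s" "x - s *\<^sub>R e \<in> K" for s
  proof -
    have "s = norm (x - (x - s *\<^sub>R e))" using e that by simp
    also have "\<dots> \<le> norm x + norm (x - s *\<^sub>R e)" by (rule norm_triangle_ineq4)
    also have "\<dots> \<le> 2 * R" using K(2)[OF x] K(2)[OF that(2)] by simp
    finally show ?thesis using that by (simp add: S_def)
  qed
  have "closed ((\<lambda>s. x - s *\<^sub>R e) -` K)"
    by (intro closed_vimage compact_imp_closed[OF K(1)] continuous_intros)
  then have "compact S" unfolding S_def by (intro compact_Int_closed) auto
  moreover have "S \<noteq> {}" using inS[of 0] x by auto
  ultimately obtain s where s: "s \<in> S" "\<And>t. t \<in> S \<Longrightarrow> t \<le> s"
    using compact_attains_sup[of S] by blast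
  define y where "y = x - s *\<^sub>R e"
  have yK: "y \<in> K" "0 \<le> s" "s \<le> 2 * R" using s(1) by (auto simp: S_def y_def)
  have "y \<notin> interior K"
  proof
    assume "y \<in> interior K"
    then obtain d where d: "d > 0" "cball y d \<subseteq> K" unfolding mem_interior_cball by blast
    have "y - d *\<^sub>R e \<in> K" using d e by (intro subsetD[OF d(2)]) (simp add: dist_norm)
    then have "x - (s + d) *\<^sub>R e \<in> K" by (simp add: y_def algebra_simps)
    then have "s + d \<le> s" using d(1) yK(2) by (intro s(2) inS) auto
    then show False using d(1) by simp
  qed
  then have "y \<in> frontier K" using yK(1) closure_subset by (auto simp: frontier_def)
  then show thesis using yK by (intro that[of y s]) (auto simp: y_def)
qed

text \<open>Translating a cover of the boundary along a coordinate axis covers the body. The boxes swept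
  out by small sets have volume comparable to the Hausdorff weight of these sets, so the boundary
  of a body of positive volume cannot have zero area.\<close>

lemma hausdorff_frontier_pos:
  fixes K :: "'a::euclidean_space set"
  assumes K: "compact K" and vol: "emeasure lborel K > 0"
  shows "hausdorff_outer_measure (DIM('a) - 1) (frontier K) > 0"
proof -
  define d where "d = DIM('a) - 1"
  define \<omega> where "\<omega> = unit_ball_vol (real d)"
  have \<omega>: "\<omega> > 0" by (simp add: \<omega>_def)
  obtain R where R: "R > 0" "\<And>x. x \<in> K \<Longrightarrow> norm x \<le> R"
    using compact_imp_bounded[OF K] unfolding bounded_pos by blast
  obtain e :: 'a where e: "e \<in> Basis" using nonempty_Basis by blast
  define C where "C = 4 ^ d * (2 + 2 * R) / \<omega>"
  have C: "C > 0" using R \<omega> by (simp add: C_def)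
  show ?thesis
  proof (rule ccontr)
    assume "\<not> ?thesis"
    then have H0: "hausdorff_premeasure d 1 (frontier K) = 0"
      using hausdorff_premeasure_le_outer[of 1 d "frontier K"] by (simp add: d_def)
    define v where "v = measure lborel K"
    have v: "emeasure lborel K = ennreal v"
      unfolding v_def using emeasure_compact_finite[OF K] by (intro emeasure_eq_ennreal_measure) auto
    with vol have v0: "v > 0" by simp
    have "hausdorff_premeasure d 1 (frontier K) < ennreal (v / C)" using H0 v0 C by simp
    then obtain U :: "nat \<Rightarrow> 'a set" where U: "frontier K \<subseteq> (\<Union>i. U i)" "\<And>i. bounded (U i)"
      "\<And>i. diameter (U i) \<le> 1" "(\<Sum>i. hausdorff_gauge d (U i)) < ennreal (v / C)"
      by (rule hausdorff_premeasure_lessE) blast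
    define x where "x i = (SOME y. y \<in> U i)" for i
    define D where "D i = diameter (U i)" for i
    have D: "0 \<le> D i" "D i \<le> 1" for i using U(3)[of i] diameter_ge_0[OF U(2)] by (auto simp: D_def)
    define l u where "l i = x i - D i *\<^sub>R One" and "u i = x i + D i *\<^sub>R One + (2 * R) *\<^sub>R e" for i
    define Q where "Q i = (if U i = {} then {} else cbox (l i) (u i))" for i
    have cover: "K \<subseteq> (\<Union>i. Q i)"
    proof
      fix z assume "z \<in> K"
      from frontier_below[OF K R(2) _ this, of e] e
      obtain y s where y: "y \<in> frontier K" "0 \<le> s" "s \<le> 2 * R" "z = y + s *\<^sub>R e" by auto
      from y(1) U(1) obtain i where i: "y \<in> U i" by blast
      have xi: "x i \<in> U i" unfolding x_def using i by (rule someI)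
      have "\<bar>(y - x i) \<bullet> b\<bar> \<le> D i" if b: "b \<in> Basis" for b
      proof -
        have "\<bar>(y - x i) \<bullet> b\<bar> \<le> norm (y - x i)" by (rule Basis_le_norm[OF b])
        also have "\<dots> \<le> D i" using diameter_bounded_bound[OF U(2) i xi] by (simp add: D_def dist_norm)
        finally show ?thesis .
      qed
      then have yb: "x i \<bullet> b - D i \<le> y \<bullet> b" "y \<bullet> b \<le> x i \<bullet> b + D i" if "b \<in> Basis" for b
        using that by (fastforce simp: inner_diff_left abs_le_iff)+
      have "z \<in> cbox (l i) (u i)"
        unfolding mem_box
      proof (intro ballI conjI)
        fix b :: 'a assume b: "b \<in> Basis"
        have eb: "e \<bullet> b = (if e = b then 1 else 0)" by (rule inner_Basis[OF e b])
        show "l i \<bullet> b \<le> z \<bullet> b" "z \<bullet> b \<le> u i \<bullet> b"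
          using yb[OF b] y(2,3) b eb
          by (auto simp: l_def u_def y(4) inner_diff_left inner_add_left split: if_splits)
      qed
      then have "z \<in> Q i" using i by (auto simp: Q_def)
      then show "z \<in> (\<Union>i. Q i)" by (rule UN_I[OF UNIV_I])
    qed
    have vol_Q: "emeasure lborel (Q i) \<le> ennreal C * hausdorff_gauge d (U i)" for i
    proof (cases "U i = {}")
      case False
      have lu: "l i \<bullet> b \<le> u i \<bullet> b" if "b \<in> Basis" for b
        using that D[of i] R(1) inner_Basis[OF e that]
        by (auto simp: l_def u_def inner_diff_left inner_add_left split: if_splits)
      have side: "(u i - l i) \<bullet> b = 2 * D i + (if e = b then 2 * R else 0)" if "b \<in> Basis" for b
        using that inner_Basis[OF e that] by (auto simp: l_def u_def inner_diff_left inner_add_left)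
      have "(\<Prod>b\<in>Basis. (u i - l i) \<bullet> b) = (\<Prod>b\<in>Basis. 2 * D i + (if e = b then 2 * R else 0))"
        by (rule prod.cong[OF refl side])
      also have "\<dots> = (2 * D i + 2 * R) * (\<Prod>b\<in>Basis - {e}. 2 * D i + (if e = b then 2 * R else 0))"
        by (subst prod.remove[OF finite_Basis e]) simp
      also have "(\<Prod>b\<in>Basis - {e}. 2 * D i + (if e = b then 2 * R else 0)) = (\<Prod>b\<in>Basis - {e}. 2 * D i)"
        by (rule prod.cong) auto
      also have "\<dots> = (2 * D i) ^ d"
        using e by (simp add: d_def card_Diff_singleton)
      also have "(2 * D i + 2 * R) * (2 * D i) ^ d \<le> (2 + 2 * R) * (2 * D i) ^ d"
        using D[of i] by (intro mult_right_mono) auto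
      also have "(2 * D i) ^ d = (4 * (D i / 2)) ^ d" by (rule arg_cong[where f = "\<lambda>x. x ^ d"]) simp
      also have "(4 * (D i / 2)) ^ d = 4 ^ d * (D i / 2) ^ d" by (rule power_mult_distrib)
      also have "(2 + 2 * R) * (4 ^ d * (D i / 2) ^ d) = C * (\<omega> * (D i / 2) ^ d)"
        using \<omega> by (simp add: C_def)
      finally have "(\<Prod>b\<in>Basis. (u i - l i) \<bullet> b) \<le> C * (\<omega> * (D i / 2) ^ d)" .
      then have "emeasure lborel (cbox (l i) (u i)) \<le> ennreal (C * (\<omega> * (D i / 2) ^ d))"
        by (subst emeasure_lborel_cbox[OF lu]) (auto intro: ennreal_leI)
      also have "\<dots> = ennreal C * ennreal (\<omega> * (D i / 2) ^ d)"
        using C by (intro ennreal_mult) (use \<omega> D[of i] in auto)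
      finally show ?thesis using False by (simp add: Q_def \<omega>_def D_def)
    qed (simp add: Q_def)
    have "emeasure lborel K \<le> emeasure lborel (\<Union>i. Q i)"
      by (rule emeasure_mono[OF cover]) (auto simp: Q_def)
    also have "\<dots> \<le> (\<Sum>i. emeasure lborel (Q i))"
      by (rule emeasure_subadditive_countably) (auto simp: Q_def)
    also have "\<dots> \<le> (\<Sum>i. ennreal C * hausdorff_gauge d (U i))"
      by (intro suminf_le summableI vol_Q)
    also have "\<dots> = ennreal C * (\<Sum>i. hausdorff_gauge d (U i))" by (rule ennreal_suminf_cmult)
    also have "\<dots> < ennreal C * ennreal (v / C)"
      using C U(4) by (intro ennreal_mult_strict_left_mono) auto
    also have "\<dots> = ennreal v" using C v0 by (simp add: ennreal_mult'[symmetric])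
    finally show False using v by simp
  qed
qed

lemma sets_weighted_measure [simp]: "sets (weighted_measure u) = sets borel"
  by (simp add: weighted_measure_def)

lemma emeasure_weighted_measure:
  assumes "continuous_on UNIV u" "A \<in> sets borel"
  shows "emeasure (weighted_measure u) A = (\<integral>\<^sup>+ x\<in>A. exp (- u x) \<partial>lborel)"
proof -
  have [measurable]: "u \<in> borel_measurable borel" by (rule borel_measurable_continuous_onI[OF assms(1)])
  show ?thesis unfolding weighted_measure_def using assms(2) by (subst emeasure_density) auto
qed

lemma emeasure_weighted_measure_finite:
  fixes A :: "'a::euclidean_space set"
  assumes u: "continuous_on UNIV u" and A: "A \<in> sets borel" "bounded A"
  shows "emeasure (weighted_measure u) A < \<infinity>"
proof -
  obtain r where r: "A \<subseteq> cball 0 r" using bounded_subset_ballD[OF A(2), of 0] ball_subset_cball by blast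
  have "continuous_on (cball 0 r) (\<lambda>x. exp (- u x))"
    by (intro continuous_intros continuous_on_subset[OF u]) auto
  from compact_imp_bounded[OF compact_continuous_image[OF this compact_cball]]
  obtain M where M: "M > 0" "\<And>x. x \<in> cball 0 r \<Longrightarrow> norm (exp (- u x)) \<le> M" unfolding bounded_pos by auto
  have "emeasure (weighted_measure u) A \<le> (\<integral>\<^sup>+ x. ennreal M * indicator (cball (0::'a) r) x \<partial>lborel)"
    unfolding emeasure_weighted_measure[OF u A(1)]
  proof (rule nn_integral_mono)
    fix x
    show "ennreal (exp (- u x)) * indicator A x \<le> ennreal M * indicator (cball 0 r) x"
      using M(2)[of x] r by (auto simp: indicator_def intro!: ennreal_leI)
  qed
  also have "\<dots> = ennreal M * emeasure lborel (cball (0::'a) r)" by (rule nn_integral_cmult_indicator) simp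
  also have "\<dots> < \<infinity>"
    using emeasure_compact_finite[OF compact_cball[of "0::'a" r]] by (simp add: ennreal_mult_less_top)
  finally show ?thesis .
qed

lemma measure_weighted_measure_pos:
  fixes A :: "'a::euclidean_space set"
  assumes u: "continuous_on UNIV u" and A: "compact A" "interior A \<noteq> {}"
  shows "measure (weighted_measure u) A > 0"
proof -
  obtain x d where d: "d > 0" "cball x d \<subseteq> A" using A(2) mem_interior_cball[of _ A] by blast
  have "continuous_on (cball x d) u" by (rule continuous_on_subset[OF u]) auto
  from compact_imp_bounded[OF compact_continuous_image[OF this compact_cball]]
  obtain M where M: "\<And>y. y \<in> cball x d \<Longrightarrow> norm (u y) \<le> M" unfolding bounded_iff by blast
  have As: "A \<in> sets borel" using A(1) by (simp add: borel_compact)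
  have "0 < ennreal (exp (- M)) * emeasure lborel (cball x d)"
    using d(1) by (simp add: emeasure_cball ennreal_zero_less_mult_iff)
  also have "\<dots> = (\<integral>\<^sup>+ y. ennreal (exp (- M)) * indicator (cball x d) y \<partial>lborel)"
    by (rule nn_integral_cmult_indicator[symmetric]) simp
  also have "\<dots> \<le> emeasure (weighted_measure u) A"
    unfolding emeasure_weighted_measure[OF u As]
  proof (rule nn_integral_mono)
    fix y
    show "ennreal (exp (- M)) * indicator (cball x d) y \<le> ennreal (exp (- u y)) * indicator A y"
      using M[of y] d(2) by (cases "y \<in> cball x d") (auto simp: abs_le_iff intro!: ennreal_leI)
  qed
  finally have "0 < emeasure (weighted_measure u) A" .
  moreover have "emeasure (weighted_measure u) A < \<infinity>"
    by (rule emeasure_weighted_measure_finite[OF u As compact_imp_bounded[OF A(1)]])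
  ultimately show ?thesis by (simp add: measure_def enn2real_positive_iff)
qed

context power_body begin

lemma power_body_volume_pos: "emeasure lborel K > 0"
proof -
  have "0 \<in> interior K" by (simp add: K_interior)
  then obtain d where d: "d > 0" "cball 0 d \<subseteq> K" unfolding mem_interior_cball by blast
  have "0 < emeasure lborel (cball (0::'a) d)" using d(1) by (simp add: emeasure_cball)
  also have "\<dots> \<le> emeasure lborel K"
    using d(2) K_compact by (intro emeasure_mono) (auto simp: borel_compact)
  finally show ?thesis .
qed

lemma shell_compact: "compact {x. a \<le> g x \<and> g x \<le> b}"
proof -
  have "closed {x. a \<le> g x \<and> g x \<le> b}"
    by (intro closed_Collect_conj closed_Collect_le g_cont continuous_on_const)
  moreover have "g x \<le> \<bar>b\<bar>" if "g x \<le> b" for x using that by linarith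
  then have "{x. a \<le> g x \<and> g x \<le> b} \<subseteq> {x. \<phi> x \<le> \<bar>b\<bar> ^ (2 * q)}"
    using g_le_iff[of "\<bar>b\<bar>"] by auto
  then have "bounded {x. a \<le> g x \<and> g x \<le> b}" using sublevel_bounded bounded_subset by blast
  ultimately show ?thesis by (simp add: compact_eq_bounded_closed)
qed

lemma scaled_K: "s > 0 \<Longrightarrow> (*\<^sub>R) s ` K = {x. g x \<le> s}"
proof -
  assume s: "s > 0"
  have "\<phi> (x /\<^sub>R s) \<le> 1 \<longleftrightarrow> g x \<le> s" for x
    using g_le_iff[of 1 "x /\<^sub>R s"] s by (simp add: g_scale field_simps)
  then show ?thesis unfolding K_def using s by (subst image_scaleR_Collect) auto
qed

lemma hausdorff_frontier_le_shell:
  assumes A: "A \<in> sets borel" "A \<subseteq> frontier K" and h: "h > 0"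
  shows "ennreal h * hausdorff_outer_measure (DIM('a) - 1) A
     \<le> (\<integral>\<^sup>+ x\<in>{y. 1 < g y \<and> g y \<le> 1 + h \<and> y /\<^sub>R g y \<in> A}. norm (\<gamma> x) \<partial>lborel)"
proof (rule hausdorff_level_set_le_shell[where C = "{x. 1/2 \<le> g x \<and> g x \<le> 2 + h}" and W = "{x. 1/2 < g x \<and> g x < 2 + h}"])
  show "open {x. 1/2 < g x \<and> g x < 2 + h}"
    by (intro open_Collect_conj open_Collect_less g_cont continuous_on_const)
  show "{x. 1/2 < g x \<and> g x < 2 + h} \<subseteq> {x. 1/2 \<le> g x \<and> g x \<le> 2 + h}" by auto
  show "compact {x. 1/2 \<le> g x \<and> g x \<le> 2 + h}" by (rule shell_compact)
  have nz: "x \<noteq> 0" if "1/2 \<le> g x" for x using that by auto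
  show "continuous_on {x. 1/2 \<le> g x \<and> g x \<le> 2 + h} \<gamma>"
    by (rule continuous_on_subset[OF gamma_cont]) (use nz in auto)
  show "\<gamma> x \<noteq> 0" if "x \<in> {x. 1/2 \<le> g x \<and> g x \<le> 2 + h}" for x
    using that nz[of x] gamma_nonzero by auto
  show "\<gamma> \<in> borel_measurable borel" by (rule gamma_measurable)
  show "g \<in> borel_measurable borel" by (rule borel_measurable_continuous_onI[OF g_cont])
  show "(g has_derivative (\<lambda>h. \<gamma> x \<bullet> h)) (at x)" if "x \<in> {x. 1/2 < g x \<and> g x < 2 + h}" for x
    using that nz[of x] by (intro g_deriv) auto
  show "g (s *\<^sub>R x) = s * g x" if "s > 0" for s x using that by (simp add: g_scale)
  show "x \<in> {x. 1/2 < g x \<and> g x < 2 + h}" if "1 < g x" "g x \<le> 1 + h" for x using that by simp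
  show "g x = 1" if "x \<in> A" for x using that A(2) by (auto simp: K_frontier g_eq_1_iff)
qed (use A h in auto)

lemma frontier_eq_g: "frontier K = {x. g x = 1}"
  by (auto simp: K_frontier g_eq_1_iff)

lemma frontier_borel [measurable]: "frontier K \<in> sets borel"
  by (intro borel_closed frontier_closed)

text \<open>The boundary integral with values in \<open>[0, \<infinity>]\<close>. Its finiteness, on which the meaning of the
  Lebesgue integral depends, is a consequence of the comparison with thin shells.\<close>

definition boundary_integral :: "('a \<Rightarrow> real) \<Rightarrow> ennreal" where
  "boundary_integral u = (\<integral>\<^sup>+ x. ennreal (2 * real q / norm (G x)) * ennreal (exp (- u x)) * indicator (frontier K) x
      \<partial>hausdorff_measure (DIM('a) - 1))"

lemma lebesgue_integral_boundary:
  assumes u: "continuous_on UNIV u"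
  shows "(\<integral>x. support_function K (gauss_map K x) \<partial>weighted_boundary_measure u K) = enn2real (boundary_integral u)"
proof -
  let ?H = "hausdorff_measure (DIM('a) - 1) :: 'a measure"
  let ?R = "restrict_space ?H (frontier K)"
  have [measurable]: "u \<in> borel_measurable borel" by (rule borel_measurable_continuous_onI[OF u])
  have [measurable]: "G \<in> borel_measurable borel" by (rule borel_measurable_continuous_onI[OF G_cont])
  have m1: "(\<lambda>x. 2 * real q / norm (G x)) \<in> borel_measurable ?H" "(\<lambda>x. exp (- u x)) \<in> borel_measurable ?H"
    by (subst measurable_cong_sets[OF sets_hausdorff_measure refl], measurable)+
  have m2: "(\<lambda>x. 2 * real q / norm (G x)) \<in> borel_measurable ?R" "(\<lambda>x. exp (- u x)) \<in> borel_measurable ?R"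
    by (rule measurable_restrict_space1, rule m1)+
  have sp: "space (weighted_boundary_measure u K) = frontier K"
    by (simp add: weighted_boundary_measure_def space_restrict_space)
  have "(\<integral>x. support_function K (gauss_map K x) \<partial>weighted_boundary_measure u K)
      = (\<integral>x. 2 * real q / norm (G x) \<partial>weighted_boundary_measure u K)"
    by (rule Bochner_Integration.integral_cong[OF refl]) (simp add: sp K_support_gauss)
  also have "\<dots> = enn2real (\<integral>\<^sup>+ x. ennreal (2 * real q / norm (G x)) \<partial>weighted_boundary_measure u K)"
    by (rule integral_eq_nn_integral) (use m2 in \<open>auto simp: weighted_boundary_measure_def\<close>)
  also have "(\<integral>\<^sup>+ x. ennreal (2 * real q / norm (G x)) \<partial>weighted_boundary_measure u K)
      = (\<integral>\<^sup>+ x. ennreal (exp (- u x)) * ennreal (2 * real q / norm (G x)) \<partial>?R)"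
    unfolding weighted_boundary_measure_def using m2 by (intro nn_integral_density) auto
  also have "\<dots> = (\<integral>\<^sup>+ x. ennreal (exp (- u x)) * ennreal (2 * real q / norm (G x)) * indicator (frontier K) x \<partial>?H)"
    by (rule nn_integral_restrict_space) simp
  also have "\<dots> = boundary_integral u"
    unfolding boundary_integral_def by (intro nn_integral_cong) (simp add: mult.commute)
  finally show ?thesis .
qed

lemma boundary_integral_pos:
  assumes u: "continuous_on UNIV u"
  shows "boundary_integral u > 0"
proof -
  let ?H = "hausdorff_measure (DIM('a) - 1) :: 'a measure"
  have cF: "compact (frontier K)" by (rule compact_frontier[OF K_compact])
  have pos: "hausdorff_outer_measure (DIM('a) - 1) (frontier K) > 0"
    by (rule hausdorff_frontier_pos[OF K_compact power_body_volume_pos])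
  then have ne: "frontier K \<noteq> {}" by auto
  have Gnz: "norm (G x) \<noteq> 0" if "x \<in> frontier K" for x
    using G_nonzero[OF frontier_nonzero[OF that]] by simp
  have "continuous_on (frontier K) (\<lambda>x. 2 * real q / norm (G x) * exp (- u x))"
    by (intro continuous_intros G_cont continuous_on_subset[OF u]) (use Gnz in auto)
  from continuous_attains_inf[OF cF ne this] obtain x where x: "x \<in> frontier K"
    "\<And>y. y \<in> frontier K \<Longrightarrow> 2 * real q / norm (G x) * exp (- u x) \<le> 2 * real q / norm (G y) * exp (- u y)"
    by blast
  define k where "k = 2 * real q / norm (G x) * exp (- u x)"
  have k: "k > 0" using Gnz[OF x(1)] q1 by (simp add: k_def)
  have "0 < ennreal k * emeasure ?H (frontier K)"
    using k pos by (simp add: emeasure_hausdorff_measure ennreal_zero_less_mult_iff)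
  also have "\<dots> = (\<integral>\<^sup>+ x. ennreal k * indicator (frontier K) x \<partial>?H)"
    by (rule nn_integral_cmult_indicator[symmetric]) simp
  also have "\<dots> \<le> boundary_integral u"
    unfolding boundary_integral_def
  proof (rule nn_integral_mono)
    fix y
    show "ennreal k * indicator (frontier K) y \<le>
      ennreal (2 * real q / norm (G y)) * ennreal (exp (- u y)) * indicator (frontier K) y"
      using x(2)[of y] by (cases "y \<in> frontier K") (auto simp: k_def ennreal_mult'[symmetric] intro!: ennreal_leI)
  qed
  finally show ?thesis .
qed

text \<open>The area bound for parts of the boundary says that \<open>h\<close> times the surface measure is at most
  the image of the measure with density \<open>|\<gamma>|\<close> on the shell under the radial projection. On the
  shell the density cancels the factor \<open>h\<^sub>K \<circ> \<nu>\<^sub>K\<close>.\<close>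

lemma boundary_integral_le_shell_projected:
  assumes u: "continuous_on UNIV u" and h: "h > 0"
  shows "ennreal h * boundary_integral u \<le> (\<integral>\<^sup>+ y\<in>{y. 1 < g y \<and> g y \<le> 1 + h}. exp (- u (y /\<^sub>R g y)) \<partial>lborel)"
proof -
  let ?H = "hausdorff_measure (DIM('a) - 1) :: 'a measure"
  let ?F = "\<lambda>x. ennreal (2 * real q / norm (G x)) * ennreal (exp (- u x))"
  define Sh where "Sh = {y. 1 < g y \<and> g y \<le> 1 + h}"
  have [measurable]: "u \<in> borel_measurable borel" by (rule borel_measurable_continuous_onI[OF u])
  have [measurable]: "G \<in> borel_measurable borel" by (rule borel_measurable_continuous_onI[OF G_cont])
  have [measurable]: "g \<in> borel_measurable borel" by (rule borel_measurable_continuous_onI[OF g_cont])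
  note gamma_measurable[measurable]
  have Sh[measurable]: "Sh \<in> sets borel" unfolding Sh_def by measurable
  have proj[measurable]: "(\<lambda>y. y /\<^sub>R g y) \<in> borel_measurable borel" by measurable
  define N where "N = density ?H (\<lambda>x. ennreal h * indicator (frontier K) x)"
  define D where "D = density lborel (\<lambda>y. ennreal (norm (\<gamma> y)) * indicator Sh y)"
  define \<nu> where "\<nu> = distr D borel (\<lambda>y. y /\<^sub>R g y)"
  have sN: "sets N = sets borel" and s\<nu>: "sets \<nu> = sets borel" by (simp_all add: N_def \<nu>_def)
  have mF: "?F \<in> borel_measurable borel" by measurable
  have mind: "(\<lambda>x. ennreal h * indicator (frontier K) x) \<in> borel_measurable ?H"
    by (subst measurable_cong_sets[OF sets_hausdorff_measure refl]) measurable
  have mFH: "?F \<in> borel_measurable ?H"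
    by (subst measurable_cong_sets[OF sets_hausdorff_measure refl]) (rule mF)
  have le: "emeasure N A \<le> emeasure \<nu> A" if A: "A \<in> sets borel" for A
  proof -
    have [measurable]: "A \<in> sets borel" by (rule A)
    have "emeasure N A = (\<integral>\<^sup>+ x. ennreal h * indicator (frontier K) x * indicator A x \<partial>?H)"
      unfolding N_def using mind A by (subst emeasure_density) auto
    also have "\<dots> = (\<integral>\<^sup>+ x. ennreal h * indicator (A \<inter> frontier K) x \<partial>?H)"
      by (intro nn_integral_cong) (auto simp: indicator_def)
    also have "\<dots> = ennreal h * emeasure ?H (A \<inter> frontier K)"
      using A by (intro nn_integral_cmult_indicator) simp
    also have "\<dots> = ennreal h * hausdorff_outer_measure (DIM('a) - 1) (A \<inter> frontier K)"
      using A by (simp add: emeasure_hausdorff_measure)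
    also have "\<dots> \<le> (\<integral>\<^sup>+ x\<in>{y. 1 < g y \<and> g y \<le> 1 + h \<and> y /\<^sub>R g y \<in> A \<inter> frontier K}. norm (\<gamma> x) \<partial>lborel)"
      using A by (intro hausdorff_frontier_le_shell h) auto
    also have "\<dots> = (\<integral>\<^sup>+ y. ennreal (norm (\<gamma> y)) * indicator Sh y * indicator ((\<lambda>y. y /\<^sub>R g y) -` A) y \<partial>lborel)"
    proof (intro nn_integral_cong)
      fix y :: 'a
      have "y /\<^sub>R g y \<in> frontier K" if "1 < g y"
        using that by (simp add: frontier_eq_g g_scale)
      then show "ennreal (norm (\<gamma> y)) * indicator {y. 1 < g y \<and> g y \<le> 1 + h \<and> y /\<^sub>R g y \<in> A \<inter> frontier K} y =
        ennreal (norm (\<gamma> y)) * indicator Sh y * indicator ((\<lambda>y. y /\<^sub>R g y) -` A) y"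
        by (auto simp: indicator_def Sh_def)
    qed
    also have "\<dots> = emeasure D ((\<lambda>y. y /\<^sub>R g y) -` A)"
      unfolding D_def using measurable_sets[OF proj A] by (subst emeasure_density) auto
    also have "\<dots> = emeasure \<nu> A"
      unfolding \<nu>_def using A by (subst emeasure_distr) (auto simp: D_def)
    finally show ?thesis .
  qed
  have "N \<le> \<nu>"
    using le by (subst le_measure) (auto simp: sN s\<nu>)
  then have "(\<integral>\<^sup>+ x. ?F x \<partial>N) \<le> (\<integral>\<^sup>+ x. ?F x \<partial>\<nu>)"
    by (intro nn_integral_mono_measure) (auto simp: sN s\<nu>)
  also have "(\<integral>\<^sup>+ x. ?F x \<partial>N) = (\<integral>\<^sup>+ x. ennreal h * (?F x * indicator (frontier K) x) \<partial>?H)"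
    unfolding N_def using mind mFH by (subst nn_integral_density) (auto simp: mult_ac)
  also have "\<dots> = ennreal h * boundary_integral u"
  proof -
    have "(\<lambda>x. ?F x * indicator (frontier K) x) \<in> borel_measurable ?H"
      by (subst measurable_cong_sets[OF sets_hausdorff_measure refl]) measurable
    then show ?thesis unfolding boundary_integral_def by (rule nn_integral_cmult)
  qed
  also have "(\<integral>\<^sup>+ x. ?F x \<partial>\<nu>) = (\<integral>\<^sup>+ y. ?F (y /\<^sub>R g y) \<partial>D)"
    unfolding \<nu>_def by (rule nn_integral_distr) (auto simp: D_def)
  also have "\<dots> = (\<integral>\<^sup>+ y. ennreal (norm (\<gamma> y)) * indicator Sh y * ?F (y /\<^sub>R g y) \<partial>lborel)"
    unfolding D_def by (rule nn_integral_density) auto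
  also have "\<dots> = (\<integral>\<^sup>+ y. ennreal (exp (- u (y /\<^sub>R g y))) * indicator Sh y \<partial>lborel)"
  proof (intro nn_integral_cong)
    fix y :: 'a
    have "norm (\<gamma> y) * (2 * real q / norm (G (y /\<^sub>R g y))) = 1" if "1 < g y"
    proof -
      have y0: "y \<noteq> 0" using that by auto
      have "y /\<^sub>R g y \<noteq> 0" using y0 that by simp
      then have "G (y /\<^sub>R g y) \<noteq> 0" by (rule G_nonzero)
      then show ?thesis using q1 by (simp add: gamma_eq[OF y0])
    qed
    then show "ennreal (norm (\<gamma> y)) * indicator Sh y * ?F (y /\<^sub>R g y) = ennreal (exp (- u (y /\<^sub>R g y))) * indicator Sh y"
      by (auto simp: indicator_def Sh_def mult.assoc[symmetric] ennreal_mult'[symmetric])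
  qed
  finally show ?thesis unfolding Sh_def .
qed

lemma measure_shell:
  assumes u: "continuous_on UNIV u" and h: "h > 0"
  shows "emeasure (weighted_measure u) {y. 1 < g y \<and> g y \<le> 1 + h} =
     ennreal (measure (weighted_measure u) ((*\<^sub>R) (1 + h) ` K) - measure (weighted_measure u) K)"
proof -
  let ?M = "weighted_measure u"
  have [measurable]: "g \<in> borel_measurable borel" by (rule borel_measurable_continuous_onI[OF g_cont])
  have big: "(*\<^sub>R) (1 + h) ` K = {y. g y \<le> 1 + h}" using h by (intro scaled_K) simp
  have small: "K = {y. g y \<le> 1}" using scaled_K[of 1] by simp
  have bdd: "bounded {y. g y \<le> b}" if "b > 0" for b
    using compact_imp_bounded[OF compact_scaling[OF K_compact, of b]] scaled_K[OF that] by simp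
  have s: "{y. g y \<le> b} \<in> sets borel" for b by measurable
  have fin: "emeasure ?M {y. g y \<le> b} < \<infinity>" if "b > 0" for b
    by (rule emeasure_weighted_measure_finite[OF u s bdd[OF that]])
  have "{y. 1 < g y \<and> g y \<le> 1 + h} = {y. g y \<le> 1 + h} - {y. g y \<le> 1}" by auto
  moreover have "emeasure ?M ({y. g y \<le> 1 + h} - {y. g y \<le> 1}) = emeasure ?M {y. g y \<le> 1 + h} - emeasure ?M {y. g y \<le> 1}"
  proof (rule emeasure_Diff)
    show "emeasure ?M {y. g y \<le> 1} \<noteq> \<infinity>" using fin[of 1] by simp
    show "{y. g y \<le> 1 + h} \<in> sets ?M" "{y. g y \<le> 1} \<in> sets ?M" using s by simp_all
    show "{y. g y \<le> 1} \<subseteq> {y. g y \<le> 1 + h}" using h by auto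
  qed
  ultimately have "emeasure ?M {y. 1 < g y \<and> g y \<le> 1 + h} = emeasure ?M {y. g y \<le> 1 + h} - emeasure ?M {y. g y \<le> 1}"
    by simp
  also have "\<dots> = ennreal (measure ?M {y. g y \<le> 1 + h}) - ennreal (measure ?M {y. g y \<le> 1})"
    using fin[of 1] fin[of "1 + h"] h by (simp add: emeasure_eq_ennreal_measure less_top)
  also have "\<dots> = ennreal (measure ?M {y. g y \<le> 1 + h} - measure ?M {y. g y \<le> 1})"
    by (rule ennreal_minus) simp
  finally show ?thesis unfolding big small[symmetric] .
qed

text \<open>In a thin shell \<open>u\<close> changes little under the radial projection to the boundary of \<open>K\<close>.\<close>

lemma boundary_integral_le_quotient:
  assumes u: "continuous_on UNIV u" and \<epsilon>: "\<epsilon> > 0"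
  obtains h0 where "h0 > 0" "\<And>h. 0 < h \<Longrightarrow> h \<le> h0 \<Longrightarrow> ennreal h * boundary_integral u \<le>
     ennreal (exp \<epsilon> * (measure (weighted_measure u) ((*\<^sub>R) (1 + h) ` K) - measure (weighted_measure u) K))"
proof -
  have C: "compact {x. 0 \<le> g x \<and> g x \<le> 2}" by (rule shell_compact)
  have "uniformly_continuous_on {x. 0 \<le> g x \<and> g x \<le> 2} u"
    by (rule compact_uniformly_continuous[OF continuous_on_subset[OF u] C]) auto
  then obtain d where d: "d > 0" "\<And>x y. 0 \<le> g x \<Longrightarrow> g x \<le> 2 \<Longrightarrow> 0 \<le> g y \<Longrightarrow> g y \<le> 2 \<Longrightarrow> dist y x < d \<Longrightarrow> dist (u y) (u x) < \<epsilon>"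
    unfolding uniformly_continuous_on_def using \<epsilon> by (metis (mono_tags, lifting) mem_Collect_eq)
  obtain R where R: "R > 0" "\<And>x. 0 \<le> g x \<Longrightarrow> g x \<le> 2 \<Longrightarrow> norm x \<le> R"
    using compact_imp_bounded[OF C] unfolding bounded_pos by auto
  define h0 where "h0 = min 1 (d / (2 * R))"
  have h0: "h0 > 0" using d R by (simp add: h0_def)
  have [measurable]: "u \<in> borel_measurable borel" by (rule borel_measurable_continuous_onI[OF u])
  have [measurable]: "g \<in> borel_measurable borel" by (rule borel_measurable_continuous_onI[OF g_cont])
  show thesis
  proof (rule that[OF h0])
    fix h assume h: "0 < h" "h \<le> h0"
    define Sh where "Sh = {y. 1 < g y \<and> g y \<le> 1 + h}"
    have Sh[measurable]: "Sh \<in> sets borel" unfolding Sh_def by measurable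
    have h1: "h \<le> 1" "h * R < d"
    proof -
      show "h \<le> 1" using h by (simp add: h0_def)
      have "h * R \<le> d / (2 * R) * R" using h R by (intro mult_right_mono) (auto simp: h0_def)
      also have "\<dots> = d / 2" using R by simp
      finally show "h * R < d" using d by simp
    qed
    have near: "exp (- u (y /\<^sub>R g y)) \<le> exp \<epsilon> * exp (- u y)" if y: "y \<in> Sh" for y
    proof -
      have gy: "1 < g y" "g y \<le> 1 + h" using y by (auto simp: Sh_def)
      have g1: "g (y /\<^sub>R g y) = 1" using gy by (simp add: g_scale)
      have "dist (y /\<^sub>R g y) y = norm ((inverse (g y) - 1) *\<^sub>R y)" by (simp add: dist_norm scaleR_diff_left)
      also have "\<dots> = (1 - inverse (g y)) * norm y" using gy by (simp add: inverse_le_1_iff)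
      also have "\<dots> \<le> h * R"
      proof (rule mult_mono)
        have "1 - inverse (g y) = (g y - 1) / g y" using gy by (simp add: field_simps)
        also have "\<dots> \<le> (g y - 1) / 1" using gy by (intro divide_left_mono) auto
        finally show "1 - inverse (g y) \<le> h" using gy by simp
        show "norm y \<le> R" using gy h1 by (intro R(2)) auto
      qed (use h in auto)
      also have "\<dots> < d" by (rule h1)
      finally have "dist (u (y /\<^sub>R g y)) (u y) < \<epsilon>" using gy h1 g1 by (intro d(2)) auto
      then have "- u (y /\<^sub>R g y) \<le> \<epsilon> + - u y" by (simp add: dist_real_def)
      then show ?thesis by (simp add: exp_add[symmetric])
    qed
    have "ennreal h * boundary_integral u \<le> (\<integral>\<^sup>+ y. ennreal (exp (- u (y /\<^sub>R g y))) * indicator Sh y \<partial>lborel)"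
      using boundary_integral_le_shell_projected[OF u h(1)] unfolding Sh_def .
    also have "\<dots> \<le> (\<integral>\<^sup>+ y. ennreal (exp \<epsilon>) * (ennreal (exp (- u y)) * indicator Sh y) \<partial>lborel)"
    proof (rule nn_integral_mono)
      fix y
      show "ennreal (exp (- u (y /\<^sub>R g y))) * indicator Sh y \<le> ennreal (exp \<epsilon>) * (ennreal (exp (- u y)) * indicator Sh y)"
        using near[of y] by (cases "y \<in> Sh") (auto simp: ennreal_mult'[symmetric] intro!: ennreal_leI)
    qed
    also have "\<dots> = ennreal (exp \<epsilon>) * emeasure (weighted_measure u) Sh"
      unfolding emeasure_weighted_measure[OF u Sh] by (rule nn_integral_cmult) measurable
    also have "\<dots> = ennreal (exp \<epsilon> * (measure (weighted_measure u) ((*\<^sub>R) (1 + h) ` K) - measure (weighted_measure u) K))"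
      unfolding Sh_def measure_shell[OF u h(1)] by (simp add: ennreal_mult')
    finally show "ennreal h * boundary_integral u \<le>
     ennreal (exp \<epsilon> * (measure (weighted_measure u) ((*\<^sub>R) (1 + h) ` K) - measure (weighted_measure u) K))" .
  qed
qed

lemma boundary_integral_finite:
  assumes u: "continuous_on UNIV u" shows "boundary_integral u < \<infinity>"
proof -
  obtain h0 where h0: "h0 > 0" "\<And>h. 0 < h \<Longrightarrow> h \<le> h0 \<Longrightarrow> ennreal h * boundary_integral u \<le>
     ennreal (exp 1 * (measure (weighted_measure u) ((*\<^sub>R) (1 + h) ` K) - measure (weighted_measure u) K))"
    using boundary_integral_le_quotient[OF u, of 1] by auto
  have "ennreal h0 * boundary_integral u < \<infinity>"
    using h0(2)[OF h0(1) order_refl] by (rule le_less_trans) simp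
  then show ?thesis using h0(1) by (auto simp: ennreal_mult_less_top)
qed

text \<open>The upper half of the first variation formula \<open>d/dt \<mu>((1+t)K) = \<integral> h\<^sub>K(\<nu>\<^sub>K) d\<mu>\<close> at \<open>t = 0\<close>. The
  factor \<open>exp \<epsilon>\<close> of the previous estimates disappears in the limit, so there is no loss of a constant.\<close>

lemma boundary_integral_le_derivative:
  assumes u: "continuous_on UNIV u"
    and der: "((\<lambda>t. measure (weighted_measure u) ((*\<^sub>R) (1 + t) ` K)) has_real_derivative D) (at 0)"
  shows "enn2real (boundary_integral u) \<le> D"
proof -
  let ?m = "\<lambda>t. measure (weighted_measure u) ((*\<^sub>R) (1 + t) ` K)"
  define I where "I = enn2real (boundary_integral u)"
  have I: "boundary_integral u = ennreal I" "I \<ge> 0"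
    using boundary_integral_finite[OF u] by (auto simp: I_def less_top)
  have "((\<lambda>h. (?m h - measure (weighted_measure u) K) / h) \<longlongrightarrow> D) (at 0)"
    using der unfolding DERIV_def by simp
  then have lim: "((\<lambda>h. (?m h - measure (weighted_measure u) K) / h) \<longlongrightarrow> D) (at_right 0)"
    by (rule tendsto_mono[OF at_le[OF subset_UNIV]])
  have bound: "I \<le> exp \<epsilon> * D" if \<epsilon>: "\<epsilon> > 0" for \<epsilon>
  proof -
    obtain h0 where h0: "h0 > 0" "\<And>h. 0 < h \<Longrightarrow> h \<le> h0 \<Longrightarrow> ennreal h * boundary_integral u \<le>
       ennreal (exp \<epsilon> * (?m h - measure (weighted_measure u) K))"
      using boundary_integral_le_quotient[OF u \<epsilon>] by blast
    have "\<forall>\<^sub>F h in at_right 0. I \<le> exp \<epsilon> * ((?m h - measure (weighted_measure u) K) / h)"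
      unfolding eventually_at_right_field
    proof (intro exI[of _ h0] conjI allI impI)
      fix h assume h: "0 < h" "h < h0"
      have "ennreal (h * I) \<le> ennreal (exp \<epsilon> * (?m h - measure (weighted_measure u) K))"
        using h0(2)[of h] h I by (simp add: ennreal_mult')
      then have "h * I \<le> exp \<epsilon> * (?m h - measure (weighted_measure u) K) \<or> h * I \<le> 0"
        using h I by (cases "0 \<le> exp \<epsilon> * (?m h - measure (weighted_measure u) K)")
          (auto simp: ennreal_le_iff ennreal_neg not_le)
      moreover have "0 \<le> ?m h - measure (weighted_measure u) K"
      proof -
        have "K \<subseteq> (*\<^sub>R) (1 + h) ` K"
          using scaled_K[of 1] scaled_K[of "1 + h"] h by auto
        moreover have c: "compact ((*\<^sub>R) (1 + h) ` K)" by (rule compact_scaling[OF K_compact])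
        moreover have "emeasure (weighted_measure u) ((*\<^sub>R) (1 + h) ` K) < \<infinity>"
          using c by (intro emeasure_weighted_measure_finite[OF u]) (auto simp: borel_compact compact_imp_bounded)
        ultimately have "measure (weighted_measure u) K \<le> ?m h"
          by (intro measure_mono_fmeasurable) (auto simp: fmeasurable_def borel_compact K_compact)
        then show ?thesis by simp
      qed
      ultimately have "h * I \<le> exp \<epsilon> * (?m h - measure (weighted_measure u) K)"
        by (auto intro: order_trans[of _ 0])
      then show "I \<le> exp \<epsilon> * ((?m h - measure (weighted_measure u) K) / h)"
        using h by (simp add: field_simps)
    qed (use h0 in auto)
    moreover have "((\<lambda>h. exp \<epsilon> * ((?m h - measure (weighted_measure u) K) / h)) \<longlongrightarrow> exp \<epsilon> * D) (at_right 0)"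
      by (intro tendsto_intros lim)
    ultimately show ?thesis by (intro tendsto_lowerbound) auto
  qed
  have "((\<lambda>\<epsilon>. exp \<epsilon> * D) \<longlongrightarrow> exp 0 * D) (at_right 0)"
    by (intro tendsto_intros)
  moreover have "\<forall>\<^sub>F \<epsilon> in at_right 0. I \<le> exp \<epsilon> * D"
    using bound by (auto simp: eventually_at_right_field intro!: exI[of _ 1])
  ultimately have "I \<le> exp 0 * D" by (intro tendsto_lowerbound) auto
  then show ?thesis by (simp add: I_def)
qed

end

section \<open>The concavity power and the dilates of a smooth body\<close>

lemma perturbation_measure_pos:
  assumes u: "continuous_on UNIV u" and "admissible K \<rho>"
  shows "\<forall>\<^sub>F t in nhds 0. measure (weighted_measure u) (perturbation K \<rho> t) > 0"
proof -
  from assms(2) obtain \<epsilon> where \<epsilon>: "\<epsilon> > 0" "\<And>t. \<bar>t\<bar> < \<epsilon> \<Longrightarrow> \<exists>L. is_perturbation K \<rho> t L"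
    unfolding admissible_def by blast
  have "measure (weighted_measure u) (perturbation K \<rho> t) > 0" if t: "\<bar>t\<bar> < \<epsilon>" for t
  proof -
    obtain L where L: "is_perturbation K \<rho> t L" using \<epsilon>(2)[OF t] by blast
    then have "compact L" "interior L \<noteq> {}" by (auto simp: is_perturbation_def C2_plus_def)
    then show ?thesis using measure_weighted_measure_pos[OF u] perturbation_eq[OF L] by simp
  qed
  then show ?thesis unfolding eventually_nhds_metric using \<epsilon>(1) by (auto simp: dist_real_def)
qed

text \<open>The exponent 0 always qualifies, and for positive exponents the condition is linear in the
  exponent. So the non-negative exponents form a closed set. It is bounded, and hence has a maximum,
  as soon as some admissible perturbation changes the measure to first order.\<close>

lemma concavity_exponent_concavity_power:
  fixes K :: "'a::euclidean_space set"
  assumes u: "continuous_on UNIV u" and \<rho>0: "admissible K \<rho>0"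
    and first_order: "\<And>m1. ((\<lambda>t. measure (weighted_measure u) (perturbation K \<rho>0 t)) has_real_derivative m1) (at 0)
       \<Longrightarrow> m1 \<noteq> 0"
  shows "concavity_exponent (weighted_measure u) K (concavity_power (weighted_measure u) K)"
proof -
  let ?M = "weighted_measure u"
  let ?m = "\<lambda>\<rho> t. measure ?M (perturbation K \<rho> t)"
  let ?S = "{p. concavity_exponent ?M K p}"
  have pos: "\<forall>\<^sub>F t in nhds 0. ?m \<rho> t > 0" if "admissible K \<rho>" for \<rho>
    by (rule perturbation_measure_pos[OF u that])
  have zero: "concavity_exponent ?M K 0"
    unfolding concavity_exponent_def
  proof (intro allI impI)
    fix \<rho> assume "admissible K \<rho>"
    have "has_second_derivative (\<lambda>t. 1) 0 0"
      by (rule has_second_derivativeI[where f' = "\<lambda>_. 0"]) (auto intro!: always_eventually)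
    then have "has_second_derivative (\<lambda>t. ?m \<rho> t powr 0) 0 0"
      by (rule has_second_derivative_transform)
        (use pos[OF \<open>admissible K \<rho>\<close>] in \<open>auto elim: eventually_mono\<close>)
    then show "\<exists>D\<le>0. has_second_derivative (\<lambda>t. ?m \<rho> t powr 0) D 0" by blast
  qed
  show ?thesis
  proof (cases "\<exists>p>0. concavity_exponent ?M K p")
    case False
    then have "Greatest (concavity_exponent ?M K) = 0"
      using zero by (intro Greatest_equality) (auto simp: not_less)
    then show ?thesis unfolding concavity_power_def using zero by simp
  next
    case True
    then obtain p0 where p0: "p0 > 0" "concavity_exponent ?M K p0" by blast
    \<comment> \<open>For \<open>p > 0\<close> the second derivative of the power \<open>p\<close> has the sign of \<open>m m'' + (p - 1) m'\<^sup>2\<close>.\<close>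
    have linear: "\<exists>a b. 0 \<le> b \<and> (\<rho> = \<rho>0 \<longrightarrow> 0 < b) \<and> (\<forall>p>0. p \<in> ?S \<longrightarrow> a + (p - 1) * b \<le> 0) \<and>
       (\<forall>p>0. a + (p - 1) * b \<le> 0 \<longrightarrow> (\<exists>D\<le>0. has_second_derivative (\<lambda>t. ?m \<rho> t powr p) D 0))"
      if \<rho>: "admissible K \<rho>" for \<rho>
    proof -
      from p0(2) \<rho> obtain E where "has_second_derivative (\<lambda>t. ?m \<rho> t powr p0) E 0"
        unfolding concavity_exponent_def by blast
      moreover have "p0 \<noteq> 0" using p0(1) by simp
      ultimately obtain m1 D where m1: "\<forall>\<^sub>F t in nhds 0. (?m \<rho> has_real_derivative m1 t) (at t)"
        "(m1 has_real_derivative D) (at 0)"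
        "\<And>r. has_second_derivative (\<lambda>t. ?m \<rho> t powr r) (r * ?m \<rho> 0 powr (r - 2) * (?m \<rho> 0 * D + (r - 1) * (m1 0)\<^sup>2)) 0"
        using has_second_derivative_of_powr[of "?m \<rho>" p0 E 0] pos[OF \<rho>] by blast
      have m0: "?m \<rho> 0 > 0" using pos[OF \<rho>] by (rule eventually_nhds_x_imp_x)
      have sign: "r * ?m \<rho> 0 powr (r - 2) * (?m \<rho> 0 * D + (r - 1) * (m1 0)\<^sup>2) \<le> 0 \<longleftrightarrow>
          ?m \<rho> 0 * D + (r - 1) * (m1 0)\<^sup>2 \<le> 0" if "r > 0" for r
      proof -
        have "r * ?m \<rho> 0 powr (r - 2) > 0" using that m0 by simp
        from mult_le_cancel_left_pos[OF this, of _ 0] show ?thesis by (simp only: mult_zero_right)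
      qed
      show ?thesis
      proof (rule exI[of _ "?m \<rho> 0 * D"], rule exI[of _ "(m1 0)\<^sup>2"], intro conjI allI impI)
        show "0 < (m1 0)\<^sup>2" if "\<rho> = \<rho>0"
        proof -
          have "(?m \<rho>0 has_real_derivative m1 0) (at 0)"
            using eventually_nhds_x_imp_x[OF m1(1)] that by simp
          then show ?thesis using first_order by simp
        qed
        show "?m \<rho> 0 * D + (p - 1) * (m1 0)\<^sup>2 \<le> 0" if "p > 0" "p \<in> ?S" for p
        proof -
          from that(2) \<rho> obtain E where E: "E \<le> 0" "has_second_derivative (\<lambda>t. ?m \<rho> t powr p) E 0"
            unfolding concavity_exponent_def by blast
          then show ?thesis using has_second_derivative_unique[OF E(2) m1(3)] sign[OF that(1)] by simp
        qed
        show "\<exists>D\<le>0. has_second_derivative (\<lambda>t. ?m \<rho> t powr p) D 0"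
          if "p > 0" "?m \<rho> 0 * D + (p - 1) * (m1 0)\<^sup>2 \<le> 0" for p
          using m1(3)[of p] sign[OF that(1)] that(2) by blast
      qed simp
    qed
    have upper: "p \<le> 1 - a / b" if b: "b > 0" and ab: "\<forall>p>0. p \<in> ?S \<longrightarrow> a + (p - 1) * b \<le> 0" and p: "p \<in> ?S" for a b p
    proof -
      have *: "r \<le> 1 - a / b" if "r > 0" "r \<in> ?S" for r
      proof -
        have "a + (r - 1) * b \<le> 0" using ab that by blast
        then show ?thesis using b by (simp add: field_simps)
      qed
      show ?thesis
      proof (cases "p > 0")
        case True then show ?thesis using * p by blast
      next
        case False then show ?thesis using *[of p0] p0 by simp
      qed
    qed
    from linear[OF \<rho>0] obtain a b where "b > 0" "\<forall>p>0. p \<in> ?S \<longrightarrow> a + (p - 1) * b \<le> 0" by blast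
    then have bdd: "bdd_above ?S" using upper by (intro bdd_aboveI[of _ "1 - a / b"]) blast
    define s where "s = Sup ?S"
    have s_upper: "p \<le> s" if "p \<in> ?S" for p unfolding s_def by (rule cSup_upper[OF that bdd])
    have s0: "s > 0" using s_upper[of p0] p0 by simp
    have "concavity_exponent ?M K s"
      unfolding concavity_exponent_def
    proof (intro allI impI)
      fix \<rho> assume "admissible K \<rho>"
      from linear[OF this] obtain a b where ab: "0 \<le> b" "\<forall>p>0. p \<in> ?S \<longrightarrow> a + (p - 1) * b \<le> 0"
        "\<forall>p>0. a + (p - 1) * b \<le> 0 \<longrightarrow> (\<exists>D\<le>0. has_second_derivative (\<lambda>t. ?m \<rho> t powr p) D 0)" by blast
      have "a + (s - 1) * b \<le> 0"
      proof (cases "b = 0")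
        case True then show ?thesis using ab(2) p0 by auto
      next
        case False
        then have b: "b > 0" using ab(1) by simp
        have "s \<le> 1 - a / b" unfolding s_def
          using upper[OF b ab(2)] zero by (intro cSup_least) auto
        then show ?thesis using b by (simp add: field_simps)
      qed
      then show "\<exists>D\<le>0. has_second_derivative (\<lambda>t. ?m \<rho> t powr s) D 0" using ab(3) s0 by blast
    qed
    moreover from this have "Greatest (concavity_exponent ?M K) = s"
      using s_upper by (intro Greatest_equality) auto
    ultimately show ?thesis unfolding concavity_power_def by simp
  qed
qed

context power_body begin

text \<open>With \<open>F(t) = \<mu>((1+t)K)\<close>, \<open>I\<close> the boundary integral and \<open>p\<close> the concavity power, the
  assumption gives \<open>F \<le> p I \<le> p F'\<close>, while the definition of \<open>p\<close>, applied to the dilation,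
  gives \<open>F F'' \<le> (1 - p) F'\<^sup>2\<close>.\<close>

lemma dilation_second_order:
  assumes u: "continuous_on UNIV u"
    and hyp: "measure (weighted_measure u) K /
             (\<integral>x. support_function K (gauss_map K x) \<partial>weighted_boundary_measure u K)
           \<le> concavity_power (weighted_measure u) K"
    and m_def: "m = (\<lambda>t. measure (weighted_measure u) ((*\<^sub>R) (1 + t) ` K))"
  obtains m1 D where "\<forall>\<^sub>F t in nhds 0. (m has_real_derivative m1 t) (at t)"
    "(m1 has_real_derivative D) (at 0)" "m 0 * D + m 0 * m1 0 \<le> (m1 0)\<^sup>2"
proof -
  let ?M = "weighted_measure u"
  define \<rho> where "\<rho> = (\<lambda>x. support_function K (gauss_map K x))"
  have adm: "admissible K \<rho>" unfolding \<rho>_def by (rule dilation_admissible)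
  have pert: "perturbation K \<rho> t = (*\<^sub>R) (1 + t) ` K" if "\<bar>t\<bar> < 1" for t
    unfolding \<rho>_def by (rule perturbation_eq[OF dilation_is_perturbation[OF that]])
  have near: "\<forall>\<^sub>F t in nhds 0. measure ?M (perturbation K \<rho> t) = m t"
    unfolding eventually_nhds_metric m_def using pert
    by (intro exI[of _ "1::real"]) (auto simp: dist_real_def)
  define I where "I = enn2real (boundary_integral u)"
  have I: "I > 0"
    using boundary_integral_pos[OF u] boundary_integral_finite[OF u] by (simp add: I_def enn2real_positive_iff)
  have I_le: "I \<le> d" if "(m has_real_derivative d) (at 0)" for d
    unfolding I_def using that unfolding m_def by (rule boundary_integral_le_derivative[OF u])
  define p where "p = concavity_power ?M K"
  have p: "concavity_exponent ?M K p"
    unfolding p_def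
  proof (rule concavity_exponent_concavity_power[OF u adm])
    fix d assume "((\<lambda>t. measure ?M (perturbation K \<rho> t)) has_real_derivative d) (at 0)"
    then have "(m has_real_derivative d) (at 0)"
      using DERIV_cong_ev[OF refl near refl] by blast
    then show "d \<noteq> 0" using I_le I by force
  qed
  have m0: "m 0 = measure ?M K" by (simp add: m_def)
  have "0 \<in> interior K" by (simp add: K_interior)
  then have int0: "interior K \<noteq> {}" by blast
  have m0pos: "m 0 > 0" unfolding m0 by (rule measure_weighted_measure_pos[OF u K_compact int0])
  have "m 0 / I \<le> p"
    using hyp unfolding lebesgue_integral_boundary[OF u] I_def p_def m0 .
  then have m0p: "m 0 \<le> p * I" using I by (simp add: field_simps)
  have p0: "p > 0" using m0p m0pos I by (metis less_le_trans zero_less_mult_pos2)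
  from p adm obtain E where E: "E \<le> 0" "has_second_derivative (\<lambda>t. measure ?M (perturbation K \<rho> t) powr p) E 0"
    unfolding concavity_exponent_def by blast
  have "has_second_derivative (\<lambda>t. m t powr p) E 0"
    by (rule has_second_derivative_transform[OF E(2)]) (use near in \<open>auto elim: eventually_mono\<close>)
  moreover have "\<forall>\<^sub>F t in nhds 0. m t > 0"
    using perturbation_measure_pos[OF u adm] near by eventually_elim simp
  moreover have "p \<noteq> 0" using p0 by simp
  ultimately obtain m1 D where m1: "\<forall>\<^sub>F t in nhds 0. (m has_real_derivative m1 t) (at t)"
    "(m1 has_real_derivative D) (at 0)"
    "\<And>r. has_second_derivative (\<lambda>t. m t powr r) (r * m 0 powr (r - 2) * (m 0 * D + (r - 1) * (m1 0)\<^sup>2)) 0"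
    and Ep: "has_second_derivative (\<lambda>t. m t powr p) E 0"
    using has_second_derivative_of_powr[of m p E 0] by blast
  have "p * m 0 powr (p - 2) * (m 0 * D + (p - 1) * (m1 0)\<^sup>2) \<le> 0"
    using has_second_derivative_unique[OF Ep m1(3)] E(1) by simp
  moreover have pm: "p * m 0 powr (p - 2) > 0" using p0 m0pos by simp
  ultimately have conc: "m 0 * D + (p - 1) * (m1 0)\<^sup>2 \<le> 0"
    using mult_le_cancel_left_pos[OF pm, of _ 0] by (simp only: mult_zero_right)
  have "I \<le> m1 0" by (rule I_le[OF eventually_nhds_x_imp_x[OF m1(1)]])
  then have "m 0 \<le> p * m1 0" "m1 0 > 0"
    using m0p I p0 by (auto intro: order_trans mult_left_mono)
  then have "m 0 * m1 0 \<le> p * (m1 0)\<^sup>2" by (simp add: power2_eq_square mult.assoc[symmetric])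
  then have "m 0 * D + m 0 * m1 0 \<le> (m1 0)\<^sup>2" using conc by (simp add: algebra_simps)
  then show thesis by (rule that[OF m1(1,2)])
qed

end

text \<open>The first derivatives given near each point agree on overlaps, since all of them are \<open>deriv f\<close>.\<close>

lemma concave_on_second_derivative:
  fixes f E :: "real \<Rightarrow> real"
  assumes "\<And>x. has_second_derivative f (E x) x" "\<And>x. E x \<le> 0"
  shows "concave_on UNIV f"
proof (rule f''_le0_imp_concave[where f' = "deriv f" and f'' = E])
  fix x
  from assms(1)[of x] obtain f' where f': "\<forall>\<^sub>F t in nhds x. (f has_real_derivative f' t) (at t)"
    "(f' has_real_derivative E x) (at x)" unfolding has_second_derivative_def by blast
  have "\<forall>\<^sub>F t in nhds x. f' t = deriv f t"
    using f'(1) by eventually_elim (rule DERIV_imp_deriv[symmetric])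
  then show "(deriv f has_real_derivative E x) (at x)"
    using f'(2) DERIV_cong_ev[OF refl _ refl] by blast
  show "(f has_real_derivative deriv f x) (at x)"
    using eventually_nhds_x_imp_x[OF f'(1)] DERIV_imp_deriv by metis
qed (use assms(2) in auto)

lemma log_concave_fun_if_concave_ln:
  assumes "\<And>t. f t > 0" "concave_on UNIV (\<lambda>t. ln (f t))"
  shows "log_concave_fun f"
  unfolding log_concave_fun_def
proof (intro conjI allI ballI)
  show "0 \<le> f x" for x using assms(1)[of x] by simp
  fix x y l :: real assume l: "l \<in> {0<..<1}"
  have "(1 - l) * ln (f x) + l * ln (f y) \<le> ln (f ((1 - l) *\<^sub>R x + l *\<^sub>R y))"
    using l by (intro concave_onD[OF assms(2)]) auto
  then have "exp ((1 - l) * ln (f x) + l * ln (f y)) \<le> f ((1 - l) * x + l * y)"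
    using assms(1) by (metis exp_le_cancel_iff exp_ln real_scaleR_def)
  then show "f x powr (1 - l) * f y powr l \<le> f ((1 - l) * x + l * y)"
    using assms(1)[of x] assms(1)[of y] by (simp add: powr_def exp_add)
qed

text \<open>For every \<open>\<tau>\<close> the dilate \<open>e\<^sup>\<tau>K\<close> is a body of the same kind, and \<open>\<mu>(e\<^sup>tK) = m(e\<^sup>t\<^sup>-\<^sup>\<tau> - 1)\<close> for
  \<open>m(s) = \<mu>((1+s)e\<^sup>\<tau>K)\<close>. By the chain rule the second derivative of the logarithm at \<open>\<tau>\<close> is
  \<open>(m m'' + m m' - m'\<^sup>2) / m\<^sup>2\<close>, evaluated at 0, and its sign is the second-order inequality for dilations.\<close>

lemma power_body_log_concave:
  fixes u :: "'a::euclidean_space \<Rightarrow> real"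
  assumes body: "power_body B q c" and u: "continuous_on UNIV u"
    and hyp: "\<And>K. C2_plus K \<Longrightarrow> origin_symmetric K \<Longrightarrow>
           measure (weighted_measure u) K /
             (\<integral>x. support_function K (gauss_map K x) \<partial>weighted_boundary_measure u K)
           \<le> concavity_power (weighted_measure u) K"
  shows "log_concave_fun (\<lambda>t. measure (weighted_measure u) ((*\<^sub>R) (exp t) ` power_body.K B q c))"
proof (rule log_concave_fun_if_concave_ln)
  interpret power_body B q c by (rule body)
  let ?G = "\<lambda>t. measure (weighted_measure u) ((*\<^sub>R) (exp t) ` K)"
  show pos: "?G t > 0" for t
    using scaled_C2_plus[of "exp t"] by (intro measure_weighted_measure_pos[OF u]) (auto simp: C2_plus_def)
  have "\<exists>E\<le>0. has_second_derivative (\<lambda>t. ln (?G t)) E \<tau>" for \<tau>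
  proof -
    let ?B = "(*\<^sub>R) (inverse (exp \<tau>)) ` B" and ?c = "c / exp \<tau> ^ (2 * q)"
    have body': "power_body ?B q ?c" by (rule power_body_scale(1)[OF body]) simp
    interpret S: power_body ?B q ?c by (rule body')
    have SK: "S.K = (*\<^sub>R) (exp \<tau>) ` K" by (rule power_body_scale(2)[OF body]) simp
    define m where "m = (\<lambda>t. measure (weighted_measure u) ((*\<^sub>R) (1 + t) ` S.K))"
    obtain m1 D where m1: "\<forall>\<^sub>F t in nhds 0. (m has_real_derivative m1 t) (at t)"
      "(m1 has_real_derivative D) (at 0)" "m 0 * D + m 0 * m1 0 \<le> (m1 0)\<^sup>2"
      by (rule S.dilation_second_order[OF u hyp[OF S.K_C2_plus S.K_symmetric] m_def]) blast
    define w where "w t = exp (t - \<tau>) - 1" for t :: real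
    have Gm: "?G t = m (w t)" for t
      by (simp add: m_def w_def SK image_image exp_diff)
    have w0: "w \<tau> = 0" by (simp add: w_def)
    have dw: "(w has_real_derivative exp (t - \<tau>)) (at t)" for t
      unfolding w_def[abs_def] by (auto intro!: derivative_eq_intros)
    have mpos: "m (w t) > 0" for t using pos[of t] by (simp add: Gm)
    have "(w \<longlongrightarrow> w \<tau>) (nhds \<tau>)"
      using DERIV_isCont[OF dw[of \<tau>]] unfolding isCont_def tendsto_at_iff_tendsto_nhds .
    then have "(w \<longlongrightarrow> 0) (nhds \<tau>)" by (simp only: w0)
    then have "\<forall>\<^sub>F t in nhds \<tau>. (m has_real_derivative m1 (w t)) (at (w t))"
      by (rule eventually_compose_filterlim[OF m1(1)])
    then have first: "\<forall>\<^sub>F t in nhds \<tau>. ((\<lambda>t. ln (m (w t))) has_real_derivative m1 (w t) * exp (t - \<tau>) / m (w t)) (at t)"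
    proof eventually_elim
      case (elim t)
      have "((\<lambda>t. m (w t)) has_real_derivative m1 (w t) * exp (t - \<tau>)) (at t)"
        by (rule DERIV_chain2[OF elim dw])
      from DERIV_chain2[OF DERIV_ln_divide[OF mpos[of t]] this]
      show ?case by simp
    qed
    have m10: "(m has_real_derivative m1 0) (at (w \<tau>))"
      unfolding w0 by (rule eventually_nhds_x_imp_x[OF m1(1)])
    have D0: "(m1 has_real_derivative D) (at (w \<tau>))"
      unfolding w0 by (rule m1(2))
    have w1: "(w has_real_derivative 1) (at \<tau>)" using dw[of \<tau>] by simp
    note dm = DERIV_chain2[OF m10 w1] and dm1 = DERIV_chain2[OF D0 w1]
    have de: "((\<lambda>t. exp (t - \<tau>)) has_real_derivative 1) (at \<tau>)"
      by (auto intro!: derivative_eq_intros)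
    define E where "E = (m 0 * D + m 0 * m1 0 - (m1 0)\<^sup>2) / (m 0)\<^sup>2"
    have m0: "m 0 > 0" using mpos[of \<tau>] by (simp add: w0)
    have "((\<lambda>t. m1 (w t) * exp (t - \<tau>) / m (w t)) has_real_derivative
        ((D * 1 * exp (\<tau> - \<tau>) + 1 * m1 (w \<tau>)) * m (w \<tau>) - m1 (w \<tau>) * exp (\<tau> - \<tau>) * (m1 0 * 1)) / (m (w \<tau>) * m (w \<tau>))) (at \<tau>)"
      by (rule DERIV_divide[OF DERIV_mult[OF dm1 de] dm]) (use mpos[of \<tau>] in simp)
    then have second: "((\<lambda>t. m1 (w t) * exp (t - \<tau>) / m (w t)) has_real_derivative E) (at \<tau>)"
      by (rule DERIV_cong) (simp add: w0 E_def power2_eq_square algebra_simps)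
    have "E \<le> 0" unfolding E_def using m1(3) by (intro divide_nonpos_nonneg) auto
    moreover have "has_second_derivative (\<lambda>t. ln (?G t)) E \<tau>"
      unfolding Gm by (rule has_second_derivativeI[OF first second])
    ultimately show ?thesis by blast
  qed
  then obtain E where "\<And>\<tau>. E \<tau> \<le> 0" "\<And>\<tau>. has_second_derivative (\<lambda>t. ln (?G t)) (E \<tau>) \<tau>" by metis
  then show "concave_on UNIV (\<lambda>t. ln (?G t))" by (intro concave_on_second_derivative)
qed

section \<open>Approximation of symmetric convex sets\<close>

lemma origin_symmetric_minus: "origin_symmetric K \<Longrightarrow> x \<in> K \<Longrightarrow> - x \<in> K"
  unfolding origin_symmetric_def by (metis image_eqI)

lemma zero_in_symmetric_convex:
  assumes "convex K" "origin_symmetric K" "K \<noteq> {}"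
  shows "0 \<in> K"
proof -
  obtain x where x: "x \<in> K" using assms(3) by blast
  have "(1/2) *\<^sub>R x + (1/2) *\<^sub>R (- x) \<in> K"
    by (rule convexD[OF assms(1) x origin_symmetric_minus[OF assms(2) x]]) auto
  then show ?thesis by simp
qed

lemma infdist_sublevel_compact:
  fixes K :: "'a::euclidean_space set"
  assumes "compact K" "K \<noteq> {}"
  shows "compact {x. infdist x K \<le> r}"
proof -
  obtain R where R: "\<And>x. x \<in> K \<Longrightarrow> norm x \<le> R" using compact_imp_bounded[OF assms(1)] unfolding bounded_iff by blast
  have "norm x \<le> R + r" if x: "infdist x K \<le> r" for x
  proof -
    obtain y where y: "y \<in> K" "infdist x K = dist x y"
      using infdist_attains_inf[OF compact_imp_closed[OF assms(1)] assms(2)] by metis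
    have "norm x \<le> norm y + dist x y" using norm_triangle_ineq[of y "x - y"] by (simp add: dist_norm)
    then show ?thesis using R[OF y(1)] y(2) x by linarith
  qed
  then have "bounded {x. infdist x K \<le> r}" unfolding bounded_iff by blast
  moreover have "closed {x. infdist x K \<le> r}" by (intro closed_Collect_le continuous_intros)
  ultimately show ?thesis by (simp add: compact_eq_bounded_closed)
qed

text \<open>A separating functional, normalised to take the value 1 on the separating hyperplane. By symmetry
  the bound on \<open>K\<close> is two-sided.\<close>

lemma symmetric_separation:
  fixes K :: "'a::euclidean_space set"
  assumes K: "compact K" "convex K" "origin_symmetric K" "K \<noteq> {}" and x: "x \<notin> K"
  obtains a where "\<And>y. y \<in> K \<Longrightarrow> \<bar>a \<bullet> y\<bar> < 1" "1 < a \<bullet> x"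
proof -
  obtain a b where ab: "a \<bullet> x < b" "\<And>y. y \<in> K \<Longrightarrow> b < a \<bullet> y"
    using separating_hyperplane_closed_point[OF K(2) compact_imp_closed[OF K(1)] x] by blast
  have b: "b < 0" using ab(2)[OF zero_in_symmetric_convex[OF K(2,3,4)]] by simp
  show thesis
  proof (rule that[of "a /\<^sub>R b"])
    fix y assume y: "y \<in> K"
    have "b < a \<bullet> y" "b < - (a \<bullet> y)"
      using ab(2)[OF y] ab(2)[OF origin_symmetric_minus[OF K(3) y]] by auto
    then have "\<bar>a \<bullet> y\<bar> < - b" by linarith
    then show "\<bar>(a /\<^sub>R b) \<bullet> y\<bar> < 1" using b by (simp add: abs_mult field_simps)
  next
    show "1 < (a /\<^sub>R b) \<bullet> x" using ab(1) b by (simp add: field_simps)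
  qed
qed

text \<open>Finitely many slabs \<open>|b \<bullet> x| < 1\<close> cut off all points at distance \<open>\<delta>\<close> from \<open>K\<close>; the
  number is finite by compactness. By convexity they cut off all points farther away. On \<open>K\<close> the
  linear forms are bounded by some \<open>\<theta> < 1\<close>, so for a large exponent the sum of their powers is at
  most \<open>1/2\<close>, and the constant \<open>c\<close> is chosen such that the remaining summand is at most \<open>1/2\<close>.\<close>

lemma power_body_approximation:
  fixes K :: "'a::euclidean_space set"
  assumes K: "compact K" "convex K" "origin_symmetric K" "K \<noteq> {}" and \<delta>: "\<delta> > 0"
  obtains B q c where "power_body B q c" "K \<subseteq> power_body.K B q c"
    "power_body.K B q c \<subseteq> {x. infdist x K \<le> \<delta>}"
proof -
  define C where "C = {x. infdist x K = \<delta>}"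
  define \<A> where "\<A> = {a. \<forall>y\<in>K. \<bar>a \<bullet> y\<bar> < 1}"
  have "closed C" unfolding C_def by (intro closed_Collect_eq continuous_intros)
  moreover have "C \<subseteq> {x. infdist x K \<le> \<delta>}" by (auto simp: C_def)
  ultimately have C: "compact C"
    using compact_Int_closed[OF infdist_sublevel_compact[OF K(1,4)], of C \<delta>] by (simp add: Int_absorb1)
  have cover: "C \<subseteq> (\<Union>a\<in>\<A>. {x. 1 < a \<bullet> x})"
  proof
    fix x assume "x \<in> C"
    then have "infdist x K \<noteq> 0" using \<delta> by (simp add: C_def)
    then have "x \<notin> K" by auto
    from symmetric_separation[OF K this] obtain a where "\<And>y. y \<in> K \<Longrightarrow> \<bar>a \<bullet> y\<bar> < 1" "1 < a \<bullet> x" by blast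
    then show "x \<in> (\<Union>a\<in>\<A>. {x. 1 < a \<bullet> x})" by (auto simp: \<A>_def)
  qed
  have op: "open {x. 1 < a \<bullet> x}" for a :: 'a
    by (intro open_Collect_less continuous_intros)
  obtain B where B: "B \<subseteq> \<A>" "finite B" "C \<subseteq> (\<Union>a\<in>B. {x. 1 < a \<bullet> x})"
    using compactE_image[OF C op cover] by metis
  have "\<exists>\<theta>. 0 \<le> \<theta> \<and> \<theta> < 1 \<and> (\<forall>b\<in>B. \<forall>y\<in>K. \<bar>b \<bullet> y\<bar> \<le> \<theta>)"
    using B(2,1)
  proof (induction B rule: finite_induct)
    case empty
    then show ?case by (intro exI[of _ "0::real"]) auto
  next
    case (insert b B)
    then obtain \<theta> where \<theta>: "0 \<le> \<theta>" "\<theta> < 1" "\<forall>b\<in>B. \<forall>y\<in>K. \<bar>b \<bullet> y\<bar> \<le> \<theta>" by auto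
    have "continuous_on K (\<lambda>y. \<bar>b \<bullet> y\<bar>)" by (intro continuous_intros)
    from continuous_attains_sup[OF K(1,4) this] obtain x where x: "x \<in> K" "\<forall>y\<in>K. \<bar>b \<bullet> y\<bar> \<le> \<bar>b \<bullet> x\<bar>" by blast
    have "\<bar>b \<bullet> x\<bar> < 1" using insert.prems x(1) by (auto simp: \<A>_def)
    with \<theta> x(2) show ?case
      by (intro exI[of _ "max \<theta> \<bar>b \<bullet> x\<bar>"]) (auto intro: max.coboundedI1 max.coboundedI2)
  qed
  then obtain \<theta> where \<theta>: "0 \<le> \<theta>" "\<theta> < 1" "\<And>b y. b \<in> B \<Longrightarrow> y \<in> K \<Longrightarrow> \<bar>b \<bullet> y\<bar> \<le> \<theta>" by blast
  have "0 < 1 / (2 * (real (card B) + 1))" by simp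
  from real_arch_pow_inv[OF this \<theta>(2)] obtain n where n: "\<theta> ^ n < 1 / (2 * (real (card B) + 1))" by blast
  define q where "q = max n 1"
  have q: "1 \<le> q" "n \<le> 2 * q" by (auto simp: q_def)
  obtain R where R: "R > 0" "\<And>x. x \<in> K \<Longrightarrow> norm x \<le> R" using compact_imp_bounded[OF K(1)] unfolding bounded_pos by blast
  define c where "c = 1 / (2 * R ^ (2 * q))"
  have c: "c > 0" using R by (simp add: c_def)
  have body: "power_body B q c" using B(2) q(1) c by unfold_locales
  interpret P: power_body B q c by (rule body)
  show thesis
  proof (rule that[OF body])
    show "K \<subseteq> P.K"
    proof
      fix y assume y: "y \<in> K"
      have "(b \<bullet> y) ^ (2 * q) \<le> 1 / (2 * (real (card B) + 1))" if b: "b \<in> B" for b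
      proof -
        have "(b \<bullet> y) ^ (2 * q) = \<bar>b \<bullet> y\<bar> ^ (2 * q)"
          by (rule power_even_abs[symmetric]) simp
        also have "\<dots> \<le> \<theta> ^ (2 * q)" by (rule power_mono[OF \<theta>(3)[OF b y]]) simp
        also have "\<dots> \<le> \<theta> ^ n" using \<theta> q(2) by (intro power_decreasing) auto
        finally show ?thesis using n by linarith
      qed
      then have "(\<Sum>b\<in>B. (b \<bullet> y) ^ (2 * q)) \<le> real (card B) * (1 / (2 * (real (card B) + 1)))"
        by (rule sum_bounded_above)
      also have "\<dots> \<le> 1 / 2" by (simp add: field_simps)
      finally have 1: "(\<Sum>b\<in>B. (b \<bullet> y) ^ (2 * q)) \<le> 1 / 2" .
      have "(y \<bullet> y) ^ q = norm y ^ (2 * q)" by (simp add: power_mult power2_norm_eq_inner)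
      also have "\<dots> \<le> R ^ (2 * q)" by (rule power_mono[OF R(2)[OF y]]) simp
      finally have "c * (y \<bullet> y) ^ q \<le> c * R ^ (2 * q)" using c by (intro mult_left_mono) auto
      also have "\<dots> = 1 / 2" using R by (simp add: c_def)
      finally show "y \<in> P.K" using 1 by (simp add: P.K_def P.\<phi>_def)
    qed
    show "P.K \<subseteq> {x. infdist x K \<le> \<delta>}"
    proof
      fix z assume z: "z \<in> P.K"
      show "z \<in> {x. infdist x K \<le> \<delta>}"
      proof (rule ccontr)
        assume "z \<notin> {x. infdist x K \<le> \<delta>}"
        then have far: "\<delta> < infdist z K" by simp
        have "0 \<in> K" by (rule zero_in_symmetric_convex[OF K(2,3,4)])
        then have "infdist (0 *\<^sub>R z) K \<le> \<delta>" using \<delta> by simp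
        moreover have "\<delta> \<le> infdist (1 *\<^sub>R z) K" using far by simp
        moreover have "continuous_on {0..1} (\<lambda>t. infdist (t *\<^sub>R z) K)" by (intro continuous_intros)
        ultimately obtain t where t: "0 \<le> t" "t \<le> 1" "infdist (t *\<^sub>R z) K = \<delta>"
          using IVT'[of "\<lambda>t. infdist (t *\<^sub>R z) K" 0 \<delta> 1] by auto
        then obtain b where b: "b \<in> B" "1 < b \<bullet> (t *\<^sub>R z)" using B(3) by (auto simp: C_def)
        have "1 < (b \<bullet> (t *\<^sub>R z)) ^ (2 * q)" using b(2) q(1) by (intro one_less_power) auto
        also have "\<dots> \<le> (\<Sum>b\<in>B. (b \<bullet> (t *\<^sub>R z)) ^ (2 * q))"
          using B(2) b(1) by (intro member_le_sum) auto
        also have "\<dots> \<le> P.\<phi> (t *\<^sub>R z)"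
        proof -
          have "0 \<le> c * (t *\<^sub>R z \<bullet> t *\<^sub>R z) ^ q"
            using c by (intro mult_nonneg_nonneg zero_le_power inner_ge_zero) simp
          then show ?thesis unfolding P.\<phi>_def by linarith
        qed
        also have "\<dots> = t ^ (2 * q) * P.\<phi> z" by (rule P.phi_scale)
        also have "\<dots> \<le> 1 * 1"
          using t z P.phi_nonneg by (intro mult_mono) (auto simp: P.K_def power_le_one)
        finally show False by simp
      qed
    qed
  qed
qed

lemma log_concave_fun_limit:
  assumes "\<And>j. log_concave_fun (f j)" "\<And>t. (\<lambda>j. f j t) \<longlonglongrightarrow> F t"
  shows "log_concave_fun F"
  unfolding log_concave_fun_def
proof (intro conjI allI ballI)
  have nonneg: "0 \<le> f j x" for j x using assms(1) by (simp add: log_concave_fun_def)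
  show F0: "0 \<le> F x" for x by (rule LIMSEQ_le_const[OF assms(2)]) (use nonneg in auto)
  fix x y l :: real assume l: "l \<in> {0<..<1}"
  have pw: "(\<lambda>j. f j z powr r) \<longlonglongrightarrow> F z powr r" if "r > 0" for z r
    using that nonneg by (intro tendsto_powr2 assms(2) tendsto_const) auto
  show "F x powr (1 - l) * F y powr l \<le> F ((1 - l) * x + l * y)"
  proof (rule LIMSEQ_le)
    show "(\<lambda>j. f j x powr (1 - l) * f j y powr l) \<longlonglongrightarrow> F x powr (1 - l) * F y powr l"
      using l by (intro tendsto_mult pw) auto
    show "(\<lambda>j. f j ((1 - l) * x + l * y)) \<longlonglongrightarrow> F ((1 - l) * x + l * y)" by (rule assms(2))
    show "\<exists>N. \<forall>n\<ge>N. f n x powr (1 - l) * f n y powr l \<le> f n ((1 - l) * x + l * y)"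
      using assms(1) l by (auto simp: log_concave_fun_def)
  qed
qed

text \<open>Continuity of the measure from above along the neighbourhoods of \<open>K\<close>, which are bounded and
  therefore of finite measure.\<close>

lemma measure_dilates_tendsto:
  fixes K :: "'a::euclidean_space set"
  assumes u: "continuous_on UNIV u" and K: "compact K" "K \<noteq> {}" and s: "s > 0"
    and L: "\<And>j. compact (L j)" "\<And>j. K \<subseteq> L j" "\<And>j. L j \<subseteq> {x. infdist x K \<le> inverse (real (Suc j))}"
  shows "(\<lambda>j. measure (weighted_measure u) ((*\<^sub>R) s ` L j)) \<longlonglongrightarrow> measure (weighted_measure u) ((*\<^sub>R) s ` K)"
proof -
  let ?M = "weighted_measure u"
  define A where "A j = (*\<^sub>R) s ` {x. infdist x K \<le> inverse (real (Suc j))}" for j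
  have cA: "compact (A j)" for j
    unfolding A_def by (intro compact_scaling infdist_sublevel_compact K)
  have fin: "C \<in> fmeasurable ?M" if "compact C" for C
    using that emeasure_weighted_measure_finite[OF u, of C]
    by (auto simp: fmeasurable_def borel_compact compact_imp_bounded)
  have "(\<Inter>j. A j) = (*\<^sub>R) s ` K"
  proof
    show "(*\<^sub>R) s ` K \<subseteq> (\<Inter>j. A j)" unfolding A_def by (intro INT_greatest image_mono) auto
    show "(\<Inter>j. A j) \<subseteq> (*\<^sub>R) s ` K"
    proof
      fix x assume x: "x \<in> (\<Inter>j. A j)"
      have small: "infdist (x /\<^sub>R s) K \<le> inverse (real (Suc j))" for j
      proof -
        from x have "x \<in> A j" by blast
        then show ?thesis using s by (auto simp: A_def)
      qed
      have "infdist (x /\<^sub>R s) K \<le> 0"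
        by (rule LIMSEQ_le_const[OF LIMSEQ_inverse_real_of_nat]) (use small in auto)
      then have "infdist (x /\<^sub>R s) K = 0" using infdist_nonneg[of "x /\<^sub>R s" K] by linarith
      then have "x /\<^sub>R s \<in> K" using in_closed_iff_infdist_zero[OF compact_imp_closed[OF K(1)] K(2)] by blast
      then show "x \<in> (*\<^sub>R) s ` K" using s by (intro image_eqI[of _ _ "x /\<^sub>R s"]) auto
    qed
  qed
  moreover have "decseq A"
    unfolding A_def by (intro decseq_SucI image_mono) (auto elim!: order_trans intro!: le_imp_inverse_le)
  moreover have "(\<lambda>j. measure ?M (A j)) \<longlonglongrightarrow> measure ?M (\<Inter>j. A j)" if "decseq A"
    using fin[OF cA] that by (intro Lim_measure_decseq) (auto simp: fmeasurable_def less_top)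
  ultimately have lim: "(\<lambda>j. measure ?M (A j)) \<longlonglongrightarrow> measure ?M ((*\<^sub>R) s ` K)" by simp
  have lower: "measure ?M ((*\<^sub>R) s ` K) \<le> measure ?M ((*\<^sub>R) s ` L j)" for j
    by (rule measure_mono_fmeasurable[OF image_mono[OF L(2)] fmeasurableD[OF fin[OF compact_scaling[OF K(1)]]]
          fin[OF compact_scaling[OF L(1)]]])
  have upper: "measure ?M ((*\<^sub>R) s ` L j) \<le> measure ?M (A j)" for j
    by (rule measure_mono_fmeasurable[OF _ fmeasurableD[OF fin[OF compact_scaling[OF L(1)]]] fin[OF cA]])
      (unfold A_def, rule image_mono[OF L(3)])
  show ?thesis
    by (rule real_tendsto_sandwich[OF always_eventually[OF allI[OF lower]]
          always_eventually[OF allI[OF upper]] tendsto_const lim])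
qed

theorem theorem1p1:
  fixes u :: "real^'n::finite \<Rightarrow> real"
  assumes "C2_on UNIV u"
    and "\<And>x. u (- x) = u x"
    and "\<And>x. positive_definite (hessian u x)"
    and "\<And>K. C2_plus K \<Longrightarrow> origin_symmetric K \<Longrightarrow>
           measure (weighted_measure u) K /
             (\<integral>x. support_function K (gauss_map K x) \<partial>weighted_boundary_measure u K)
           \<le> concavity_power (weighted_measure u) K"
  shows "\<forall>K. compact K \<and> convex K \<and> origin_symmetric K \<longrightarrow>
           log_concave_fun (\<lambda>t. measure (weighted_measure u) ((\<lambda>x. exp t *\<^sub>R x) ` K))"
proof (intro allI impI)
  fix K :: "(real^'n) set"
  assume K: "compact K \<and> convex K \<and> origin_symmetric K"
  have u: "continuous_on UNIV u"
  proof -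
    from assms(1) obtain u' where "\<forall>x\<in>UNIV. (u has_derivative blinfun_apply (u' x)) (at x)"
      unfolding C2_on_def by blast
    then show ?thesis
      by (intro continuous_at_imp_continuous_on ballI) (rule has_derivative_continuous, erule bspec)
  qed
  show "log_concave_fun (\<lambda>t. measure (weighted_measure u) ((\<lambda>x. exp t *\<^sub>R x) ` K))"
  proof (cases "K = {}")
    case True
    then show ?thesis by (simp add: log_concave_fun_def)
  next
    case False
    have "\<exists>L. compact L \<and> K \<subseteq> L \<and> L \<subseteq> {x. infdist x K \<le> inverse (real (Suc j))} \<and>
        log_concave_fun (\<lambda>t. measure (weighted_measure u) ((*\<^sub>R) (exp t) ` L))" for j
    proof -
      have "inverse (real (Suc j)) > 0" by simp
      then obtain B q c where body: "power_body B q c" and sub: "K \<subseteq> power_body.K B q c"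
        "power_body.K B q c \<subseteq> {x. infdist x K \<le> inverse (real (Suc j))}"
        using power_body_approximation[of K] K False by blast
      show ?thesis
        using power_body_log_concave[OF body u assms(4)] power_body.K_compact[OF body] sub by blast
    qed
    then have "\<exists>L. \<forall>j. compact (L j) \<and> K \<subseteq> L j \<and> L j \<subseteq> {x. infdist x K \<le> inverse (real (Suc j))} \<and>
        log_concave_fun (\<lambda>t. measure (weighted_measure u) ((*\<^sub>R) (exp t) ` L j))"
      by (intro choice allI)
    then obtain L where L: "\<And>j. compact (L j)" "\<And>j. K \<subseteq> L j"
      "\<And>j. L j \<subseteq> {x. infdist x K \<le> inverse (real (Suc j))}"
      "\<And>j. log_concave_fun (\<lambda>t. measure (weighted_measure u) ((*\<^sub>R) (exp t) ` L j))" by blast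
    show ?thesis
    proof (rule log_concave_fun_limit[OF L(4)])
      fix t
      show "(\<lambda>j. measure (weighted_measure u) ((*\<^sub>R) (exp t) ` L j)) \<longlonglongrightarrow>
          measure (weighted_measure u) ((\<lambda>x. exp t *\<^sub>R x) ` K)"
        using K False L by (intro measure_dilates_tendsto[OF u]) auto
    qed
  qed
qed

end
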